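(* (1) Let $\nu$ be a probability measure on $[0,1]^2$ both of whose marginals are uniform on $[0,1]$. Let $(U_1,V_1),(U_2,V_2),\ldots$ be independent pairs of random variables, each distributed according to $\nu$. Let $\lhd$ be the ordering of $\mathbb{N}$ given by $k\lhd k'$ iff $U_k<U_{k'}$, and let $\lhd'$ be the ordering of $\mathbb{N}$ given by $k\lhd' k'$ iff $V_k<V_{k'}$ (both are almost surely well-defined strict total orderings). Let $\hat\nu(\lhd,\cdot)$ be a regular conditional probability for $\lhd'$ given $\lhd$. Then $\kappa=\hat\nu$ satisfies the commutation relation: for every bijection $r:\mathbb{N}\to\mathbb{N}$ and every measurable $A\subseteq\tilde{\mathcal{O}}$, $$\kappa(\hat r(\lhd),\hat r(A))=\kappa(\lhd,A)\qquad\text{for }\lambda\text{-almost all }\lhd.$$ (2) Conversely, every transition kernel $\kappa$ on $\tilde{\mathcal{O}}$ satisfying this commutation relation (for every bijection $r$ of $\mathbb{N}$ and every measurable $A$) is a mixture of kernels constructed in this manner: there exist a probability measure $\alpha$ on the set of probability measures $\nu$ on $[0,1]^2$ having both marginals uniform on $[0,1]$, and a choice of versions of the regular conditional probabilities $\hat\nu$ (with $(\nu,\lhd)\mapsto\hat\nu(\lhd,A)$ measurable for each measurable $A$), such that $$\kappa(\lhd,\cdot)=\int\alpha(d\nu)\,\hat\nu(\lhd,\cdot).$$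
   Context: $\mathbb{N}=\{1,2,\ldots\}$. $\tilde{\mathcal{O}}$ is the set of all strict total orderings of $\mathbb{N}$, with the $\sigma$-algebra inherited as a subset of $2^{\mathbb{N}\times\mathbb{N}}$. $\lambda$ is the unique probability measure on $\tilde{\mathcal{O}}$ such that, for each $n$, the restriction of the ordering to $\{1,\ldots,n\}$ is uniformly distributed over all $n!$ orderings; equivalently, $\lambda$ is the law of the ordering $k\lhd k'$ iff $U_k<U_{k'}$ where $U_1,U_2,\ldots$ are independent uniform random variables on $[0,1]$. For a bijection $r:\mathbb{N}\to\mathbb{N}$, the induced relabelling $\hat r:\tilde{\mathcal{O}}\to\tilde{\mathcal{O}}$ sends $\lhd$ to the ordering in which $k$ is less than $k'$ iff $r(k)\lhd r(k')$; for $A\subseteq\tilde{\mathcal{O}}$, $\hat r(A)$ denotes the image of $A$. A transition kernel $\kappa$ on $\tilde{\mathcal{O}}$ assigns to each $\lhd$ a probability measure $\kappa(\lhd,\cdot)$ on $\tilde{\mathcal{O}}$, measurably in $\lhd$. The set of probability measures on $[0,1]^2$ carries the Borel $\sigma$-algebra of the weak topology. *)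

theory Defs
  imports "HOL-Probability.Probability"
begin

section \<open>Strict total orderings of the natural numbers\<close>

text \<open>
  An ordering is a relation \<open>R :: nat rel\<close>, where \<open>(k, k') \<in> R\<close> reads ``\<open>k\<close> is less than \<open>k'\<close>''.
  The label set \<open>{1, 2, \<dots>}\<close> is represented by the type \<open>nat\<close> (label \<open>k + 1\<close> being \<open>k\<close>); labels
  are only ever compared through \<open>R\<close> and permuted by arbitrary bijections.
\<close>

definition orderings :: "nat rel set" where
  "orderings = {R. strict_linear_order R}"

text \<open>
  Identifying a relation with its indicator function in \<open>2\<^bsup>\<nat>\<times>\<nat>\<^esup>\<close>, this is the trace of the product
  \<open>\<sigma>\<close>-algebra.
\<close>

definition ordering_space :: "nat rel measure" where
  "ordering_space = vimage_algebra orderings (\<lambda>R p. p \<in> R) (\<Pi>\<^sub>M p\<in>(UNIV :: (nat \<times> nat) set). count_space (UNIV :: bool set))"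

text \<open>
  The ordering of the labels by the values \<open>u k\<close>. In case of ties the values do not define a
  total ordering, and the usual one is returned by convention; for independent uniform values this
  happens with probability 0 only.
\<close>

definition ordering_of :: "(nat \<Rightarrow> real) \<Rightarrow> nat rel" where
  "ordering_of u = (if inj u then {(k, k'). u k < u k'} else less_than)"

definition uniform01 :: "real measure" where
  "uniform01 = uniform_measure lborel {0..1}"

text \<open>
  The measure \<open>\<lambda>\<close>: the unique probability measure on orderings under which, for each \<open>n\<close>, all \<open>n!\<close>
  orderings of the first \<open>n\<close> labels are equally likely.
\<close>

definition uniform_ordering :: "nat rel measure" where
  "uniform_ordering = distr (\<Pi>\<^sub>M k\<in>(UNIV :: nat set). uniform01) ordering_space ordering_of"

definition relabel :: "(nat \<Rightarrow> nat) \<Rightarrow> nat rel \<Rightarrow> nat rel" where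
  "relabel r R = {(k, k'). (r k, r k') \<in> R}"


section \<open>Kernels and regular conditional probabilities\<close>

text \<open>
  The \<open>\<sigma>\<close>-algebra of \<^const>\<open>prob_algebra\<close> is generated by the evaluations \<open>P \<mapsto> P A\<close>, so a measurable
  map into it is a transition kernel.
\<close>

abbreviation ordering_kernel :: "(nat rel \<Rightarrow> nat rel measure) \<Rightarrow> bool" where
  "ordering_kernel \<kappa> \<equiv> \<kappa> \<in> ordering_space \<rightarrow>\<^sub>M prob_algebra ordering_space"

definition commutes_with_relabelling :: "(nat rel \<Rightarrow> nat rel measure) \<Rightarrow> bool" where
  "commutes_with_relabelling \<kappa> \<longleftrightarrow>
     (\<forall>r. bij r \<longrightarrow> (\<forall>A\<in>sets ordering_space.
        AE R in uniform_ordering. emeasure (\<kappa> (relabel r R)) (relabel r ` A) = emeasure (\<kappa> R) A))"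

text \<open>\<open>\<kappa>\<close> is a regular conditional probability for \<open>Y\<close> given \<open>X\<close> under the probability measure \<open>M\<close>.\<close>

definition regular_cond_prob ::
  "'a measure \<Rightarrow> 'b measure \<Rightarrow> ('a \<Rightarrow> 'b) \<Rightarrow> 'c measure \<Rightarrow> ('a \<Rightarrow> 'c) \<Rightarrow> ('b \<Rightarrow> 'c measure) \<Rightarrow> bool" where
  "regular_cond_prob M S X T Y \<kappa> \<longleftrightarrow>
     \<kappa> \<in> S \<rightarrow>\<^sub>M prob_algebra T \<and>
     (\<forall>B\<in>sets T. AE \<omega> in M.
        measure (\<kappa> (X \<omega>)) B
          = real_cond_exp M (vimage_algebra (space M) X S) (indicator (Y -` B \<inter> space M)) \<omega>)"


section \<open>Probability measures on the unit square\<close>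

abbreviation unit_square :: "(real \<times> real) set" where
  "unit_square \<equiv> {0..1} \<times> {0..1}"

definition prob_measures_on :: "'a::topological_space set \<Rightarrow> 'a measure set" where
  "prob_measures_on X = {\<nu>. sets \<nu> = sets (restrict_space borel X) \<and> prob_space \<nu>}"

text \<open>The coarsest topology making \<open>\<nu> \<mapsto> \<integral> f d\<nu>\<close> continuous for all bounded continuous \<open>f\<close> on \<open>X\<close>.\<close>

definition weak_topology :: "'a::topological_space set \<Rightarrow> 'a measure topology" where
  "weak_topology X = topology_generated_by
     {{\<nu> \<in> prob_measures_on X. (\<integral>x. f x \<partial>\<nu>) \<in> G} | (f :: 'a \<Rightarrow> real) G.
        continuous_on X f \<and> bounded (f ` X) \<and> open G}"

definition weak_borel :: "'a::topological_space set \<Rightarrow> 'a measure measure" where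
  "weak_borel X = sigma (prob_measures_on X) {W. openin (weak_topology X) W}"

definition uniform_couplings :: "(real \<times> real) measure set" where
  "uniform_couplings = {\<nu> \<in> prob_measures_on unit_square.
     distr \<nu> borel fst = uniform01 \<and> distr \<nu> borel snd = uniform01}"

definition coupling_space :: "(real \<times> real) measure measure" where
  "coupling_space = restrict_space (weak_borel unit_square) uniform_couplings"

text \<open>
  \<open>(U 0, V 0), (U 1, V 1), \<dots>\<close> are independent pairs of random variables on \<open>M\<close>, each with law \<open>\<nu>\<close>.
\<close>

definition iid_pairs ::
  "'a measure \<Rightarrow> (nat \<Rightarrow> 'a \<Rightarrow> real) \<Rightarrow> (nat \<Rightarrow> 'a \<Rightarrow> real) \<Rightarrow> (real \<times> real) measure \<Rightarrow> bool" where
  "iid_pairs M U V \<nu> \<longleftrightarrow>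
     prob_space M \<and>
     prob_space.indep_vars M (\<lambda>_. restrict_space borel unit_square) (\<lambda>k \<omega>. (U k \<omega>, V k \<omega>)) UNIV \<and>
     (\<forall>k. distr M (restrict_space borel unit_square) (\<lambda>\<omega>. (U k \<omega>, V k \<omega>)) = \<nu>)"

text \<open>
  \<open>\<kappa>\<close> is a version of the kernel \<open>\<nu>\<close>-hat when \<open>U\<close>, \<open>V\<close> are independent pairs with law \<open>\<nu>\<close>.
\<close>

definition coupling_kernel ::
  "'a measure \<Rightarrow> (nat \<Rightarrow> 'a \<Rightarrow> real) \<Rightarrow> (nat \<Rightarrow> 'a \<Rightarrow> real) \<Rightarrow> (nat rel \<Rightarrow> nat rel measure) \<Rightarrow> bool" where
  "coupling_kernel M U V \<kappa> \<longleftrightarrow>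
     regular_cond_prob M
       ordering_space (\<lambda>\<omega>. ordering_of (\<lambda>k. U k \<omega>))
       ordering_space (\<lambda>\<omega>. ordering_of (\<lambda>k. V k \<omega>)) \<kappa>"

text \<open>
  The canonical model: the coordinate pairs on the infinite product of copies of \<open>\<nu>\<close>. The versions
  of the kernel depend only on the joint law of the two orderings, hence only on \<open>\<nu>\<close>.
\<close>

definition coupling_kernel_version :: "(real \<times> real) measure \<Rightarrow> (nat rel \<Rightarrow> nat rel measure) \<Rightarrow> bool" where
  "coupling_kernel_version \<nu> \<kappa> \<longleftrightarrow>
     coupling_kernel (\<Pi>\<^sub>M k\<in>(UNIV :: nat set). \<nu>) (\<lambda>k \<omega>. fst (\<omega> k)) (\<lambda>k \<omega>. snd (\<omega> k)) \<kappa>"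


section \<open>Well-definedness\<close>

lemma space_ordering_space [simp]: "space ordering_space = orderings"
  by (simp add: ordering_space_def)

lemma ordering_of_in_orderings: "ordering_of u \<in> orderings"
proof (cases "inj u")
  case True
  then have "total_on UNIV {(k, k'). u k < u k'}"
    by (auto simp: total_on_def inj_def) (meson linorder_neqE_linordered_idom)
  with True show ?thesis
    by (auto simp: ordering_of_def orderings_def strict_linear_order_on_def trans_def irrefl_def)
next
  case False
  then show ?thesis
    by (auto simp: ordering_of_def orderings_def strict_linear_order_on_def trans_def irrefl_def
        total_on_def)
qed

lemma measurable_ordering_of [measurable]:
  "ordering_of \<in> (\<Pi>\<^sub>M k\<in>(UNIV :: nat set). (borel :: real measure)) \<rightarrow>\<^sub>M ordering_space"
  unfolding ordering_space_def
proof (rule measurable_vimage_algebra2)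
  let ?P = "\<Pi>\<^sub>M k\<in>(UNIV :: nat set). (borel :: real measure)"
  show "ordering_of \<in> space ?P \<rightarrow> orderings"
    using ordering_of_in_orderings by auto
  have [measurable]: "Measurable.pred ?P inj"
  proof -
    have "inj = (\<lambda>u :: nat \<Rightarrow> real. \<forall>i j. u i = u j \<longrightarrow> i = j)"
      by (auto simp: inj_def fun_eq_iff)
    also have "Measurable.pred ?P \<dots>"
    proof (intro pred_intros_countable pred_intros_logic)
      fix i j :: nat
      show "Measurable.pred ?P (\<lambda>u. u i = u j)"
        unfolding pred_def by (rule borel_measurable_eq) measurable
      show "Measurable.pred ?P (\<lambda>u. i = j)"
        by (rule measurable_const) simp
    qed
    finally show ?thesis .
  qed
  have "(\<lambda>u. p \<in> ordering_of u) \<in> ?P \<rightarrow>\<^sub>M count_space UNIV" for p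
  proof -
    have "(\<lambda>u. p \<in> ordering_of u) = (\<lambda>u. (inj u \<and> u (fst p) < u (snd p)) \<or> (\<not> inj u \<and> fst p < snd p))"
      by (cases p) (auto simp: ordering_of_def fun_eq_iff)
    also have "\<dots> \<in> ?P \<rightarrow>\<^sub>M count_space UNIV"
      by measurable
    finally show ?thesis .
  qed
  then show "(\<lambda>u p. p \<in> ordering_of u) \<in> ?P \<rightarrow>\<^sub>M (\<Pi>\<^sub>M p\<in>UNIV. count_space UNIV)"
    by (intro measurable_PiM_single') auto
qed

lemma prob_space_uniform01: "prob_space uniform01"
  unfolding uniform01_def by (rule prob_space_uniform_measure) auto

lemma prob_space_uniform_ordering: "prob_space uniform_ordering"
  unfolding uniform_ordering_def
proof (rule prob_space.prob_space_distr)
  show "prob_space (\<Pi>\<^sub>M k\<in>(UNIV :: nat set). uniform01)"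
    by (intro prob_space_PiM prob_space_uniform01)
  have "sets (\<Pi>\<^sub>M k\<in>(UNIV :: nat set). uniform01) = sets (\<Pi>\<^sub>M k\<in>(UNIV :: nat set). borel)"
    by (intro sets_PiM_cong) (auto simp: uniform01_def)
  then show "ordering_of \<in> (\<Pi>\<^sub>M k\<in>(UNIV :: nat set). uniform01) \<rightarrow>\<^sub>M ordering_space"
    using measurable_ordering_of by (simp cong: measurable_cong_sets)
qed

text \<open>Ties have probability 0, so the convention in \<^const>\<open>ordering_of\<close> is immaterial.\<close>

lemma AE_inj_iid_uniform01:
  assumes "prob_space M" and indep: "prob_space.indep_vars M (\<lambda>_. borel) X UNIV"
    and law: "\<And>k :: nat. distr M borel (X k) = uniform01"
  shows "AE \<omega> in M. inj (\<lambda>k. X k \<omega>)"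
proof -
  interpret prob_space M by fact
  interpret u: prob_space uniform01 by (rule prob_space_uniform01)
  interpret u2: pair_prob_space uniform01 uniform01 ..
  have sets_u [measurable_cong, simp]: "sets uniform01 = sets borel"
    by (simp add: uniform01_def)
  have [measurable]: "X k \<in> borel_measurable M" for k
    using indep by (auto simp: indep_vars_def)
  have single: "emeasure uniform01 {x} = 0" for x
  proof -
    have "emeasure lborel ({0..1} \<inter> {x}) \<le> emeasure lborel {x}"
      by (intro emeasure_mono) auto
    then show ?thesis by (simp add: uniform01_def emeasure_uniform_measure)
  qed
  have diag: "AE p in uniform01 \<Otimes>\<^sub>M uniform01. fst p \<noteq> snd p"
  proof (rule u2.AE_pair_measure)
    show "{p \<in> space (uniform01 \<Otimes>\<^sub>M uniform01). fst p \<noteq> snd p} \<in> sets (uniform01 \<Otimes>\<^sub>M uniform01)"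
      by measurable
    have "AE y in uniform01. y \<noteq> x" for x
      by (rule AE_I[where N = "{x}"]) (auto simp: single)
    then show "AE x in uniform01. AE y in uniform01. fst (x, y) \<noteq> snd (x, y)"
      by (auto simp: eq_commute)
  qed
  have "AE \<omega> in M. X i \<omega> \<noteq> X j \<omega>" if "i \<noteq> j" for i j
  proof -
    have "indep_var borel (X i) borel (X j)"
    proof -
      have "indep_var
          borel ((\<lambda>f. f i) \<circ> (\<lambda>\<omega>. restrict (\<lambda>i. X i \<omega>) {i}))
          borel ((\<lambda>f. f j) \<circ> (\<lambda>\<omega>. restrict (\<lambda>i. X i \<omega>) {j}))"
        using that by (intro indep_var_compose[OF indep_var_restrict[OF indep]]) auto
      then show ?thesis by (simp add: comp_def)
    qed
    then have eq: "distr M (borel \<Otimes>\<^sub>M borel) (\<lambda>\<omega>. (X i \<omega>, X j \<omega>)) = uniform01 \<Otimes>\<^sub>M uniform01"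
      by (simp add: indep_var_distribution_eq law)
    show ?thesis
      using diag unfolding eq[symmetric] by (subst (asm) AE_distr_iff) auto
  qed
  then have "AE \<omega> in M. \<forall>i j. i \<noteq> j \<longrightarrow> X i \<omega> \<noteq> X j \<omega>"
    by (simp add: AE_all_countable)
  then show ?thesis
    by eventually_elim (auto simp: inj_def)
qed

lemma AE_inj_iid_pairs:
  assumes "iid_pairs M U V \<nu>" and "\<nu> \<in> uniform_couplings"
  shows "AE \<omega> in M. inj (\<lambda>k. U k \<omega>) \<and> inj (\<lambda>k. V k \<omega>)"
proof -
  let ?S = "restrict_space borel unit_square :: (real \<times> real) measure"
  interpret prob_space M
    using assms by (simp add: iid_pairs_def)
  have indep: "indep_vars (\<lambda>_. ?S) (\<lambda>k \<omega>. (U k \<omega>, V k \<omega>)) UNIV"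
    and law: "\<And>k. distr M ?S (\<lambda>\<omega>. (U k \<omega>, V k \<omega>)) = \<nu>"
    using assms by (auto simp: iid_pairs_def)
  have [measurable]: "fst \<in> ?S \<rightarrow>\<^sub>M borel" "snd \<in> ?S \<rightarrow>\<^sub>M borel"
    by (auto intro!: measurable_restrict_space1 simp: borel_prod[symmetric])
  have meas: "(\<lambda>\<omega>. (U k \<omega>, V k \<omega>)) \<in> M \<rightarrow>\<^sub>M ?S" for k
    using indep by (auto simp: indep_vars_def)
  have "indep_vars (\<lambda>_. borel) U UNIV"
    using indep_vars_compose2[OF indep, of "\<lambda>_. fst" "\<lambda>_. borel"] by simp
  moreover have "distr M borel (U k) = uniform01" for k
    using distr_distr[OF \<open>fst \<in> ?S \<rightarrow>\<^sub>M borel\<close> meas[of k]] assms(2)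
    by (simp add: law uniform_couplings_def comp_def)
  moreover have "indep_vars (\<lambda>_. borel) V UNIV"
    using indep_vars_compose2[OF indep, of "\<lambda>_. snd" "\<lambda>_. borel"] by simp
  moreover have "distr M borel (V k) = uniform01" for k
    using distr_distr[OF \<open>snd \<in> ?S \<rightarrow>\<^sub>M borel\<close> meas[of k]] assms(2)
    by (simp add: law uniform_couplings_def comp_def)
  ultimately show ?thesis
    using AE_inj_iid_uniform01[OF prob_space_axioms, of U]
      AE_inj_iid_uniform01[OF prob_space_axioms, of V] by simp
qed

end

theory Submission
  imports Defs
begin

text \<open>
  (1) The joint law of the two orderings of an independent sequence of pairs is invariant under
  simultaneous relabelling, since the pairs are exchangeable. Its disintegrations over the first
  ordering are unique up to null sets, so they commute with relabelling.

  (2) If \<open>\<kappa>\<close> commutes with relabelling, then the law \<open>Q\<close> of a pair of orderings with first component of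
  law \<open>\<lambda>\<close> and second component drawn from \<open>\<kappa>\<close> is invariant under simultaneous relabelling. Both
  marginals of \<open>Q\<close> are relabelling invariant, hence equal to \<open>\<lambda>\<close>. Under \<open>\<lambda>\<close> the limiting frequencies
  \<open>lim (1/n) #{i < n. i \<lhd> k}\<close> are independent uniform variables which determine the ordering, so
  \<open>Q\<close> is the law of the orderings induced by an exchangeable sequence of pairs \<open>(U\<^sub>k, V\<^sub>k)\<close> in the
  square with uniform marginals. The limiting empirical distribution function of the pairs is a
  random copula, and de Finetti's argument represents \<open>Q\<close> as the mixture of the joint laws of
  orderings over the couplings with these copulas. Comparing disintegrations gives the mixture
  representation for almost all orderings.

  The conditional kernels have to depend measurably on the coupling. They come from one explicit
  construction: the conditional distribution function of \<open>V\<close> given \<open>U\<close> is the limit of the difference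
  quotients of the copula over finer and finer grids, along a subsequence chosen measurably, and the
  corresponding quantile function turns independent uniform noise into the second ordering.
\<close>

text \<open>The commutation relation comes with a null set that depends on the bijection and on the
  event, so it cannot be used pointwise; it enters only in integrated form, as invariance of the
  single joint law \<open>Q\<close>. Passing from orderings to limiting ranks trades relations for
  real pairs, for which distribution functions are available. Two demands of the conclusion shape
  the rest. The versions must be jointly measurable in the coupling and the ordering, which a
  separate choice of disintegration for each coupling does not ensure; so a coupling is encoded by
  its masses on countably many rational corners, and one sampling formula, measurable in these
  masses, serves all couplings. Moreover the mixture identity must hold for every ordering, not only
  for almost every one; a countable generating family of cylinders yields a single exceptional null
  set, on which versions may be changed freely.\<close>

section \<open>Almost sure convergence of dyadic means\<close>

text \<open>The weight (4/3)^j is small enough for the weighted second moments, at most K (2/3)^j,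
  to be summable, and large enough for its reciprocal (3/4)^j to be summable; any base strictly
  between 1 and 2 would serve.\<close>

lemma AE_summable_of_geometric_L2:
  fixes D :: "nat \<Rightarrow> 'a \<Rightarrow> real"
  assumes [measurable]: "\<And>j. D j \<in> borel_measurable M"
    and int: "\<And>j. integrable M (\<lambda>x. (D j x)\<^sup>2)"
    and bound: "\<And>j. (\<integral>x. (D j x)\<^sup>2 \<partial>M) \<le> K * (1/2)^j"
  shows "AE x in M. summable (\<lambda>j. D j x)"
proof -
  have K: "0 \<le> K"
    using order_trans[OF integral_nonneg_AE bound[of 0]] by simp
  have step: "(\<integral>\<^sup>+x. ennreal ((4/3)^j * (D j x)\<^sup>2) \<partial>M) \<le> ennreal (K * (2/3)^j)" for j
  proof -
    have "(\<integral>\<^sup>+x. ennreal ((4/3)^j * (D j x)\<^sup>2) \<partial>M) = ennreal (\<integral>x. (4/3)^j * (D j x)\<^sup>2 \<partial>M)"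
      using int by (intro nn_integral_eq_integral) auto
    also have "\<dots> \<le> ennreal ((4/3)^j * (K * (1/2)^j))"
      using bound[of j] by (intro ennreal_leI) simp
    also have "(4/3::real)^j * (K * (1/2)^j) = K * (2/3)^j"
      by (simp add: power_mult_distrib[symmetric])
    finally show ?thesis .
  qed
  have "(\<integral>\<^sup>+x. (\<Sum>j. ennreal ((4/3)^j * (D j x)\<^sup>2)) \<partial>M)
      = (\<Sum>j. \<integral>\<^sup>+x. ennreal ((4/3)^j * (D j x)\<^sup>2) \<partial>M)"
    by (intro nn_integral_suminf) simp
  also have "\<dots> \<le> (\<Sum>j. ennreal (K * (2/3)^j))"
    by (intro suminf_le step) auto
  also have "\<dots> = ennreal (\<Sum>j. K * (2/3)^j)"
    using K by (intro suminf_ennreal2) (auto intro!: summable_mult)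
  finally have "(\<integral>\<^sup>+x. (\<Sum>j. ennreal ((4/3)^j * (D j x)\<^sup>2)) \<partial>M) \<noteq> \<infinity>"
    by (auto simp: top_unique)
  then have "AE x in M. (\<Sum>j. ennreal ((4/3)^j * (D j x)\<^sup>2)) \<noteq> \<infinity>"
    by (intro nn_integral_PInf_AE) auto
  then show ?thesis
  proof eventually_elim
    case (elim x)
    then have "summable (\<lambda>j. (4/3)^j * (D j x)\<^sup>2)"
      by (intro summable_suminf_not_top) auto
    moreover have "summable (\<lambda>j. (3/4::real)^j)"
      by simp
    ultimately have "summable (\<lambda>j. (3/4)^j + (4/3)^j * (D j x)\<^sup>2)"
      by (intro summable_add)
    then show ?case
    proof (rule summable_comparison_test')
      fix j :: nat
      \<comment> \<open>Expanding the square gives 2 |D| \<le> (3/4)^j + (4/3)^j D^2, which turns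
        summability of the weighted squares into absolute summability.\<close>
      have "0 \<le> (3/4)^j * (1 - (4/3)^j * \<bar>D j x\<bar>)\<^sup>2"
        by simp
      also have "\<dots> = (3/4)^j - 2 * ((3/4)^j * (4/3)^j) * \<bar>D j x\<bar> + ((3/4)^j * (4/3)^j) * (4/3)^j * (D j x)\<^sup>2"
        by (simp add: power2_eq_square algebra_simps)
      also have "(3/4)^j * (4/3::real)^j = 1"
        by (simp add: power_mult_distrib[symmetric])
      finally show "norm (D j x) \<le> (3/4)^j + (4/3)^j * (D j x)\<^sup>2"
        by simp
    qed
  qed
qed

text \<open>
  Averages over the first \<open>2\<^sup>j\<close> terms: consecutive ones differ by geometrically small amounts in mean
  square, which is enough for almost sure convergence without a strong law for the full sequence.
\<close>

definition dyadic_mean :: "(nat \<Rightarrow> real) \<Rightarrow> nat \<Rightarrow> real" where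
  "dyadic_mean a j = (\<Sum>i<2^j. a i) / 2^j"

lemma dyadic_mean_mono: "(\<And>i. a i \<le> b i) \<Longrightarrow> dyadic_mean a j \<le> dyadic_mean b j"
  unfolding dyadic_mean_def by (intro divide_right_mono sum_mono) auto

lemma dyadic_mean_const [simp]: "dyadic_mean (\<lambda>_. c) j = c"
  by (simp add: dyadic_mean_def)

lemma dyadic_mean_add: "dyadic_mean (\<lambda>i. a i + b i) j = dyadic_mean a j + dyadic_mean b j"
  by (simp add: dyadic_mean_def sum.distrib add_divide_distrib)

lemma dyadic_mean_diff: "dyadic_mean (\<lambda>i. a i - b i) j = dyadic_mean a j - dyadic_mean b j"
  by (simp add: dyadic_mean_def sum_subtractf diff_divide_distrib)

lemma dyadic_mean_bounds:
  assumes "\<And>i. l \<le> a i" "\<And>i. a i \<le> u"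
  shows "l \<le> dyadic_mean a j" "dyadic_mean a j \<le> u"
  using dyadic_mean_mono[of "\<lambda>_. l" a j] dyadic_mean_mono[of a "\<lambda>_. u" j] assms by auto

lemma measurable_dyadic_mean [measurable (raw)]:
  "(\<And>i. (\<lambda>x. a x i) \<in> borel_measurable M) \<Longrightarrow> (\<lambda>x. dyadic_mean (a x) j) \<in> borel_measurable M"
  unfolding dyadic_mean_def by (intro borel_measurable_divide borel_measurable_sum) auto

text \<open>General weights cover both uses: for the difference of consecutive dyadic means they sum
  to 0 and the term with \<open>c\<close> cancels, for a single dyadic mean they sum to 1.\<close>

lemma (in prob_space) expectation_weighted_sum_square:
  fixes X :: "'i \<Rightarrow> 'a \<Rightarrow> real"
  assumes [measurable]: "\<And>i. X i \<in> borel_measurable M" and bdd: "\<And>i x. \<bar>X i x\<bar> \<le> 1"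
    and c: "\<And>i k. i \<noteq> k \<Longrightarrow> expectation (\<lambda>x. X i x * X k x) = c"
    and b: "\<And>i. expectation (\<lambda>x. (X i x)\<^sup>2) = b"
    and fin: "finite I"
  shows "expectation (\<lambda>x. (\<Sum>i\<in>I. w i * X i x)\<^sup>2) = c * (\<Sum>i\<in>I. w i)\<^sup>2 + (b - c) * (\<Sum>i\<in>I. (w i)\<^sup>2)"
proof -
  have int: "integrable M (\<lambda>x. X i x * X k x)" for i k
    using bdd mult_mono[OF bdd bdd]
    by (intro integrable_const_bound[where B = 1]) (auto simp: abs_mult)
  have E: "expectation (\<lambda>x. X i x * X k x) = c + (if i = k then b - c else 0)" for i k
    using c[of i k] b[of i] by (auto simp: power2_eq_square)
  have "expectation (\<lambda>x. (\<Sum>i\<in>I. w i * X i x)\<^sup>2)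
      = expectation (\<lambda>x. \<Sum>i\<in>I. \<Sum>k\<in>I. (w i * w k) * (X i x * X k x))"
    by (simp add: power2_eq_square sum_product algebra_simps)
  also have "\<dots> = (\<Sum>i\<in>I. \<Sum>k\<in>I. (w i * w k) * (c + (if i = k then b - c else 0)))"
  proof -
    have "expectation (\<lambda>x. \<Sum>i\<in>I. \<Sum>k\<in>I. (w i * w k) * (X i x * X k x))
        = (\<Sum>i\<in>I. expectation (\<lambda>x. \<Sum>k\<in>I. (w i * w k) * (X i x * X k x)))"
      by (intro Bochner_Integration.integral_sum Bochner_Integration.integrable_sum integrable_mult_right int)
    also have "\<dots> = (\<Sum>i\<in>I. \<Sum>k\<in>I. expectation (\<lambda>x. (w i * w k) * (X i x * X k x)))"
      by (intro sum.cong refl Bochner_Integration.integral_sum integrable_mult_right int)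
    finally show ?thesis
      by (simp add: E)
  qed
  also have "\<dots> = (\<Sum>i\<in>I. \<Sum>k\<in>I. c * (w i * w k)) + (\<Sum>i\<in>I. \<Sum>k\<in>I. if i = k then (b - c) * (w i)\<^sup>2 else 0)"
    by (subst sum.distrib[symmetric], intro sum.cong refl, subst sum.distrib[symmetric])
      (auto intro!: sum.cong simp: algebra_simps power2_eq_square)
  also have "(\<Sum>i\<in>I. \<Sum>k\<in>I. c * (w i * w k)) = c * (\<Sum>i\<in>I. w i)\<^sup>2"
    unfolding power2_eq_square sum_product by (simp add: sum_distrib_left)
  also have "(\<Sum>i\<in>I. \<Sum>k\<in>I. if i = k then (b - c) * (w i)\<^sup>2 else 0) = (b - c) * (\<Sum>i\<in>I. (w i)\<^sup>2)"
    using fin by (simp add: sum.delta sum_distrib_left)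
  finally show ?thesis .
qed

text \<open>A difference of consecutive means carries weights +1/2^(j+1) and -1/2^(j+1) with sum 0,
  so its second moment is (b - c)/2^(j+1) for any value of \<open>c\<close>. This covers
  exchangeable variables, whose limit is random.\<close>

lemma (in prob_space) AE_convergent_dyadic_mean:
  fixes X :: "nat \<Rightarrow> 'a \<Rightarrow> real"
  assumes [measurable]: "\<And>i. X i \<in> borel_measurable M" and bdd: "\<And>i x. \<bar>X i x\<bar> \<le> 1"
    and c: "\<And>i k. i \<noteq> k \<Longrightarrow> expectation (\<lambda>x. X i x * X k x) = c"
    and b: "\<And>i. expectation (\<lambda>x. (X i x)\<^sup>2) = b"
  shows "AE x in M. convergent (dyadic_mean (\<lambda>i. X i x))"
proof -
  define D where "D j x = dyadic_mean (\<lambda>i. X i x) (Suc j) - dyadic_mean (\<lambda>i. X i x) j" for j x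
  have mean_bdd: "\<bar>dyadic_mean (\<lambda>i. X i x) j\<bar> \<le> 1" for j x
    using dyadic_mean_bounds[of "-1" "\<lambda>i. X i x" 1 j] bdd[of _ x] by (simp add: abs_le_iff minus_le_iff)
  have D_meas[measurable]: "D j \<in> borel_measurable M" for j
    unfolding D_def by measurable
  have D_bdd: "(D j x)\<^sup>2 \<le> 4" for j x
  proof -
    have "\<bar>D j x\<bar> \<le> 2"
      unfolding D_def using mean_bdd[of x "Suc j"] mean_bdd[of x j] by linarith
    then show ?thesis
      using power_mono[of "\<bar>D j x\<bar>" 2 2] by simp
  qed
  have int: "integrable M (\<lambda>x. (D j x)\<^sup>2)" for j
    using D_bdd by (intro integrable_const_bound[where B = 4]) auto
  have split: "(\<Sum>i<2*2^j. f i) = (\<Sum>i<2^j. f i) + (\<Sum>i\<in>{2^j..<2*2^j}. f i)"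
    for f :: "nat \<Rightarrow> real" and j :: nat
    by (subst sum.union_disjoint[symmetric]) (auto intro!: sum.cong)
  have D_eq: "D j x = (\<Sum>i<2*2^j. (if i < 2^j then -1 else 1) / (2 * 2^j) * X i x)" for j x
  proof -
    have "(\<Sum>i<2*2^j. (if i < 2^j then -1 else 1) / (2 * 2^j) * X i x)
        = (\<Sum>i<2^j. - X i x) / (2 * 2^j) + (\<Sum>i\<in>{2^j..<2*2^j}. X i x) / (2 * 2^j)"
      by (subst split) (simp add: sum_divide_distrib)
    also have "\<dots> = D j x"
      by (simp add: D_def dyadic_mean_def split sum_negf field_simps)
    finally show ?thesis ..
  qed
  have "expectation (\<lambda>x. (D j x)\<^sup>2) = (b - c) / 2 * (1/2)^j" for j
  proof -
    have sgn0: "(\<Sum>i<2*2^j::nat. (if i < 2^j then -1 else 1) / (2 * 2^j) :: real) = 0"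
    proof -
      have "(\<Sum>i<2*2^j::nat. (if i < 2^j then -1 else 1) / (2 * 2^j) :: real)
          = (\<Sum>i<2^j::nat. - 1 / (2 * 2^j)) + (\<Sum>i\<in>{2^j::nat..<2*2^j}. 1 / (2 * 2^j))"
        by (subst split) (simp add: sum_negf)
      then show ?thesis by simp
    qed
    have "expectation (\<lambda>x. (D j x)\<^sup>2)
        = (b - c) * (\<Sum>i<2*2^j::nat. ((if i < 2^j then -1 else 1) / (2 * 2^j))\<^sup>2)"
      unfolding D_eq by (subst expectation_weighted_sum_square[OF assms(1) bdd c b]) (auto simp: sgn0)
    also have "(\<Sum>i<2*2^j::nat. ((if i < 2^j then -1 else 1) / (2 * 2^j))\<^sup>2) = (\<Sum>i<(2::nat)*2^j. (1 / (2 * 2^j))\<^sup>2 :: real)"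
      by (intro sum.cong) (auto simp: power_divide)
    finally show ?thesis
      by (simp add: power2_eq_square field_simps power_one_over)
  qed
  then have "AE x in M. summable (\<lambda>j. D j x)"
    by (intro AE_summable_of_geometric_L2[OF D_meas int, where K = "(b - c) / 2"]) simp
  then show ?thesis
  proof eventually_elim
    case (elim x)
    have "(\<Sum>k<j. D k x) + dyadic_mean (\<lambda>i. X i x) 0 = dyadic_mean (\<lambda>i. X i x) j" for j
      unfolding D_def by (induction j) auto
    moreover have "(\<lambda>j. (\<Sum>k<j. D k x) + dyadic_mean (\<lambda>i. X i x) 0)
        \<longlonglongrightarrow> suminf (\<lambda>j. D j x) + dyadic_mean (\<lambda>i. X i x) 0"
      by (intro tendsto_intros summable_LIMSEQ elim)
    ultimately show ?case
      by (auto simp: convergent_def)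
  qed
qed

text \<open>For uncorrelated variables the deviations from \<open>m\<close> themselves, and not only
  the increments, have geometrically small second moments; they form a summable series and hence
  tend to 0.\<close>

lemma (in prob_space) AE_dyadic_mean_tendsto:
  fixes X :: "nat \<Rightarrow> 'a \<Rightarrow> real"
  assumes [measurable]: "\<And>i. X i \<in> borel_measurable M" and bdd: "\<And>i x. \<bar>X i x\<bar> \<le> 1"
    and c: "\<And>i k. i \<noteq> k \<Longrightarrow> expectation (\<lambda>x. X i x * X k x) = m\<^sup>2"
    and b: "\<And>i. expectation (\<lambda>x. (X i x)\<^sup>2) = b"
    and m: "\<And>i. expectation (X i) = m"
  shows "AE x in M. dyadic_mean (\<lambda>i. X i x) \<longlonglongrightarrow> m"
proof -
  have mean_bdd: "\<bar>dyadic_mean (\<lambda>i. X i x) j\<bar> \<le> 1" for j x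
    using dyadic_mean_bounds[of "-1" "\<lambda>i. X i x" 1 j] bdd[of _ x] by (simp add: abs_le_iff minus_le_iff)
  have intX: "integrable M (X i)" for i
    using bdd by (intro integrable_const_bound[where B = 1]) auto
  have int1: "integrable M (\<lambda>x. dyadic_mean (\<lambda>i. X i x) j)" for j
    using mean_bdd by (intro integrable_const_bound[where B = 1]) auto
  have int2: "integrable M (\<lambda>x. (dyadic_mean (\<lambda>i. X i x) j)\<^sup>2)" for j
    using mean_bdd by (intro integrable_const_bound[where B = 1]) (auto simp: abs_square_le_1)
  have sq: "(dyadic_mean (\<lambda>i. X i x) j - m)\<^sup>2
      = (dyadic_mean (\<lambda>i. X i x) j)\<^sup>2 - 2 * m * dyadic_mean (\<lambda>i. X i x) j + m\<^sup>2" for x j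
    by (simp add: power2_eq_square algebra_simps)
  have int: "integrable M (\<lambda>x. (dyadic_mean (\<lambda>i. X i x) j - m)\<^sup>2)" for j
    unfolding sq using int1 int2 by auto
  have E1: "expectation (\<lambda>x. dyadic_mean (\<lambda>i. X i x) j) = m" for j
    unfolding dyadic_mean_def using intX by (simp add: m)
  have E2: "expectation (\<lambda>x. (dyadic_mean (\<lambda>i. X i x) j)\<^sup>2) = m\<^sup>2 + (b - m\<^sup>2) * (1/2)^j" for j
  proof -
    have "expectation (\<lambda>x. (dyadic_mean (\<lambda>i. X i x) j)\<^sup>2) = expectation (\<lambda>x. (\<Sum>i<2^j. 1/2^j * X i x)\<^sup>2)"
      by (simp add: dyadic_mean_def sum_divide_distrib)
    then show ?thesis
      by (subst (asm) expectation_weighted_sum_square[OF assms(1) bdd c b])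
        (auto simp: power2_eq_square power_one_over field_simps)
  qed
  have "expectation (\<lambda>x. (dyadic_mean (\<lambda>i. X i x) j - m)\<^sup>2) = (b - m\<^sup>2) * (1/2)^j" for j
    unfolding sq using int1 int2
    by (simp add: E1 E2 prob_space) (simp add: power2_eq_square algebra_simps)
  then have "AE x in M. summable (\<lambda>j. dyadic_mean (\<lambda>i. X i x) j - m)"
    by (intro AE_summable_of_geometric_L2[OF _ int, where K = "b - m\<^sup>2"]) auto
  then show ?thesis
    by eventually_elim (auto dest: summable_LIMSEQ_zero simp: LIM_zero_iff)
qed

section \<open>Uniform sequences and the uniform ordering\<close>

text \<open>This is the distribution function of the uniform law on the unit interval; it doubles as
  the retraction of the line onto that interval.\<close>

definition clip :: "real \<Rightarrow> real" where
  "clip x = max 0 (min 1 x)"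

lemma clip_bounds [simp]: "0 \<le> clip x" "clip x \<le> 1"
  by (auto simp: clip_def)

lemma clip_diff_le: "x \<le> y \<Longrightarrow> clip y - clip x \<le> y - x"
  by (auto simp: clip_def)

lemma clip_id: "0 \<le> x \<Longrightarrow> x \<le> 1 \<Longrightarrow> clip x = x"
  by (auto simp: clip_def)

lemma clip_measurable [measurable]: "clip \<in> borel_measurable borel"
  unfolding clip_def[abs_def] by measurable

lemma sets_uniform01 [measurable_cong, simp]: "sets uniform01 = sets borel"
  by (simp add: uniform01_def)

lemma space_uniform01 [simp]: "space uniform01 = UNIV"
  by (simp add: uniform01_def)

lemma emeasure_uniform01: "A \<in> sets borel \<Longrightarrow> emeasure uniform01 A = emeasure lborel ({0..1} \<inter> A)"
  by (simp add: uniform01_def emeasure_uniform_measure divide_ennreal_def)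

lemma measure_uniform01_lessThan: "measure uniform01 {..<q} = clip q"
proof -
  have "emeasure lborel ({0..1} \<inter> {..<q}) = ennreal (clip q)"
  proof (cases "q \<le> 1")
    case True
    then have "{0..1} \<inter> {..<q} = {0..<q}" by auto
    with True show ?thesis by (cases "0 \<le> q") (auto simp: clip_def)
  next
    case False
    then have "{0..1} \<inter> {..<q} = {0..1}" by auto
    with False show ?thesis by (auto simp: clip_def)
  qed
  then show ?thesis
    by (simp add: measure_def emeasure_uniform01)
qed

lemma AE_uniform01: "AE x in uniform01. 0 \<le> x \<and> x < 1"
proof (rule AE_I[where N = "- {0..<1}"])
  have "{0..1} \<inter> - {0..<1} = {1::real}"
    by auto
  then show "emeasure uniform01 (- {0..<1}) = 0"
    by (simp add: emeasure_uniform01)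
qed auto

abbreviation uniform_sequence :: "(nat \<Rightarrow> real) measure" where
  "uniform_sequence \<equiv> \<Pi>\<^sub>M k\<in>UNIV. uniform01"

interpretation uniform01: prob_space uniform01
  by (rule prob_space_uniform01)

interpretation uniform_seq: product_prob_space "\<lambda>_. uniform01" "UNIV :: nat set"
  by standard

lemma sets_uniform_sequence: "sets uniform_sequence = sets (\<Pi>\<^sub>M k\<in>UNIV. borel)"
  by (intro sets_PiM_cong) auto

lemma space_uniform_sequence [simp]: "space uniform_sequence = UNIV"
  by (simp add: space_PiM)

text \<open>These properties, almost sure for independent uniform values, let the ordering give back
  the sequence. Rational thresholds keep the conditions countable. Excluding the value 1 means that
  a strict upper bound by a rational \<ge> 1 is always satisfied.\<close>

definition typical :: "(nat \<Rightarrow> real) \<Rightarrow> bool" where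
  "typical u \<longleftrightarrow> inj u \<and> (\<forall>k. 0 \<le> u k \<and> u k < 1) \<and>
     (\<forall>q :: rat. dyadic_mean (\<lambda>i. of_bool (u i < of_rat q)) \<longlonglongrightarrow> clip (of_rat q))"

lemma AE_typical: "AE u in uniform_sequence. typical u"
proof -
  let ?P = uniform_sequence
  have comp: "distr ?P borel (\<lambda>u. u k) = uniform01" for k
    using distr_PiM_component[of UNIV "\<lambda>_. uniform01" k] prob_space_uniform01
    by (simp cong: distr_cong)
  have "AE u in ?P. inj (\<lambda>k. u k)"
  proof (rule AE_inj_iid_uniform01[OF _ _ comp])
    show "prob_space ?P" by (rule uniform_seq.P.prob_space_axioms)
    have "distr ?P (\<Pi>\<^sub>M i\<in>UNIV. borel) (\<lambda>x. restrict x UNIV) = ?P"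
      by (subst distr_cong[OF refl sets_uniform_sequence[symmetric], of _ _ "\<lambda>x. x"])
        (auto simp: distr_id)
    then show "uniform_seq.P.indep_vars (\<lambda>_. borel) (\<lambda>k u. u k) UNIV"
      by (subst uniform_seq.P.indep_vars_iff_distr_eq_PiM) (auto simp: comp)
  qed
  moreover have "AE u in ?P. \<forall>k. 0 \<le> u k \<and> u k < 1"
    unfolding AE_all_countable
    by (intro allI AE_PiM_component[OF prob_space_uniform01 _ AE_uniform01]) auto
  moreover have "AE u in ?P. \<forall>q :: rat. dyadic_mean (\<lambda>i. of_bool (u i < of_rat q)) \<longlonglongrightarrow> clip (of_rat q)"
    unfolding AE_all_countable
  proof
    fix r :: rat
    define q :: real where "q = of_rat r"
    have one: "uniform_seq.P.expectation (\<lambda>u. of_bool (u i < q) :: real) = clip q" for i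
    proof -
      have "uniform_seq.P.expectation (\<lambda>u. of_bool (u i < q) :: real) = uniform_seq.P.expectation (indicator {u. u i < q})"
        by (intro Bochner_Integration.integral_cong) (auto simp: indicator_def)
      also have "\<dots> = measure ?P {u. u i < q}"
        by simp
      also have "emeasure ?P {u. u i < q} = emeasure uniform01 {..<q}"
        using uniform_seq.emeasure_PiM_Collect_single[of i "{..<q}"] by simp
      then have "measure ?P {u. u i < q} = clip q"
        by (simp add: measure_def[of ?P]) (simp add: measure_uniform01_lessThan[symmetric] measure_def)
      finally show ?thesis .
    qed
    have two: "uniform_seq.P.expectation (\<lambda>u. of_bool (u i < q) * of_bool (u k < q) :: real) = (clip q)\<^sup>2" if "i \<noteq> k" for i k
    proof -
      have "uniform_seq.P.expectation (\<lambda>u. of_bool (u i < q) * of_bool (u k < q) :: real)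
          = uniform_seq.P.expectation (indicator {u. \<forall>j\<in>{i, k}. u j \<in> {..<q}})"
        by (intro Bochner_Integration.integral_cong) (auto simp: indicator_def)
      also have "\<dots> = measure ?P {u. \<forall>j\<in>{i, k}. u j \<in> {..<q}}"
        by simp
      also have "emeasure ?P {u. \<forall>j\<in>{i, k}. u j \<in> {..<q}} = (\<Prod>j\<in>{i, k}. emeasure uniform01 {..<q})"
        using uniform_seq.emeasure_PiM_Collect[of "{i, k}" "\<lambda>_. {..<q}"] by simp
      then have "measure ?P {u. \<forall>j\<in>{i, k}. u j \<in> {..<q}} = (clip q)\<^sup>2"
        using that by (simp add: measure_def[of ?P] enn2real_mult power2_eq_square)
          (simp add: measure_uniform01_lessThan[symmetric] measure_def)
      finally show ?thesis .
    qed
    show "AE u in ?P. dyadic_mean (\<lambda>i. of_bool (u i < of_rat r)) \<longlonglongrightarrow> clip (of_rat r)"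
      unfolding q_def[symmetric]
    proof (rule uniform_seq.P.AE_dyadic_mean_tendsto[where b = "clip q"])
      show "uniform_seq.P.expectation (\<lambda>u. (of_bool (u i < q) :: real)\<^sup>2) = clip q" for i
        using one[of i] by (simp add: power2_eq_square flip: of_bool_conj)
    qed (simp_all add: one two)
  qed
  ultimately show ?thesis
    by eventually_elim (auto simp: typical_def)
qed


section \<open>Measurability of orderings and their limiting ranks\<close>

lemma measurable_mem_ordering [measurable]: "(\<lambda>R. p \<in> R) \<in> ordering_space \<rightarrow>\<^sub>M count_space UNIV"
proof -
  have "(\<lambda>R p. p \<in> R) \<in> ordering_space \<rightarrow>\<^sub>M (\<Pi>\<^sub>M p\<in>(UNIV :: (nat \<times> nat) set). count_space (UNIV :: bool set))"
    unfolding ordering_space_def by (rule measurable_vimage_algebra1) (auto simp: space_PiM)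
  from measurable_compose[OF this measurable_component_singleton[of p]] show ?thesis
    by simp
qed

lemma measurable_into_ordering_space:
  assumes "f \<in> space M \<rightarrow> orderings" "\<And>p. Measurable.pred M (\<lambda>x. p \<in> f x)"
  shows "f \<in> M \<rightarrow>\<^sub>M ordering_space"
  unfolding ordering_space_def
proof (rule measurable_vimage_algebra2)
  show "(\<lambda>x p. p \<in> f x) \<in> M \<rightarrow>\<^sub>M (\<Pi>\<^sub>M p\<in>UNIV. count_space UNIV)"
    using assms(2) by (intro measurable_PiM_single') auto
qed (rule assms(1))

text \<open>The outer \<^const>\<open>clip\<close> guards against the arbitrary value of \<^const>\<open>lim\<close> on divergent sequences.\<close>

definition limit_rank :: "nat rel \<Rightarrow> nat \<Rightarrow> real" where
  "limit_rank R k = clip (lim (dyadic_mean (\<lambda>i. of_bool ((i, k) \<in> R))))"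

lemma limit_rank_bounds [simp]: "0 \<le> limit_rank R k" "limit_rank R k \<le> 1"
  by (simp_all add: limit_rank_def)

lemma measurable_limit_rank_component [measurable]: "(\<lambda>R. limit_rank R k) \<in> borel_measurable ordering_space"
  unfolding limit_rank_def by measurable

lemma measurable_limit_rank [measurable]: "limit_rank \<in> ordering_space \<rightarrow>\<^sub>M (\<Pi>\<^sub>M k\<in>UNIV. borel)"
  by (intro measurable_PiM_single') auto

text \<open>The frequency of values below \<open>u k\<close> is squeezed between the frequencies
  below rationals on either side of \<open>u k\<close>, whose limits are known for typical
  \<open>u\<close>.\<close>

lemma rank_ordering_of:
  assumes u: "typical u"
  shows "limit_rank (ordering_of u) = u"
proof
  fix k
  let ?m = "dyadic_mean (\<lambda>i. of_bool (u i < u k))"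
  have mean: "dyadic_mean (\<lambda>i. of_bool (u i < q)) \<longlonglongrightarrow> clip q" if "q \<in> \<rat>" for q
    using u that by (auto simp: typical_def elim!: Rats_cases)
  have uk: "0 \<le> u k" "u k < 1"
    using u by (auto simp: typical_def)
  have "?m \<longlonglongrightarrow> u k"
  proof (rule order_tendstoI)
    fix a assume "a < u k"
    then obtain q where q: "q \<in> \<rat>" "a < q" "q < u k"
      using Rats_dense_in_real by blast
    then have "a < clip q" using uk by (auto simp: clip_def)
    then have "eventually (\<lambda>j. a < dyadic_mean (\<lambda>i. of_bool (u i < q)) j) sequentially"
      using mean[OF q(1)] by (auto dest: order_tendstoD)
    then show "eventually (\<lambda>j. a < ?m j) sequentially"
    proof eventually_elim
      case (elim j)
      have "dyadic_mean (\<lambda>i. of_bool (u i < q)) j \<le> ?m j"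
        by (rule dyadic_mean_mono) (use q in auto)
      with elim show ?case by simp
    qed
  next
    fix a assume "u k < a"
    then obtain q where q: "q \<in> \<rat>" "u k < q" "q < a"
      using Rats_dense_in_real by blast
    then have "clip q < a" using uk by (auto simp: clip_def)
    then have "eventually (\<lambda>j. dyadic_mean (\<lambda>i. of_bool (u i < q)) j < a) sequentially"
      using mean[OF q(1)] by (auto dest: order_tendstoD)
    then show "eventually (\<lambda>j. ?m j < a) sequentially"
    proof eventually_elim
      case (elim j)
      have "?m j \<le> dyadic_mean (\<lambda>i. of_bool (u i < q)) j"
        by (rule dyadic_mean_mono) (use q in auto)
      with elim show ?case by simp
    qed
  qed
  then have "lim ?m = u k"
    by (rule limI)
  moreover have "inj u"
    using u by (auto simp: typical_def)
  ultimately show "limit_rank (ordering_of u) k = u k"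
    using uk by (simp add: limit_rank_def ordering_of_def clip_id)
qed

lemma measurable_ordering_of_uniform [measurable]: "ordering_of \<in> uniform_sequence \<rightarrow>\<^sub>M ordering_space"
  using measurable_ordering_of by (simp add: sets_uniform_sequence cong: measurable_cong_sets)

lemma measurable_ordering_of_component [measurable (raw)]:
  assumes "\<And>k. (\<lambda>x. u x k) \<in> borel_measurable M"
  shows "(\<lambda>x. ordering_of (u x)) \<in> M \<rightarrow>\<^sub>M ordering_space"
  using assms by (intro measurable_compose[OF _ measurable_ordering_of] measurable_PiM_single') auto

lemma sets_uniform_ordering [measurable_cong, simp]: "sets uniform_ordering = sets ordering_space"
  by (simp add: uniform_ordering_def)

lemma space_uniform_ordering [simp]: "space uniform_ordering = orderings"
  by (simp add: uniform_ordering_def)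

interpretation uniform_ordering: prob_space uniform_ordering
  by (rule prob_space_uniform_ordering)

lemma measurable_typical [measurable]: "Measurable.pred (\<Pi>\<^sub>M k\<in>UNIV. borel) typical"
proof -
  have "Measurable.pred (\<Pi>\<^sub>M k\<in>UNIV. borel) (\<lambda>u :: nat \<Rightarrow> real. \<forall>i j. i \<noteq> j \<longrightarrow> u i \<noteq> u j)"
    by (intro pred_intros_countable pred_intros_logic borel_measurable_neq[folded pred_def]) auto
  moreover have "(\<lambda>u :: nat \<Rightarrow> real. \<forall>i j. i \<noteq> j \<longrightarrow> u i \<noteq> u j) = inj"
    by (auto simp: inj_def fun_eq_iff)
  ultimately have [measurable]: "Measurable.pred (\<Pi>\<^sub>M k\<in>UNIV. borel) (inj :: (nat \<Rightarrow> real) \<Rightarrow> bool)"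
    by simp
  show ?thesis
    unfolding typical_def[abs_def] by measurable
qed

lemma AE_uniform_ordering: "AE R in uniform_ordering. typical (limit_rank R) \<and> ordering_of (limit_rank R) = R"
proof -
  \<comment> \<open>Equality of relations is spelled out as countably many membership statements, so
    that the event is visibly measurable and can be pulled back along
    \<open>ordering_of\<close>.\<close>
  have *: "AE R in uniform_ordering. typical (limit_rank R) \<and> (\<forall>p. p \<in> ordering_of (limit_rank R) \<longleftrightarrow> p \<in> R)"
    unfolding uniform_ordering_def
  proof (subst AE_distr_iff)
    show "AE u in uniform_sequence. typical (limit_rank (ordering_of u)) \<and>
        (\<forall>p. p \<in> ordering_of (limit_rank (ordering_of u)) \<longleftrightarrow> p \<in> ordering_of u)"
      using AE_typical by eventually_elim (simp add: rank_ordering_of)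
  qed measurable
  then show ?thesis
    by eventually_elim auto
qed

lemma distr_rank_uniform_ordering:
  "distr uniform_ordering (\<Pi>\<^sub>M k\<in>UNIV. borel) limit_rank = uniform_sequence"
proof -
  have "distr uniform_ordering (\<Pi>\<^sub>M k\<in>UNIV. borel) limit_rank
      = distr uniform_sequence (\<Pi>\<^sub>M k\<in>UNIV. borel) (\<lambda>u. limit_rank (ordering_of u))"
    unfolding uniform_ordering_def by (subst distr_distr) (auto simp: comp_def)
  also have "\<dots> = distr uniform_sequence uniform_sequence (\<lambda>u. u)"
  proof (intro distr_cong_AE)
    show "AE u in uniform_sequence. limit_rank (ordering_of u) = u"
      using AE_typical by eventually_elim (simp add: rank_ordering_of)
  qed (auto simp: sets_uniform_sequence cong: measurable_cong_sets)
  finally show ?thesis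
    by (simp add: distr_id)
qed


section \<open>Relabelling, cylinder events and the uniqueness of the invariant law\<close>

lemma orderings_iff:
  "R \<in> orderings \<longleftrightarrow> (\<forall>i j k. (i, j) \<in> R \<longrightarrow> (j, k) \<in> R \<longrightarrow> (i, k) \<in> R) \<and> (\<forall>i. (i, i) \<notin> R)
     \<and> (\<forall>i j. i \<noteq> j \<longrightarrow> (i, j) \<in> R \<or> (j, i) \<in> R)"
  unfolding orderings_def strict_linear_order_on_def trans_def irrefl_def total_on_def by auto

lemma relabel_in_orderings: "R \<in> orderings \<Longrightarrow> inj r \<Longrightarrow> relabel r R \<in> orderings"
  unfolding orderings_iff relabel_def by (simp add: inj_eq)

lemma relabel_ordering_of: "inj u \<Longrightarrow> inj r \<Longrightarrow> relabel r (ordering_of u) = ordering_of (\<lambda>k. u (r k))"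
  using inj_compose[of u r] by (simp add: relabel_def ordering_of_def comp_def)

lemma mem_relabel_iff [simp]: "(i, j) \<in> relabel r R \<longleftrightarrow> (r i, r j) \<in> R"
  by (simp add: relabel_def)

lemma measurable_relabel: "inj r \<Longrightarrow> relabel r \<in> ordering_space \<rightarrow>\<^sub>M ordering_space"
  by (intro measurable_into_ordering_space) (auto simp: relabel_in_orderings split_paired_all)

lemma relabel_inv:
  assumes "bij r"
  shows "relabel (inv r) (relabel r R) = R" "relabel r (relabel (inv r) R) = R"
  using assms by (auto simp: relabel_def bij_is_surj surj_f_inv_f bij_is_inj)

text \<open>An image under a relabelling is a preimage under the inverse relabelling; this is how
  the images in the commutation relation are seen to be measurable.\<close>

lemma relabel_image:
  assumes r: "bij r" and A: "A \<subseteq> orderings"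
  shows "relabel r ` A = relabel (inv r) -` A \<inter> orderings"
proof (intro set_eqI iffI)
  fix R assume "R \<in> relabel r ` A"
  then show "R \<in> relabel (inv r) -` A \<inter> orderings"
    using A r by (auto simp: relabel_inv intro!: relabel_in_orderings bij_is_inj)
next
  fix R assume R: "R \<in> relabel (inv r) -` A \<inter> orderings"
  then show "R \<in> relabel r ` A"
    using relabel_inv(2)[OF r, of R] by (auto intro!: image_eqI[where x = "relabel (inv r) R"])
qed

lemma sets_relabel_image:
  assumes "bij r" and A: "A \<in> sets ordering_space"
  shows "relabel r ` A \<in> sets ordering_space"
  using measurable_sets[OF measurable_relabel A, of "inv r"] sets.sets_into_space[OF A] assms(1)
  by (simp add: relabel_image bij_imp_bij_inv bij_is_inj)

lemma distr_uniform_ordering_relabel: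
  assumes r: "bij r"
  shows "distr uniform_ordering ordering_space (relabel r) = uniform_ordering"
proof -
  note [measurable] = measurable_relabel[OF bij_is_inj[OF r]]
  have "distr uniform_ordering ordering_space (relabel r)
      = distr uniform_sequence ordering_space (\<lambda>u. relabel r (ordering_of u))"
    unfolding uniform_ordering_def by (subst distr_distr) (auto simp: comp_def)
  also have "\<dots> = distr uniform_sequence ordering_space (\<lambda>u. ordering_of (\<lambda>k. u (r k)))"
  proof (intro distr_cong_AE refl)
    show "AE u in uniform_sequence. relabel r (ordering_of u) = ordering_of (\<lambda>k. u (r k))"
      using AE_typical
      by eventually_elim (auto simp: typical_def relabel_ordering_of bij_is_inj[OF r])
  qed measurable
  also have "\<dots> = distr (distr uniform_sequence uniform_sequence (\<lambda>u k. u (r k))) ordering_space ordering_of"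
    by (subst distr_distr) (auto simp: comp_def intro!: measurable_PiM_single')
  also have "distr uniform_sequence uniform_sequence (\<lambda>u k. u (r k)) = uniform_sequence"
    using distr_PiM_reindex[of UNIV "\<lambda>_. uniform01" r UNIV] prob_space_uniform01 bij_is_inj[OF r]
    by (simp add: restrict_def)
  finally show ?thesis
    by (simp add: uniform_ordering_def)
qed


text \<open>Positive information suffices, since the events \<open>p \<in> R\<close> already
  generate. Their finite conjunctions form a family that is both closed under intersection and
  countable; the latter later yields one null set for all events.\<close>

lemma sets_ordering_space_cylinders:
  "sets ordering_space = sigma_sets orderings ((\<lambda>F. {R \<in> orderings. F \<subseteq> R}) ` Collect finite)"
    (is "_ = sigma_sets _ ?G")
proof
  have G: "?G \<subseteq> Pow orderings" by auto
  have "(\<lambda>R. R) \<in> sigma orderings ?G \<rightarrow>\<^sub>M ordering_space"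
  proof (rule measurable_into_ordering_space)
    fix p :: "nat \<times> nat"
    have "{R \<in> orderings. {p} \<subseteq> R} \<in> sets (sigma orderings ?G)"
      using G by (auto intro!: sigma_sets.Basic image_eqI[where x = "{p}"] simp: sets_measure_of)
    then show "Measurable.pred (sigma orderings ?G) (\<lambda>R. p \<in> R)"
      using G by (simp add: pred_def space_measure_of)
  qed (use G in \<open>auto simp: space_measure_of\<close>)
  then have "A \<in> sets ordering_space \<Longrightarrow> A \<in> sets (sigma orderings ?G)" for A
    using measurable_sets[of "\<lambda>R. R" "sigma orderings ?G" ordering_space A] sets.sets_into_space[of A ordering_space] G
    by (auto simp: space_measure_of vimage_def Int_absorb2)
  with G show "sets ordering_space \<subseteq> sigma_sets orderings ?G"
    by (auto simp: sets_measure_of)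
  have "{R \<in> orderings. F \<subseteq> R} \<in> sets ordering_space" if "finite F" for F
  proof -
    have "{R \<in> space ordering_space. \<forall>p\<in>F. p \<in> R} \<in> sets ordering_space"
      by measurable (use that in \<open>auto intro: countable_finite\<close>)
    then show ?thesis by (simp add: subset_eq)
  qed
  then show "sigma_sets orderings ?G \<subseteq> sets ordering_space"
    using sets.sigma_sets_subset[of ?G ordering_space] by auto
qed

lemma Int_stable_cylinders: "Int_stable ((\<lambda>F. {R \<in> orderings. F \<subseteq> R}) ` Collect finite)"
proof (rule Int_stableI, safe)
  fix F F' :: "nat rel" assume "finite F" "finite F'"
  then show "{R \<in> orderings. F \<subseteq> R} \<inter> {R \<in> orderings. F' \<subseteq> R} \<in> (\<lambda>F. {R \<in> orderings. F \<subseteq> R}) ` Collect finite"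
    by (auto intro!: image_eqI[where x = "F \<union> F'"])
qed

lemma measure_eqI_ordering_space:
  assumes "sets \<mu> = sets ordering_space" "sets \<mu>' = sets ordering_space"
    and "finite_measure \<mu>"
    and eq: "\<And>F. finite F \<Longrightarrow> emeasure \<mu> {R \<in> orderings. F \<subseteq> R} = emeasure \<mu>' {R \<in> orderings. F \<subseteq> R}"
  shows "\<mu> = \<mu>'"
proof (rule measure_eqI_generator_eq[OF Int_stable_cylinders])
  interpret finite_measure \<mu> by fact
  show "range (\<lambda>_ :: nat. orderings) \<subseteq> (\<lambda>F. {R \<in> orderings. F \<subseteq> R}) ` Collect finite"
    by (auto intro!: image_eqI[where x = "{}"])
  show "emeasure \<mu> orderings \<noteq> \<infinity>"
    by simp
qed (use assms in \<open>auto simp: sets_ordering_space_cylinders\<close>)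

definition position :: "nat \<Rightarrow> nat rel \<Rightarrow> nat \<Rightarrow> nat" where
  "position n R i = card {j. j < n \<and> (j, i) \<in> R}"

lemma position_less_iff:
  assumes R: "R \<in> orderings" and "i < n" "j < n"
  shows "position n R i < position n R j \<longleftrightarrow> (i, j) \<in> R"
proof -
  have less: "position n R i < position n R j" if "(i, j) \<in> R" "i < n" for i j
    unfolding position_def
  proof (rule psubset_card_mono)
    show "{k. k < n \<and> (k, i) \<in> R} \<subset> {k. k < n \<and> (k, j) \<in> R}"
      using R that unfolding orderings_iff by blast
  qed auto
  then show ?thesis
    using R assms(2,3) less[of i j] less[of j i] unfolding orderings_iff
    by (cases "i = j") (auto, meson less_asym)
qed

lemma bij_betw_position:
  assumes R: "R \<in> orderings"
  shows "bij_betw (position n R) {..<n} {..<n}"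
proof -
  have inj: "inj_on (position n R) {..<n}"
  proof (rule inj_onI)
    fix i j assume "i \<in> {..<n}" "j \<in> {..<n}" "position n R i = position n R j"
    with R position_less_iff[OF R, of i n j] position_less_iff[OF R, of j n i] show "i = j"
      unfolding orderings_iff by auto
  qed
  moreover have "position n R ` {..<n} \<subseteq> {..<n}"
  proof safe
    fix i assume "i < n"
    then have "{j. j < n \<and> (j, i) \<in> R} \<subset> {..<n}"
      using R by (auto simp: orderings_iff)
    from psubset_card_mono[OF _ this] show "position n R i < n"
      by (simp add: position_def)
  qed
  ultimately show ?thesis
    by (simp add: bij_betw_def endo_inj_surj)
qed

text \<open>The permutation sends \<open>i\<close> to the label whose position in \<open>R\<close>,
  among the first \<open>n\<close> labels, is the position of \<open>i\<close> in \<open>R'\<close>;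
  labels from \<open>n\<close> on stay fixed.\<close>

lemma relabelling_between_orderings:
  assumes "R \<in> orderings" "R' \<in> orderings"
  obtains r where "bij r" "r ` {..<n} = {..<n}" "\<And>i j. i < n \<Longrightarrow> j < n \<Longrightarrow> (r i, r j) \<in> R \<longleftrightarrow> (i, j) \<in> R'"
proof -
  let ?p = "position n R" and ?p' = "position n R'"
  define r where "r i = (if i < n then inv_into {..<n} ?p (?p' i) else i)" for i
  note bij = bij_betw_position[OF assms(1), of n] bij_betw_position[OF assms(2), of n]
  have "bij_betw (inv_into {..<n} ?p \<circ> ?p') {..<n} {..<n}"
    using bij by (intro bij_betw_trans[OF _ bij_betw_inv_into]) auto
  then have r1: "bij_betw r {..<n} {..<n}"
    by (rule bij_betw_cong[THEN iffD1, rotated]) (auto simp: r_def)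
  moreover have "bij_betw r {n..} {n..}"
    by (rule bij_betw_cong[THEN iffD1, rotated, OF bij_betw_id]) (auto simp: r_def)
  ultimately have "bij_betw r ({..<n} \<union> {n..}) ({..<n} \<union> {n..})"
    by (intro bij_betw_combine) auto
  moreover have "{..<n} \<union> {n..} = UNIV" by auto
  ultimately have "bij r" by simp
  moreover have "?p (r i) = ?p' i" and "r i < n" if "i < n" for i
    using that r1 bij by (auto simp: r_def bij_betw_def intro!: f_inv_into_f)
  then have "(r i, r j) \<in> R \<longleftrightarrow> (i, j) \<in> R'" if "i < n" "j < n" for i j
    using that position_less_iff[OF assms(1), of "r i" n "r j"] position_less_iff[OF assms(2), of i n j] by simp
  moreover have "r ` {..<n} = {..<n}"
    using r1 by (simp add: bij_betw_def)
  ultimately show ?thesis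
    using that by blast
qed

text \<open>The two measures to be compared are indexed by \<^typ>\<open>bool\<close>, so that every step applies to both.\<close>

lemma relabel_invariant_unique:
  assumes sets: "\<And>b. sets (\<mu> b) = sets ordering_space" and prob: "\<And>b. prob_space (\<mu> b)"
    and inv: "\<And>b r. bij r \<Longrightarrow> distr (\<mu> b) ordering_space (relabel r) = \<mu> b"
  shows "\<mu> True = \<mu> False"
proof (rule measure_eqI_ordering_space[OF sets sets])
  show "finite_measure (\<mu> True)"
    using prob by (rule prob_space.finite_measure)
  have [simp]: "space (\<mu> b) = orderings" for b
    using sets_eq_imp_space_eq[OF sets[of b]] by simp
  note [measurable_cong] = sets
  fix F :: "nat rel" assume "finite F"
  obtain n where n: "F \<subseteq> {..<n} \<times> {..<n}"
  proof
    show "F \<subseteq> {..<Suc (Max (fst ` F \<union> snd ` F))} \<times> {..<Suc (Max (fst ` F \<union> snd ` F))}"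
      using \<open>finite F\<close> by (force simp: less_Suc_eq_le intro!: Max_ge)
  qed
  let ?B = "{..<n} \<times> {..<n}"
  define L where "L = (\<lambda>R. R \<inter> ?B) ` orderings"
  define cyl where "cyl S = {R \<in> orderings. R \<inter> ?B = S}" for S
  have fin: "finite L"
    by (rule finite_subset[of _ "Pow ?B"]) (auto simp: L_def)
  have cyl_sets: "cyl S \<in> sets ordering_space" if "S \<in> L" for S
  proof -
    have "{R \<in> space ordering_space. \<forall>p\<in>?B. p \<in> R \<longleftrightarrow> p \<in> S} \<in> sets ordering_space"
      by measurable
    also have "{R \<in> space ordering_space. \<forall>p\<in>?B. p \<in> R \<longleftrightarrow> p \<in> S} = cyl S"
      using that unfolding cyl_def L_def by auto
    finally show ?thesis .
  qed
  \<comment> \<open>A permutation matching two patterns on the first \<open>n\<close> labels pulls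
    one cylinder back to the other, so invariance forces equal masses.\<close>
  have same: "measure (\<mu> b) (cyl S) = measure (\<mu> b) (cyl T)" if ST: "S \<in> L" "T \<in> L" for b S T
  proof -
    from ST obtain R R' where R: "R \<in> orderings" "S = R \<inter> ?B" "R' \<in> orderings" "T = R' \<inter> ?B"
      by (auto simp: L_def)
    obtain r where r: "bij r" "r ` {..<n} = {..<n}" "\<And>i j. i < n \<Longrightarrow> j < n \<Longrightarrow> (r i, r j) \<in> R \<longleftrightarrow> (i, j) \<in> R'"
      by (rule relabelling_between_orderings[OF R(1,3), of n]) blast
    have rn: "r i < n \<longleftrightarrow> i < n" for i
      using r(1,2) by (metis bij_is_inj inj_image_mem_iff lessThan_iff)
    have "relabel r -` cyl T \<inter> orderings = cyl S"
    proof (intro set_eqI iffI)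
      fix Q assume Q: "Q \<in> relabel r -` cyl T \<inter> orderings"
      have "(a, b) \<in> Q \<longleftrightarrow> (a, b) \<in> S" if "a < n" "b < n" for a b
      proof -
        from that r(2) obtain i j where ij: "a = r i" "b = r j" "i < n" "j < n"
          by (metis imageE lessThan_iff)
        have "(i, j) \<in> relabel r Q \<longleftrightarrow> (i, j) \<in> T"
          using Q ij by (auto simp: cyl_def)
        then show ?thesis
          using r(3)[OF ij(3,4)] R ij that by auto
      qed
      then show "Q \<in> cyl S"
        using Q R by (auto simp: cyl_def)
    next
      fix Q assume Q: "Q \<in> cyl S"
      have eq: "(i, j) \<in> relabel r Q \<longleftrightarrow> (i, j) \<in> T" if "i < n" "j < n" for i j
      proof -
        have "(r i, r j) \<in> Q \<longleftrightarrow> (r i, r j) \<in> S"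
          using Q that rn by (auto simp: cyl_def)
        then show ?thesis
          using r(3)[OF that] R that rn by auto
      qed
      have "Q \<in> orderings" "T \<subseteq> ?B"
        using Q R by (auto simp: cyl_def)
      moreover have "relabel r Q \<inter> ?B = T"
        using eq \<open>T \<subseteq> ?B\<close> by (auto simp del: mem_relabel_iff)
      ultimately show "Q \<in> relabel r -` cyl T \<inter> orderings"
        using r(1) by (simp add: cyl_def relabel_in_orderings bij_is_inj)
    qed
    then have "measure (distr (\<mu> b) ordering_space (relabel r)) (cyl T) = measure (\<mu> b) (cyl S)"
      using measurable_relabel[OF bij_is_inj[OF r(1)]] cyl_sets[OF ST(2)]
      by (subst measure_distr) (auto cong: measurable_cong_sets simp: sets)
    then show ?thesis
      using inv[OF r(1)] by simp
  qed
  have disj: "disjoint_family_on cyl L'" for L'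
    by (auto simp: disjoint_family_on_def cyl_def)
  have sum: "measure (\<mu> b) (\<Union>S\<in>L'. cyl S) = (\<Sum>S\<in>L'. measure (\<mu> b) (cyl S))" if "L' \<subseteq> L" for b L'
  proof -
    interpret prob_space "\<mu> b" by (rule prob)
    show ?thesis
      using that fin cyl_sets disj finite_subset[OF that fin]
      by (intro finite_measure_finite_Union) (auto simp: sets)
  qed
  have cover: "(\<Union>S\<in>L. cyl S) = orderings"
    by (auto simp: L_def cyl_def)
  \<comment> \<open>The patterns partition the space into finitely many equally likely cylinders, so
    counting fixes each mass, and it is the same for both measures.\<close>
  have val: "measure (\<mu> b) (cyl S) = 1 / card L" if "S \<in> L" for b S
  proof -
    interpret prob_space "\<mu> b" by (rule prob)
    have "1 = measure (\<mu> b) (\<Union>S\<in>L. cyl S)"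
      using cover prob_space by simp
    also have "\<dots> = (\<Sum>T\<in>L. measure (\<mu> b) (cyl S))"
      unfolding sum[OF order_refl] by (intro sum.cong refl same that)
    finally show ?thesis
      using that fin by (cases "card L = 0") (auto simp: field_simps)
  qed
  have "{R \<in> orderings. F \<subseteq> R} = (\<Union>S\<in>{S \<in> L. F \<subseteq> S}. cyl S)"
    using n by (auto simp: L_def cyl_def)
  moreover have "measure (\<mu> b) (\<Union>S\<in>{S \<in> L. F \<subseteq> S}. cyl S) = (\<Sum>S\<in>{S \<in> L. F \<subseteq> S}. 1 / card L)" for b
    by (subst sum, force, intro sum.cong refl val) auto
  ultimately show "emeasure (\<mu> True) {R \<in> orderings. F \<subseteq> R} = emeasure (\<mu> False) {R \<in> orderings. F \<subseteq> R}"
    using prob[THEN prob_space.finite_measure, THEN finite_measure.emeasure_eq_measure] by simp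
qed

lemma relabel_invariant_eq_uniform_ordering:
  assumes "sets \<mu> = sets ordering_space" "prob_space \<mu>"
    and "\<And>r. bij r \<Longrightarrow> distr \<mu> ordering_space (relabel r) = \<mu>"
  shows "\<mu> = uniform_ordering"
  using relabel_invariant_unique[of "\<lambda>b. if b then \<mu> else uniform_ordering"] assms
    distr_uniform_ordering_relabel prob_space_uniform_ordering by (simp split: if_splits)

section \<open>Copulas and their conditional distribution functions\<close>

text \<open>
  Copulas have rational arguments because limits of empirical frequencies are only available
  simultaneously for countably many of them.
\<close>

definition copula :: "(rat \<Rightarrow> rat \<Rightarrow> real) \<Rightarrow> bool" where
  "copula C \<longleftrightarrow>
     (\<forall>p p' q q'. p \<le> p' \<longrightarrow> q \<le> q' \<longrightarrow> 0 \<le> C p' q' - C p q' - C p' q + C p q) \<and>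
     (\<forall>p q. p \<le> 0 \<or> q \<le> 0 \<longrightarrow> C p q = 0) \<and>
     (\<forall>p q. 1 \<le> q \<longrightarrow> C p q = clip (of_rat p)) \<and>
     (\<forall>p q. 1 \<le> p \<longrightarrow> C p q = clip (of_rat q))"

lemma copula_2_increasing:
  "copula C \<Longrightarrow> p \<le> p' \<Longrightarrow> q \<le> q' \<Longrightarrow> C p q' - C p q \<le> C p' q' - C p' q"
proof -
  assume "copula C" "p \<le> p'" "q \<le> q'"
  then have "0 \<le> C p' q' - C p q' - C p' q + C p q"
    unfolding copula_def by blast
  then show ?thesis by simp
qed

lemma copula_boundary:
  assumes "copula C"
  shows "p \<le> 0 \<Longrightarrow> C p q = 0" "q \<le> 0 \<Longrightarrow> C p q = 0"
    "1 \<le> q \<Longrightarrow> C p q = clip (of_rat p)" "1 \<le> p \<Longrightarrow> C p q = clip (of_rat q)"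
  using assms unfolding copula_def by blast+

text \<open>This bound and the next two apply the rectangle inequality with one side moved to the
  boundary, where the copula is known. The \<open>min\<close> and \<open>max\<close> keep the sides
  in order for arguments outside the unit interval.\<close>

lemma copula_mono1:
  assumes "copula C" "p \<le> p'" shows "C p q \<le> C p' q"
  using copula_2_increasing[OF assms, of "min q 0" q] copula_boundary(2)[OF assms(1), of "min q 0"] by simp

lemma copula_lipschitz1:
  assumes "copula C" "p \<le> p'" shows "C p' q - C p q \<le> clip (of_rat p') - clip (of_rat p)"
  using copula_2_increasing[OF assms, of q "max q 1"] copula_boundary(3)[OF assms(1), of "max q 1"] by simp

lemma copula_lipschitz2:
  assumes "copula C" "q \<le> q'" shows "C p q' - C p q \<le> clip (of_rat q') - clip (of_rat q)"
  using copula_2_increasing[OF assms(1) _ assms(2), of p "max p 1"] copula_boundary(4)[OF assms(1), of "max p 1"] by simp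

lemma copula_bounds:
  assumes "copula C" shows "0 \<le> C p q" "C p q \<le> 1"
  using copula_mono1[OF assms, of "min p 0" p q] copula_boundary(1)[OF assms, of "min p 0" q]
    copula_mono1[OF assms, of p "max p 1" q] copula_boundary(4)[OF assms, of "max p 1" q]
    clip_bounds(2)[of "of_rat q"] by linarith+

lemma of_rat_fact [simp]: "real_of_rat (fact n) = fact n"
  by (metis of_nat_fact of_rat_of_nat_eq)

lemma measure_uniform01_UNIV [simp]: "measure uniform01 UNIV = 1"
  using uniform01.prob_space by simp

text \<open>
  The grids of mesh \<open>1 / n!\<close> are nested, and every rational number is a grid point from some \<open>n\<close> on.
\<close>

definition cell :: "nat \<Rightarrow> real \<Rightarrow> nat" where
  "cell n u = nat \<lfloor>fact n * u\<rfloor>"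

lemma measurable_cell [measurable]: "cell n \<in> borel \<rightarrow>\<^sub>M count_space UNIV"
  unfolding cell_def[abs_def] by measurable

lemma cell_less: "0 \<le> u \<Longrightarrow> u < 1 \<Longrightarrow> cell n u < fact n"
proof -
  assume "0 \<le> u" "u < 1"
  then have "fact n * u < (fact n :: real)" "0 \<le> fact n * u" by simp_all
  then have "\<lfloor>fact n * u\<rfloor> < fact n" by (simp add: floor_less_iff)
  with \<open>0 \<le> fact n * u\<close> show ?thesis by (simp add: cell_def nat_less_iff)
qed

lemma cell_eq_iff:
  assumes "0 \<le> u" shows "cell n u = i \<longleftrightarrow> of_nat i / fact n \<le> u \<and> u < of_nat (Suc i) / fact n"
proof -
  have "cell n u = i \<longleftrightarrow> \<lfloor>fact n * u\<rfloor> = int i"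
    using assms by (auto simp: cell_def)
  also have "\<dots> \<longleftrightarrow> of_nat i \<le> fact n * u \<and> fact n * u < of_nat (Suc i)"
    by (auto simp: floor_eq_iff)
  also have "\<dots> \<longleftrightarrow> of_nat i / fact n \<le> u \<and> u < of_nat (Suc i) / fact n"
    by (auto simp: field_simps)
  finally show ?thesis .
qed

lemma cell_less_iff:
  assumes "0 \<le> u" shows "cell n u < i \<longleftrightarrow> u < of_nat i / fact n"
proof -
  have "cell n u < i \<longleftrightarrow> \<lfloor>fact n * u\<rfloor> < int i"
    using assms by (auto simp: cell_def nat_less_iff)
  also have "\<dots> \<longleftrightarrow> fact n * u < of_nat i"
    by (auto simp: floor_less_iff)
  finally show ?thesis by (simp add: field_simps)
qed

text \<open>The ratio of the two meshes is an integer, so the floor at the coarse mesh is the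
  integer quotient of the floor at the fine mesh.\<close>

lemma cell_refine:
  assumes "0 \<le> u" "n \<le> m" shows "cell n u = cell m u div (fact m div fact n)"
proof -
  define k :: nat where "k = fact m div fact n"
  have k: "fact m = fact n * k" "0 < k"
    using fact_dvd[OF assms(2), where 'a = nat] by (auto simp: k_def div_greater_zero_iff dvd_imp_le)
  have k': "(fact m :: real) = fact n * of_nat k"
    by (metis k(1) of_nat_fact of_nat_mult)
  have "\<lfloor>fact n * u\<rfloor> = \<lfloor>(fact m * u) / real_of_int (int k)\<rfloor>"
    using k k' by simp
  also have "\<dots> = \<lfloor>fact m * u\<rfloor> div int k"
    by (rule floor_divide_real_eq_div) simp
  finally show ?thesis
    using assms(1) unfolding cell_def k_def[symmetric] by (simp add: nat_div_distrib)
qed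

lemma measure_uniform01_atLeastLessThan:
  assumes "a \<le> b" shows "measure uniform01 {a..<b} = clip b - clip a"
proof -
  have "measure uniform01 ({..<b} - {..<a}) = measure uniform01 {..<b} - measure uniform01 {..<a}"
    using assms by (intro uniform01.finite_measure_Diff) auto
  moreover have "{..<b} - {..<a} = {a..<b}" by auto
  ultimately show ?thesis by (simp add: measure_uniform01_lessThan)
qed

lemma integral_uniform01_cell:
  fixes g :: "nat \<Rightarrow> real"
  shows "(\<integral>u. g (cell n u) \<partial>uniform01) = (\<Sum>i<fact n. g i) / fact n"
    and "integrable uniform01 (\<lambda>u. g (cell n u))"
proof -
  let ?I = "\<lambda>i. {of_nat i / fact n..<of_nat (Suc i) / fact n} :: real set"
  have ae: "AE u in uniform01. g (cell n u) = (\<Sum>i<fact n. g i * indicator (?I i) u)"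
    using AE_uniform01
  proof eventually_elim
    case (elim u)
    then have "g (cell n u) = (\<Sum>i<fact n. if i = cell n u then g i else 0)"
      using cell_less[of u n] by simp
    also have "\<dots> = (\<Sum>i<fact n. g i * indicator (?I i) u)"
    proof (intro sum.cong refl)
      fix i
      have "u \<in> ?I i \<longleftrightarrow> i = cell n u"
        using cell_eq_iff[of u n i] elim by auto
      then show "(if i = cell n u then g i else 0) = g i * indicator (?I i) u"
        by (simp add: indicator_def)
    qed
    finally show ?case .
  qed
  have int: "integrable uniform01 (\<lambda>u. g i * indicator (?I i) u)" for i
    by (intro integrable_mult_right integrable_real_indicator) (auto simp: uniform01.emeasure_eq_measure)
  show "integrable uniform01 (\<lambda>u. g (cell n u))"
  proof (subst integrable_cong_AE[OF _ _ ae])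
    show "integrable uniform01 (\<lambda>u. \<Sum>i<fact n. g i * indicator (?I i) u)"
      by (intro Bochner_Integration.integrable_sum int)
  qed measurable
  have "(\<integral>u. g (cell n u) \<partial>uniform01) = (\<integral>u. (\<Sum>i<fact n. g i * indicator (?I i) u) \<partial>uniform01)"
    by (intro integral_cong_AE ae) measurable
  also have "\<dots> = (\<Sum>i<fact n. g i * measure uniform01 (?I i))"
    by (subst Bochner_Integration.integral_sum[OF int]) simp
  also have "\<dots> = (\<Sum>i<fact n. g i / fact n)"
  proof (intro sum.cong refl)
    fix i assume "i \<in> {..<fact n :: nat}"
    then have "real (Suc i) \<le> real (fact n)"
      unfolding of_nat_le_iff by simp
    then have le: "of_nat (Suc i) / fact n \<le> (1::real)"
      by simp
    have "measure uniform01 (?I i) = clip (of_nat (Suc i) / fact n) - clip (of_nat i / fact n)"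
      by (intro measure_uniform01_atLeastLessThan) (simp add: divide_right_mono)
    also have "\<dots> = of_nat (Suc i) / fact n - of_nat i / fact n"
      using le by (subst (1 2) clip_id) (auto simp: field_simps)
    finally show "g i * measure uniform01 (?I i) = g i / fact n"
      by (simp add: field_simps)
  qed
  finally show "(\<integral>u. g (cell n u) \<partial>uniform01) = (\<Sum>i<fact n. g i) / fact n"
    by (simp add: sum_divide_distrib)
qed

section \<open>Step densities of a copula and their mean square convergence\<close>

definition increment :: "(rat \<Rightarrow> rat \<Rightarrow> real) \<Rightarrow> nat \<Rightarrow> rat \<Rightarrow> nat \<Rightarrow> real" where
  "increment C n q i = C (of_nat (Suc i) / fact n) q - C (of_nat i / fact n) q"

text \<open>The difference quotient of \<open>C\<close> in its first argument over the grid cell of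
  \<open>u\<close>. When \<open>C\<close> is the copula of (U, V), this is the conditional
  probability of V < q given the cell of U.\<close>

definition density_step :: "(rat \<Rightarrow> rat \<Rightarrow> real) \<Rightarrow> nat \<Rightarrow> rat \<Rightarrow> real \<Rightarrow> real" where
  "density_step C n q u = fact n * increment C n q (cell n u)"

text \<open>The squared mean square norm of \<open>density_step C n q\<close> under the uniform
  law.\<close>

definition energy :: "(rat \<Rightarrow> rat \<Rightarrow> real) \<Rightarrow> nat \<Rightarrow> rat \<Rightarrow> real" where
  "energy C n q = fact n * (\<Sum>i<fact n. (increment C n q i)\<^sup>2)"

text \<open>The martingale property of the step densities: tested against a function of the coarse
  cell, the fine increments inside each coarse cell telescope to the coarse increment.\<close>

lemma integral_density_step:
  assumes "n \<le> m"
  shows "(\<integral>u. g (cell n u) * density_step C m q u \<partial>uniform01) = (\<Sum>i<fact n. g i * increment C n q i)"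
    and "integrable uniform01 (\<lambda>u. g (cell n u) * density_step C m q u)"
proof -
  define k :: nat where "k = fact m div fact n"
  have k: "fact m = fact n * k" "0 < k"
    using fact_dvd[OF assms, where 'a = nat] by (auto simp: k_def div_greater_zero_iff dvd_imp_le)
  have k': "(fact m :: rat) = fact n * of_nat k"
    by (metis k(1) of_nat_fact of_nat_mult)
  define h where "h i = g (i div k) * (fact m * increment C m q i)" for i
  have ae: "AE u in uniform01. g (cell n u) * density_step C m q u = h (cell m u)"
    using AE_uniform01
    by eventually_elim (simp add: h_def density_step_def k_def cell_refine[OF _ assms])
  have meas: "(\<lambda>u. g (cell n u) * density_step C m q u) \<in> borel_measurable uniform01"
    unfolding density_step_def by measurable
  show "integrable uniform01 (\<lambda>u. g (cell n u) * density_step C m q u)"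
    using integral_uniform01_cell(2)[of h m] by (subst integrable_cong_AE[OF _ _ ae]) (auto intro: meas)
  have "(\<integral>u. g (cell n u) * density_step C m q u \<partial>uniform01) = (\<integral>u. h (cell m u) \<partial>uniform01)"
    by (intro integral_cong_AE ae meas) measurable
  also have "\<dots> = (\<Sum>i<fact m. g (i div k) * increment C m q i)"
    unfolding integral_uniform01_cell(1) by (simp add: h_def sum_divide_distrib)
  also have "\<dots> = (\<Sum>i<fact n. \<Sum>l\<in>{i*k..<i*k+k}. g (l div k) * increment C m q l)"
    unfolding k(1) by (rule sum.nat_group[symmetric])
  also have "\<dots> = (\<Sum>i<fact n. g i * increment C n q i)"
  proof (intro sum.cong refl)
    fix i
    have "(\<Sum>l\<in>{i*k..<i*k+k}. g (l div k) * increment C m q l) = (\<Sum>l\<in>{i*k..<i*k+k}. g i * increment C m q l)"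
    proof (intro sum.cong refl)
      fix l assume "l \<in> {i*k..<i*k+k}"
      then have "l div k = i"
        by (intro div_nat_eqI) (auto simp: algebra_simps)
      then show "g (l div k) * increment C m q l = g i * increment C m q l" by simp
    qed
    also have "\<dots> = g i * (C (of_nat (i*k+k) / fact m) q - C (of_nat (i*k) / fact m) q)"
      unfolding increment_def sum_distrib_left[symmetric]
      by (subst sum_Suc_diff'[of _ _ "\<lambda>l. C (of_nat l / fact m) q"]) auto
    also have "of_nat (i*k+k) / fact m = (of_nat (Suc i) / fact n :: rat)"
      using k(2) by (simp add: k' field_simps)
    also have "of_nat (i*k) / fact m = (of_nat i / fact n :: rat)"
      using k(2) by (simp add: k' field_simps)
    finally show "(\<Sum>l\<in>{i*k..<i*k+k}. g (l div k) * increment C m q l) = g i * increment C n q i"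
      by (simp add: increment_def)
  qed
  finally show "(\<integral>u. g (cell n u) * density_step C m q u \<partial>uniform01) = (\<Sum>i<fact n. g i * increment C n q i)" .
qed

lemma measurable_density_step [measurable]: "density_step C n q \<in> borel_measurable borel"
  unfolding density_step_def[abs_def] by measurable

lemma integral_density_step_product:
  assumes "n \<le> m"
  shows "(\<integral>u. density_step C n q u * density_step C m q u \<partial>uniform01) = energy C n q"
    and "integrable uniform01 (\<lambda>u. density_step C n q u * density_step C m q u)"
  using integral_density_step[OF assms, of "\<lambda>i. fact n * increment C n q i" C q]
  by (simp_all add: density_step_def energy_def power2_eq_square sum_distrib_left mult.assoc)

text \<open>Pythagoras for martingale differences: the coarse density is orthogonal to the
  difference, so the squared distance is the gain in energy.\<close>

lemma integral_density_step_diff: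
  assumes "n \<le> m"
  shows "(\<integral>u. (density_step C m q u - density_step C n q u)\<^sup>2 \<partial>uniform01) = energy C m q - energy C n q"
    and "integrable uniform01 (\<lambda>u. (density_step C m q u - density_step C n q u)\<^sup>2)"
proof -
  have eq: "(density_step C m q u - density_step C n q u)\<^sup>2 = density_step C m q u * density_step C m q u
      - 2 * (density_step C n q u * density_step C m q u) + density_step C n q u * density_step C n q u" for u
    by (simp add: power2_eq_square algebra_simps)
  note int = integral_density_step_product(2)[OF order_refl, of C m q]
    integral_density_step_product(2)[OF order_refl, of C n q]
    integral_density_step_product(2)[OF assms, of C q]
  show "integrable uniform01 (\<lambda>u. (density_step C m q u - density_step C n q u)\<^sup>2)"
    unfolding eq using int by simp
  show "(\<integral>u. (density_step C m q u - density_step C n q u)\<^sup>2 \<partial>uniform01) = energy C m q - energy C n q"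
    unfolding eq using int by (simp add: integral_density_step_product assms)
qed

lemma energy_mono: "n \<le> m \<Longrightarrow> energy C n q \<le> energy C m q"
  using integral_density_step_diff(1)[of n m C q]
    Bochner_Integration.integral_nonneg[of uniform01 "\<lambda>u. (density_step C m q u - density_step C n q u)\<^sup>2"] by simp

text \<open>
  The step densities converge in mean square, but almost everywhere convergence along the full
  sequence would need a maximal inequality. Passing to levels chosen by this explicit rule instead
  gives almost everywhere convergence and keeps the limit measurable in the copula.
\<close>

definition level :: "(rat \<Rightarrow> rat \<Rightarrow> real) \<Rightarrow> nat \<Rightarrow> nat" where
  "level C j = (LEAST n. j \<le> n \<and> (\<forall>m. \<forall>q :: rat. to_nat q \<le> j \<longrightarrow> energy C m q \<le> energy C n q + (1/2)^j))"

definition cond_cdf :: "(rat \<Rightarrow> rat \<Rightarrow> real) \<Rightarrow> rat \<Rightarrow> real \<Rightarrow> real" where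
  "cond_cdf C q u = lim (\<lambda>j. density_step C (level C j) q u)"

context
  fixes C :: "rat \<Rightarrow> rat \<Rightarrow> real"
  assumes C: "copula C"
begin

lemma increment_bounds: "0 \<le> increment C n q i" "increment C n q i \<le> 1 / fact n"
proof -
  have le: "of_nat i / fact n \<le> (of_nat (Suc i) / fact n :: rat)"
    by (simp add: divide_right_mono)
  from copula_mono1[OF C le] show "0 \<le> increment C n q i"
    by (simp add: increment_def)
  have "increment C n q i \<le> clip (of_rat (of_nat (Suc i) / fact n)) - clip (of_rat (of_nat i / fact n))"
    unfolding increment_def by (rule copula_lipschitz1[OF C le])
  also have "\<dots> \<le> of_rat (of_nat (Suc i) / fact n) - of_rat (of_nat i / fact n)"
    using le by (intro clip_diff_le) (simp add: of_rat_less_eq)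
  also have "\<dots> = 1 / fact n"
    by (simp add: of_rat_diff[symmetric] diff_divide_distrib[symmetric]) (simp add: of_rat_divide)
  finally show "increment C n q i \<le> 1 / fact n" .
qed

lemma density_step_bounds: "0 \<le> density_step C n q u" "density_step C n q u \<le> 1"
proof -
  show "0 \<le> density_step C n q u"
    using increment_bounds(1) by (simp add: density_step_def)
  have "fact n * increment C n q (cell n u) \<le> fact n * (1 / fact n)"
    by (intro mult_left_mono increment_bounds) simp
  then show "density_step C n q u \<le> 1"
    by (simp add: density_step_def)
qed

lemma energy_le_1: "energy C n q \<le> 1"
proof -
  have "energy C n q = (\<integral>u. density_step C n q u * density_step C n q u \<partial>uniform01)"
    by (simp add: integral_density_step_product)
  also have "\<dots> \<le> (\<integral>u. 1 \<partial>uniform01)"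
    using density_step_bounds[of n q]
    by (intro integral_mono integral_density_step_product) (auto intro: mult_le_one)
  finally show ?thesis
    by (simp add: uniform01.prob_space)
qed

text \<open>For each \<open>q\<close> the energies are bounded by 1, so some grid comes within
  (1/2)^j of their supremum. Only finitely many rationals have code at most \<open>j\<close>, and
  monotonicity of the energy lets the largest of their grids serve them all.\<close>

lemma level_ge: "j \<le> level C j"
  and level_bound: "to_nat q \<le> j \<Longrightarrow> energy C m q \<le> energy C (level C j) q + (1/2)^j"
proof -
  have "\<exists>n. \<forall>m. energy C m q \<le> energy C n q + (1/2)^j" for q
  proof -
    define s where "s = (SUP n. energy C n q)"
    have bdd: "bdd_above (range (\<lambda>n. energy C n q))"
      by (auto intro!: bdd_aboveI2 energy_le_1)
    obtain n where "s - (1/2)^j < energy C n q"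
      using less_cSUP_iff[OF _ bdd, of "s - (1/2)^j"] by (auto simp: s_def)
    moreover have "energy C m q \<le> s" for m
      unfolding s_def by (intro cSUP_upper bdd) auto
    ultimately have "energy C m q \<le> energy C n q + (1/2)^j" for m
      by (smt (verit, best))
    then show ?thesis by blast
  qed
  then obtain N where N: "\<And>q m. energy C m q \<le> energy C (N q) q + (1/2)^j"
    by metis
  have fin: "finite {q :: rat. to_nat q \<le> j}"
    using finite_vimageI[of "{..j}" "to_nat :: rat \<Rightarrow> nat"] by (simp add: vimage_def)
  let ?n = "max j (Max (N ` {q. to_nat q \<le> j}))"
  have "energy C m q \<le> energy C ?n q + (1/2)^j" if "to_nat q \<le> j" for m q
  proof -
    have "N q \<le> ?n"
      using fin that by (intro max.coboundedI2 Max_ge) auto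
    then show ?thesis
      using N[of m q] energy_mono[of "N q" ?n C q] by simp
  qed
  then have "j \<le> level C j \<and> (\<forall>m. \<forall>q :: rat. to_nat q \<le> j \<longrightarrow> energy C m q \<le> energy C (level C j) q + (1/2)^j)"
    unfolding level_def
    by (intro LeastI[where k = ?n and P = "\<lambda>n. j \<le> n \<and> (\<forall>m. \<forall>q :: rat. to_nat q \<le> j \<longrightarrow> energy C m q \<le> energy C n q + (1/2)^j)"]) simp
  then show "j \<le> level C j" "to_nat q \<le> j \<Longrightarrow> energy C m q \<le> energy C (level C j) q + (1/2)^j"
    by blast+
qed

text \<open>The level for \<open>j + 1\<close> also meets the weaker demands for \<open>j\<close>,
  among which \<open>level C j\<close> is the least solution.\<close>

lemma level_mono: "level C j \<le> level C (Suc j)"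
proof -
  have "energy C m q \<le> energy C (level C (Suc j)) q + (1/2)^j" if "to_nat q \<le> j" for m q
  proof -
    have "energy C m q \<le> energy C (level C (Suc j)) q + (1/2)^Suc j"
      using that by (intro level_bound) simp
    moreover have "(1/2::real)^Suc j \<le> (1/2)^j"
      by (intro power_decreasing) auto
    ultimately show ?thesis by linarith
  qed
  then show ?thesis
    unfolding level_def[of C j] using level_ge[of "Suc j"] by (intro Least_le) auto
qed

lemma AE_density_step_tendsto:
  "AE u in uniform01. \<forall>q. (\<lambda>j. density_step C (level C j) q u) \<longlonglongrightarrow> cond_cdf C q u"
  unfolding AE_all_countable
proof
  fix q :: rat
  \<comment> \<open>The energy bound speaks about \<open>q\<close> only from index
    \<open>to_nat q\<close> on, so the increments are counted from there.\<close>
  define s where "s = to_nat q"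
  define D where "D j u = density_step C (level C (Suc (s + j))) q u - density_step C (level C (s + j)) q u" for j u
  have "AE u in uniform01. summable (\<lambda>j. D j u)"
  proof (rule AE_summable_of_geometric_L2[where K = 1])
    fix j
    show "D j \<in> borel_measurable uniform01"
      unfolding D_def by measurable
    show "integrable uniform01 (\<lambda>u. (D j u)\<^sup>2)"
      unfolding D_def by (intro integral_density_step_diff level_mono)
    have "(\<integral>u. (D j u)\<^sup>2 \<partial>uniform01) = energy C (level C (Suc (s + j))) q - energy C (level C (s + j)) q"
      unfolding D_def by (intro integral_density_step_diff level_mono)
    also have "\<dots> \<le> (1/2)^(s + j)"
      using level_bound[of q "s + j"] by (simp add: s_def diff_le_eq add.commute)
    also have "\<dots> \<le> 1 * (1/2)^j"
      by (simp add: power_decreasing)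
    finally show "(\<integral>u. (D j u)\<^sup>2 \<partial>uniform01) \<le> 1 * (1/2)^j" .
  qed
  then show "AE u in uniform01. (\<lambda>j. density_step C (level C j) q u) \<longlonglongrightarrow> cond_cdf C q u"
  proof eventually_elim
    case (elim u)
    let ?X = "\<lambda>j. density_step C (level C j) q u"
    have "(\<Sum>k<j. D k u) + ?X s = ?X (j + s)" for j
      unfolding D_def by (induction j) (auto simp: add.commute)
    moreover have "(\<lambda>j. (\<Sum>k<j. D k u) + ?X s) \<longlonglongrightarrow> suminf (\<lambda>j. D j u) + ?X s"
      by (intro tendsto_intros summable_LIMSEQ elim)
    ultimately have "(\<lambda>j. ?X (j + s)) \<longlonglongrightarrow> suminf (\<lambda>j. D j u) + ?X s"
      by simp
    then have "convergent ?X"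
      by (auto simp: convergent_def dest: LIMSEQ_offset)
    then show ?case
      unfolding cond_cdf_def by (simp add: convergent_LIMSEQ_iff)
  qed
qed

lemma measurable_cond_cdf [measurable]: "cond_cdf C q \<in> borel_measurable borel"
  unfolding cond_cdf_def[abs_def] by measurable

lemma AE_cond_cdf:
  "AE u in uniform01. (\<forall>q. 0 \<le> cond_cdf C q u \<and> cond_cdf C q u \<le> 1) \<and>
     (\<forall>q q'. q \<le> q' \<longrightarrow> cond_cdf C q u \<le> cond_cdf C q' u) \<and> (\<forall>q\<ge>1. cond_cdf C q u = 1)"
  using AE_density_step_tendsto AE_uniform01
proof eventually_elim
  case (elim u)
  then have lim: "(\<lambda>j. density_step C (level C j) q u) \<longlonglongrightarrow> cond_cdf C q u" for q
    by blast
  have "0 \<le> cond_cdf C q u" "cond_cdf C q u \<le> 1" for q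
    using density_step_bounds by (auto intro: LIMSEQ_le_const[OF lim] LIMSEQ_le_const2[OF lim])
  moreover have "cond_cdf C q u \<le> cond_cdf C q' u" if "q \<le> q'" for q q'
  proof (rule LIMSEQ_le[OF lim lim], intro exI allI impI)
    fix j
    show "density_step C (level C j) q u \<le> density_step C (level C j) q' u"
      using copula_2_increasing[OF C _ that, of "of_nat (cell (level C j) u) / fact (level C j)"
          "of_nat (Suc (cell (level C j) u)) / fact (level C j)"]
      by (auto simp: density_step_def increment_def divide_right_mono)
  qed
  moreover have "cond_cdf C q u = 1" if "1 \<le> q" for q
  proof -
    \<comment> \<open>For q \<ge> 1 the copula is the uniform distribution function in its first
      argument and has slope 1 on every cell of the unit interval.\<close>
    have "density_step C n q u = 1" for n
    proof -
      define i where "i = cell n u"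
      have "Suc i \<le> fact n"
        using cell_less[of u n] elim by (simp add: i_def)
      then have "real (Suc i) \<le> real (fact n)"
        unfolding of_nat_le_iff .
      then have le: "real (Suc i) / fact n \<le> 1"
        by simp
      have "increment C n q i = clip (real (Suc i) / fact n) - clip (real i / fact n)"
        unfolding increment_def using that by (simp add: copula_boundary(3)[OF C] of_rat_divide of_rat_add)
      also have "\<dots> = real (Suc i) / fact n - real i / fact n"
        using le by (subst (1 2) clip_id) (auto simp: field_simps)
      finally show ?thesis
        by (simp add: density_step_def i_def[symmetric] field_simps)
    qed
    then show ?thesis
      using lim[of q] by (simp add: LIMSEQ_const_iff)
  qed
  ultimately show ?case by blast
qed

text \<open>If p = a/b lies in the unit interval, then b divides n! for all n \<ge> b, so p is a
  grid point and the integral of the step density over the values below p telescopes to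
  \<open>C p q\<close> exactly. Dominated convergence carries this to the limit.\<close>

lemma integral_cond_cdf: "(\<integral>u. indicator {..<of_rat p} u * cond_cdf C q u \<partial>uniform01) = C p q"
proof -
  have main: "(\<integral>u. indicator {..<of_rat p} u * cond_cdf C q u \<partial>uniform01) = C p q" if p: "0 \<le> p" "p \<le> 1" for p
  proof (rule LIMSEQ_unique)
    obtain a b :: int where ab: "p = of_int a / of_int b" "b > 0" "coprime a b"
      by (metis Rat_cases Fract_of_int_quotient)
    have a: "0 \<le> a" "a \<le> b"
      using p ab by (auto simp: zero_le_divide_iff divide_le_eq)
    show "(\<lambda>j. \<integral>u. indicator {..<of_rat p} u * density_step C (level C j) q u \<partial>uniform01)
        \<longlonglongrightarrow> (\<integral>u. indicator {..<of_rat p} u * cond_cdf C q u \<partial>uniform01)"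
    proof (rule integral_dominated_convergence[where w = "\<lambda>_. 1"])
      show "AE u in uniform01. (\<lambda>j. indicator {..<of_rat p} u * density_step C (level C j) q u)
          \<longlonglongrightarrow> indicator {..<of_rat p} u * cond_cdf C q u"
        using AE_density_step_tendsto by eventually_elim (auto intro!: tendsto_intros)
      show "AE u in uniform01. norm (indicator {..<of_rat p} u * density_step C (level C j) q u) \<le> 1" for j
        using density_step_bounds by (auto simp: indicator_def)
    qed measurable

    have "(\<integral>u. indicator {..<of_rat p} u * density_step C n q u \<partial>uniform01) = C p q" if n: "nat b \<le> n" for n
    proof -
      have "nat b dvd fact n"
        using n ab(2) by (intro dvd_fact) auto
      then obtain c where c: "fact n = nat b * c" by blast
      define i where "i = nat a * c"
      have fact_c: "fact n = (of_int b * of_nat c :: rat)"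
        using c ab(2) by (metis of_nat_fact of_nat_mult of_nat_nat order_less_imp_le)
      then have "c \<noteq> 0"
        by (metis fact_nonzero mult_zero_right of_nat_0)
      then have p_eq: "of_nat i / fact n = p"
        using a ab(2) by (simp add: ab(1) i_def fact_c)
      have i_le: "i \<le> fact n"
        using a by (simp add: i_def c nat_mono)
      have p_real: "of_rat p = (of_nat i / fact n :: real)"
        unfolding p_eq[symmetric] by (simp add: of_rat_divide)
      have "AE u in uniform01. indicator {..<of_rat p} u * density_step C n q u
          = of_bool (cell n u < i) * density_step C n q u"
        unfolding p_real using AE_uniform01 by eventually_elim (auto simp: cell_less_iff)
      then have "(\<integral>u. indicator {..<of_rat p} u * density_step C n q u \<partial>uniform01)
          = (\<integral>u. of_bool (cell n u < i) * density_step C n q u \<partial>uniform01)"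
        by (intro integral_cong_AE) auto
      also have "\<dots> = (\<Sum>l<fact n. of_bool (l < i) * increment C n q l)"
        by (intro integral_density_step) simp
      also have "\<dots> = (\<Sum>l\<in>{0..<i}. increment C n q l)"
        using i_le by (intro sum.mono_neutral_cong_right) auto
      also have "\<dots> = C (of_nat i / fact n) q - C (of_nat 0 / fact n) q"
        unfolding increment_def by (subst sum_Suc_diff') auto
      also have "\<dots> = C p q"
        unfolding p_eq by (simp add: copula_boundary(1)[OF C])
      finally show ?thesis .
    qed
    then have "eventually (\<lambda>j. (\<integral>u. indicator {..<of_rat p} u * density_step C (level C j) q u \<partial>uniform01) = C p q) sequentially"
      using level_ge by (intro eventually_sequentiallyI[of "nat b"]) (meson order_trans)
    then show "(\<lambda>j. \<integral>u. indicator {..<of_rat p} u * density_step C (level C j) q u \<partial>uniform01) \<longlonglongrightarrow> C p q"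
      by (rule tendsto_eventually)
  qed
  consider "p \<le> 0" | "0 \<le> p" "p \<le> 1" | "1 \<le> p" by linarith
  then show ?thesis
  proof cases
    case 1
    have "(\<integral>u. indicator {..<of_rat p} u * cond_cdf C q u \<partial>uniform01) = (\<integral>u. 0 \<partial>uniform01)"
    proof (intro integral_cong_AE)
      show "AE u in uniform01. indicator {..<of_rat p} u * cond_cdf C q u = 0"
        using AE_uniform01
      proof eventually_elim
        case (elim u)
        have "real_of_rat p \<le> 0" using 1 by simp
        with elim have "\<not> u < of_rat p" by linarith
        then show ?case by simp
      qed
    qed auto
    with 1 show ?thesis by (simp add: copula_boundary(1)[OF C])
  next
    case 2 then show ?thesis by (rule main)
  next
    case 3
    have "(\<integral>u. indicator {..<of_rat p} u * cond_cdf C q u \<partial>uniform01)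
        = (\<integral>u. indicator {..<of_rat 1} u * cond_cdf C q u \<partial>uniform01)"
    proof (intro integral_cong_AE)
      show "AE u in uniform01. indicator {..<of_rat p} u * cond_cdf C q u = indicator {..<of_rat 1} u * cond_cdf C q u"
        using AE_uniform01
      proof eventually_elim
        case (elim u)
        have "1 \<le> real_of_rat p" using 3 by simp
        with elim have "u < of_rat p" by linarith
        with elim show ?case by simp
      qed
    qed auto
    also have "\<dots> = C 1 q" by (rule main) auto
    finally show ?thesis
      using 3 by (simp add: copula_boundary(4)[OF C])
  qed
qed

end

section \<open>Conditional quantiles and couplings\<close>

text \<open>The generalized inverse of the conditional distribution function. The inserted 1 keeps
  the set nonempty, and with \<open>0 \<le> q\<close> all values lie in the unit interval for
  arbitrary \<open>C\<close>, \<open>u\<close> and \<open>w\<close>.\<close>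

definition quantile :: "(rat \<Rightarrow> rat \<Rightarrow> real) \<Rightarrow> real \<Rightarrow> real \<Rightarrow> real" where
  "quantile C u w = Inf (insert 1 (of_rat ` {q. 0 \<le> q \<and> w < cond_cdf C q u}))"

text \<open>A strict bound on the infimum becomes an existential over rationals, hence a countable
  union; joint measurability of the quantile in all its arguments rests on this form.\<close>

lemma quantile_less_iff:
  "quantile C u w < x \<longleftrightarrow> 1 < x \<or> (\<exists>q\<ge>0. of_rat q < x \<and> w < cond_cdf C q u)"
proof -
  have "bdd_below (insert 1 (of_rat ` {q. 0 \<le> q \<and> w < cond_cdf C q u}) :: real set)"
    by (auto intro!: bdd_belowI2[of _ 0])
  then show ?thesis
    unfolding quantile_def by (subst cInf_less_iff) auto
qed

lemma quantile_bounds: "0 \<le> quantile C u w" "quantile C u w \<le> 1"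
proof -
  show "0 \<le> quantile C u w"
    unfolding quantile_def by (rule cInf_greatest) auto
  show "quantile C u w \<le> 1"
    unfolding quantile_def by (rule cInf_lower) (auto intro!: bdd_belowI2[of _ 0])
qed

context
  fixes C :: "'a \<Rightarrow> rat \<Rightarrow> rat \<Rightarrow> real" and M :: "'a measure"
  assumes C [measurable]: "\<And>p q. (\<lambda>x. C x p q) \<in> borel_measurable M"
begin

lemma measurable_increment_param [measurable]: "(\<lambda>x. increment (C x) n q i) \<in> borel_measurable M"
  unfolding increment_def by measurable

lemma measurable_level_param [measurable]: "(\<lambda>x. level (C x) j) \<in> M \<rightarrow>\<^sub>M count_space UNIV"
  unfolding level_def energy_def by measurable

text \<open>Both the grid level and the cell containing \<open>u x\<close> vary with
  \<open>x\<close>, but they take countably many values, so measurability is checked for each fixed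
  value.\<close>

lemma measurable_cond_cdf_param [measurable]:
  assumes [measurable]: "u \<in> borel_measurable M"
  shows "(\<lambda>x. cond_cdf (C x) q (u x)) \<in> borel_measurable M"
proof -
  have step: "(\<lambda>x. density_step (C x) n q (u x)) \<in> borel_measurable M" for n
    unfolding density_step_def
    by (intro borel_measurable_times measurable_const
        measurable_compose_countable[where f = "\<lambda>i x. increment (C x) n q i" and g = "\<lambda>x. cell n (u x)"]) auto
  have "(\<lambda>x. density_step (C x) (level (C x) j) q (u x)) \<in> borel_measurable M" for j
    by (rule measurable_compose_countable[where f = "\<lambda>n x. density_step (C x) n q (u x)", OF step]) measurable
  then show ?thesis
    unfolding cond_cdf_def by measurable
qed

lemma measurable_quantile_param:
  assumes [measurable]: "u \<in> borel_measurable M" "w \<in> borel_measurable M"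
  shows "(\<lambda>x. quantile (C x) (u x) (w x)) \<in> borel_measurable M"
proof (rule borel_measurableI_less)
  fix y :: real
  show "{x \<in> space M. quantile (C x) (u x) (w x) < y} \<in> sets M"
    unfolding quantile_less_iff by measurable
qed

end

section \<open>Couplings sampled from copulas\<close>

abbreviation square_borel :: "(real \<times> real) measure" where
  "square_borel \<equiv> restrict_space borel unit_square"

lemma measurable_fst_square [measurable]: "fst \<in> borel_measurable square_borel"
  and measurable_snd_square [measurable]: "snd \<in> borel_measurable square_borel"
  by (auto intro!: measurable_restrict_space1 simp: borel_prod[symmetric])

lemma measurable_into_square:
  assumes [measurable]: "f \<in> borel_measurable M" "g \<in> borel_measurable M"
    and "\<And>x. x \<in> space M \<Longrightarrow> f x \<in> {0..1} \<and> g x \<in> {0..1}"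
  shows "(\<lambda>x. (f x, g x)) \<in> M \<rightarrow>\<^sub>M square_borel"
proof (rule measurable_restrict_space2)
  show "(\<lambda>x. (f x, g x)) \<in> borel_measurable M"
    unfolding borel_prod[symmetric] by measurable
qed (use assms(3) in auto)

text \<open>The second coordinate samples the conditional law given the first by inverting its
  distribution function at the noise \<open>w\<close>. The underlying space of
  \<open>uniform01\<close> is the whole line, so \<open>clip\<close> forces the first coordinate
  into the square; almost surely it changes nothing.\<close>

definition copula_point :: "(rat \<Rightarrow> rat \<Rightarrow> real) \<Rightarrow> real \<times> real \<Rightarrow> real \<times> real" where
  "copula_point C = (\<lambda>(u, w). (clip u, quantile C u w))"

definition copula_measure :: "(rat \<Rightarrow> rat \<Rightarrow> real) \<Rightarrow> (real \<times> real) measure" where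
  "copula_measure C = distr (uniform01 \<Otimes>\<^sub>M uniform01) square_borel (copula_point C)"

lemma measurable_copula_point_param:
  assumes [measurable]: "\<And>p q. (\<lambda>x. C x p q) \<in> borel_measurable M"
  shows "(\<lambda>(x, z). copula_point (C x) z) \<in> M \<Otimes>\<^sub>M (uniform01 \<Otimes>\<^sub>M uniform01) \<rightarrow>\<^sub>M square_borel"
proof -
  have "(\<lambda>y. quantile (C (fst y)) (fst (snd y)) (snd (snd y))) \<in> borel_measurable (M \<Otimes>\<^sub>M (uniform01 \<Otimes>\<^sub>M uniform01))"
    by (rule measurable_quantile_param) measurable
  then have "(\<lambda>y. (clip (fst (snd y)), quantile (C (fst y)) (fst (snd y)) (snd (snd y))))
      \<in> M \<Otimes>\<^sub>M (uniform01 \<Otimes>\<^sub>M uniform01) \<rightarrow>\<^sub>M square_borel"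
    by (intro measurable_into_square) (auto simp: quantile_bounds)
  then show ?thesis
    by (simp add: copula_point_def case_prod_unfold)
qed

lemma measurable_copula_point [measurable]: "copula_point C \<in> uniform01 \<Otimes>\<^sub>M uniform01 \<rightarrow>\<^sub>M square_borel"
  using measurable_compose[OF measurable_Pair1' measurable_copula_point_param, of undefined "count_space UNIV" "\<lambda>_. C"]
  by (simp add: comp_def)

lemma measurable_copula_measure:
  assumes "\<And>p q. (\<lambda>x. C x p q) \<in> borel_measurable M"
  shows "(\<lambda>x. copula_measure (C x)) \<in> M \<rightarrow>\<^sub>M prob_algebra square_borel"
  unfolding copula_measure_def
  by (rule measurable_distr_prob_space2[OF measurable_const measurable_copula_point_param[OF assms]])
    (auto simp: space_prob_algebra intro!: prob_space_pair prob_space_uniform01)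

text \<open>The bounds are strict: a bound of 1 still omits an edge of the square, and 2 is used
  where no restriction is meant.\<close>

definition corner :: "rat \<Rightarrow> rat \<Rightarrow> (real \<times> real) set" where
  "corner p q = {z \<in> unit_square. fst z < of_rat p \<and> snd z < of_rat q}"

lemma space_square [simp]: "space square_borel = unit_square"
  by (simp add: space_restrict_space)

lemma sets_corner [measurable]: "corner p q \<in> sets square_borel"
proof -
  have "{z \<in> space square_borel. fst z < of_rat p \<and> snd z < of_rat q} \<in> sets square_borel"
    by measurable
  then show ?thesis by (simp add: corner_def)
qed

text \<open>By Fubini the mass of the corner is the integral over u < p of the chance h(u) that the
  quantile is below q. For almost every u this chance lies between the conditional distribution
  function at any y < q with y \<ge> 0 and at q. The integrals of these bounds are
  \<open>C p y\<close> and \<open>C p q\<close>, and the Lipschitz bound closes the gap as y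
  approaches q.\<close>

lemma measure_copula_measure:
  assumes C: "copula C"
  shows "measure (copula_measure C) (corner p q) = C p q"
proof -
  define h where "h u = measure uniform01 {w. quantile C u w < of_rat q}" for u
  have quant[measurable]: "(\<lambda>z. quantile C (fst z) (snd z)) \<in> borel_measurable (uniform01 \<Otimes>\<^sub>M uniform01)"
    by (rule measurable_quantile_param) measurable
  have [measurable]: "(\<lambda>w. quantile C u w) \<in> borel_measurable borel" for u
    by (rule measurable_quantile_param) measurable
  let ?A = "{z. clip (fst z) < of_rat p \<and> quantile C (fst z) (snd z) < of_rat q}"
  have A: "?A \<in> sets (uniform01 \<Otimes>\<^sub>M uniform01)"
  proof -
    have "{z \<in> space (uniform01 \<Otimes>\<^sub>M uniform01). clip (fst z) < of_rat p \<and> quantile C (fst z) (snd z) < of_rat q}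
        \<in> sets (uniform01 \<Otimes>\<^sub>M uniform01)"
      by measurable
    then show ?thesis by (simp add: space_pair_measure)
  qed
  have h_meas: "h \<in> borel_measurable uniform01"
  proof -
    have "(\<lambda>u. measure uniform01 (Pair u -` {z. quantile C (fst z) (snd z) < of_rat q})) \<in> borel_measurable uniform01"
    proof -
      have "{z \<in> space (uniform01 \<Otimes>\<^sub>M uniform01). quantile C (fst z) (snd z) < of_rat q} \<in> sets (uniform01 \<Otimes>\<^sub>M uniform01)"
        by measurable
      then have "{z. quantile C (fst z) (snd z) < of_rat q} \<in> sets (uniform01 \<Otimes>\<^sub>M uniform01)"
        by (simp add: space_pair_measure)
      from uniform01.measurable_emeasure_Pair[OF this] show ?thesis
        by (simp add: measure_def)
    qed
    then show ?thesis by (simp add: h_def[abs_def] vimage_def)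
  qed
  have h_bounds: "0 \<le> h u" "h u \<le> 1" for u
    by (auto simp: h_def)
  have sub: "cond_cdf C y u \<le> h u" if u: "0 \<le> cond_cdf C y u \<and> cond_cdf C y u \<le> 1" and y: "0 \<le> y" "y < q" for u y
  proof -
    have "cond_cdf C y u = measure uniform01 {..<cond_cdf C y u}"
      using u by (simp add: measure_uniform01_lessThan clip_id)
    also have "\<dots> \<le> h u"
      unfolding h_def using y by (intro uniform01.finite_measure_mono) (auto simp: quantile_less_iff of_rat_less)
    finally show ?thesis .
  qed
  have sup: "h u \<le> cond_cdf C q u"
    if u: "0 \<le> cond_cdf C q u" "cond_cdf C q u \<le> 1" "\<And>q q'. q \<le> q' \<Longrightarrow> cond_cdf C q u \<le> cond_cdf C q' u"
      "\<And>q. 1 \<le> q \<Longrightarrow> cond_cdf C q u = 1" for u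
  proof (cases "1 < q")
    case True then show ?thesis using u(4)[of q] h_bounds(2) by simp
  next
    case False
    then have "{w. quantile C u w < of_rat q} \<subseteq> {..<cond_cdf C q u}"
    proof (intro subsetI)
      fix w assume "w \<in> {w. quantile C u w < of_rat q}"
      with False obtain y where "y < q" "w < cond_cdf C y u"
        by (auto simp: quantile_less_iff of_rat_less)
      with u(3)[of y q] show "w \<in> {..<cond_cdf C q u}" by auto
    qed
    then have "h u \<le> measure uniform01 {..<cond_cdf C q u}"
      unfolding h_def by (intro uniform01.finite_measure_mono) auto
    then show ?thesis
      using u by (simp add: measure_uniform01_lessThan clip_id)
  qed
  have int: "integrable uniform01 (\<lambda>u. indicator {..<of_rat p} u * h u)"
    using h_bounds h_meas by (intro uniform01.integrable_const_bound[where B = 1]) (auto simp: indicator_def)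
  have int_cdf: "integrable uniform01 (\<lambda>u. indicator {..<of_rat p} u * cond_cdf C q u)" for q
  proof (rule uniform01.integrable_const_bound[where B = 1])
    show "AE u in uniform01. norm (indicator {..<of_rat p} u * cond_cdf C q u) \<le> 1"
      using AE_cond_cdf[OF C] by eventually_elim (auto simp: indicator_def)
  qed (auto intro: measurable_cond_cdf[OF C])
  define I where "I = (\<integral>u. indicator {..<of_rat p} u * h u \<partial>uniform01)"
  have "emeasure (copula_measure C) (corner p q) = emeasure (uniform01 \<Otimes>\<^sub>M uniform01) ?A"
    unfolding copula_measure_def
    by (subst emeasure_distr[OF measurable_copula_point sets_corner])
      (auto simp: space_pair_measure corner_def copula_point_def quantile_bounds intro!: arg_cong2[where f = emeasure])
  also have "\<dots> = (\<integral>\<^sup>+u. emeasure uniform01 (Pair u -` ?A) \<partial>uniform01)"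
    by (rule uniform01.emeasure_pair_measure_alt[OF A])
  also have "\<dots> = (\<integral>\<^sup>+u. ennreal (indicator {..<of_rat p} u * h u) \<partial>uniform01)"
  proof (intro nn_integral_cong_AE)
    show "AE u in uniform01. emeasure uniform01 (Pair u -` ?A) = ennreal (indicator {..<of_rat p} u * h u)"
      using AE_uniform01
      by eventually_elim (auto simp: clip_id indicator_def h_def vimage_def uniform01.emeasure_eq_measure)
  qed
  also have "\<dots> = ennreal I"
    unfolding I_def by (intro nn_integral_eq_integral int) (simp add: h_bounds)
  finally have "emeasure (copula_measure C) (corner p q) = ennreal I" .
  moreover have "0 \<le> I"
    unfolding I_def by (intro Bochner_Integration.integral_nonneg) (simp add: h_bounds)
  ultimately have eq_I: "measure (copula_measure C) (corner p q) = I"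
    by (simp add: measure_def)
  have upper': "(\<integral>u. indicator {..<of_rat p} u * h u \<partial>uniform01)
      \<le> (\<integral>u. indicator {..<of_rat p} u * cond_cdf C q u \<partial>uniform01)"
  proof (intro integral_mono_AE int int_cdf)
    show "AE u in uniform01. indicator {..<of_rat p} u * h u \<le> indicator {..<of_rat p} u * cond_cdf C q u"
      using AE_cond_cdf[OF C] by eventually_elim (auto simp: indicator_def intro!: sup)
  qed
  have upper: "I \<le> C p q"
    unfolding I_def
    by (subst integral_cond_cdf[OF C, symmetric], rule upper')
  have lower': "(\<integral>u. indicator {..<of_rat p} u * cond_cdf C y u \<partial>uniform01)
      \<le> (\<integral>u. indicator {..<of_rat p} u * h u \<partial>uniform01)" if "0 \<le> y" "y < q" for y
  proof (intro integral_mono_AE int int_cdf)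
    show "AE u in uniform01. indicator {..<of_rat p} u * cond_cdf C y u \<le> indicator {..<of_rat p} u * h u"
      using AE_cond_cdf[OF C] by eventually_elim (auto simp: indicator_def intro!: sub that)
  qed
  have lower: "C p y \<le> I" if "0 \<le> y" "y < q" for y
    unfolding I_def
    by (subst integral_cond_cdf[OF C, symmetric], rule lower'[OF that])
  have "C p q \<le> I"
  proof (cases "q \<le> 0")
    case True then show ?thesis using \<open>0 \<le> I\<close> by (simp add: copula_boundary(2)[OF C])
  next
    case False
    show ?thesis
    proof (rule field_le_epsilon)
      fix e :: real assume "0 < e"
      then obtain y where y: "max 0 (of_rat q - e) < of_rat y" "of_rat y < (of_rat q :: real)"
        using of_rat_dense[of "max 0 (of_rat q - e)" "of_rat q"] False by auto
      then have y': "0 \<le> y" "y < q" by (auto simp: of_rat_less)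
      have "C p q - C p y \<le> clip (of_rat q) - clip (of_rat y)"
        using y' by (intro copula_lipschitz2[OF C]) simp
      also have "\<dots> \<le> of_rat q - of_rat y"
        using y by (intro clip_diff_le) simp
      also have "\<dots> \<le> e" using y by simp
      finally show "C p q \<le> I + e"
        using lower[OF y'] by simp
    qed
  qed
  with upper eq_I show ?thesis by simp
qed

section \<open>Generators of the Borel sets of the square and of the line\<close>

lemma borel_measurableI_rat_less:
  fixes f :: "'a \<Rightarrow> real"
  assumes "\<And>q. {x \<in> space M. f x < of_rat q} \<in> sets M"
  shows "f \<in> borel_measurable M"
proof (rule borel_measurableI_less)
  fix y :: real
  have "{x \<in> space M. f x < y} = (\<Union>q\<in>{q. of_rat q < y}. {x \<in> space M. f x < of_rat q})"
    using of_rat_dense[of _ y] by (auto intro: less_trans)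
  also have "\<dots> \<in> sets M"
    using assms by (intro sets.countable_UN') auto
  finally show "{x \<in> space M. f x < y} \<in> sets M" .
qed

text \<open>One inclusion is the assumption that \<open>G\<close> consists of measurable sets. The
  other is measurability of the identity, which in the applications reduces to that of the
  coordinates.\<close>

lemma sets_eq_sigma_setsI:
  assumes G: "G \<subseteq> sets N" "space N = \<Omega>" and id: "(\<lambda>x. x) \<in> sigma \<Omega> G \<rightarrow>\<^sub>M N"
  shows "sets N = sigma_sets \<Omega> G"
proof
  have G': "G \<subseteq> Pow \<Omega>"
    using G sets.sets_into_space by blast
  show "sigma_sets \<Omega> G \<subseteq> sets N"
    using sets.sigma_sets_subset[OF G(1)] G(2) by simp
  show "sets N \<subseteq> sigma_sets \<Omega> G"
  proof
    fix A assume A: "A \<in> sets N"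
    have "(\<lambda>x. x) -` A \<inter> space (sigma \<Omega> G) \<in> sets (sigma \<Omega> G)"
      using id A by (rule measurable_sets)
    moreover have "(\<lambda>x. x) -` A \<inter> space (sigma \<Omega> G) = A"
      using sets.sets_into_space[OF A] G(2) G' by (auto simp: space_measure_of)
    ultimately show "A \<in> sigma_sets \<Omega> G"
      using G' by (simp add: sets_measure_of)
  qed
qed

lemma sets_square_corners: "sets square_borel = sigma_sets unit_square (range (\<lambda>(p, q). corner p q))"
proof (rule sets_eq_sigma_setsI)
  let ?N = "sigma unit_square (range (\<lambda>(p, q). corner p q))"
  have G: "range (\<lambda>(p, q). corner p q) \<subseteq> Pow unit_square"
    by (auto simp: corner_def)
  have corner: "corner p q \<in> sets ?N" for p q
    using G by (auto simp: sets_measure_of)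
  have fst: "fst \<in> borel_measurable ?N"
  proof (rule borel_measurableI_rat_less)
    fix q
    have "{x \<in> space ?N. fst x < of_rat q} = corner q 2"
      using G by (auto simp: space_measure_of corner_def)
    then show "{x \<in> space ?N. fst x < of_rat q} \<in> sets ?N"
      by (simp add: corner)
  qed
  have snd: "snd \<in> borel_measurable ?N"
  proof (rule borel_measurableI_rat_less)
    fix q
    have "{x \<in> space ?N. snd x < of_rat q} = corner 2 q"
      using G by (auto simp: space_measure_of corner_def)
    then show "{x \<in> space ?N. snd x < of_rat q} \<in> sets ?N"
      by (simp add: corner)
  qed
  have "(\<lambda>x. (fst x, snd x)) \<in> ?N \<rightarrow>\<^sub>M square_borel"
    using G by (intro measurable_into_square fst snd) (auto simp: space_measure_of)
  then show "(\<lambda>x. x) \<in> ?N \<rightarrow>\<^sub>M square_borel" by simp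
qed (auto intro: sets_corner)

lemma corner_Int: "corner p q \<inter> corner p' q' = corner (min p p') (min q q')"
  by (auto simp: corner_def min_def of_rat_less_eq; metis less_le_trans le_less_trans not_le of_rat_less_eq less_imp_le)

lemma Int_stable_corners: "Int_stable (range (\<lambda>(p, q). corner p q))"
proof (rule Int_stableI, safe)
  fix p q p' q'
  show "corner p q \<inter> corner p' q' \<in> range (\<lambda>(p, q). corner p q)"
    unfolding corner_Int by (rule range_eqI[where x = "(min p p', min q q')"]) simp
qed

lemma corner_2_2: "corner 2 2 = unit_square"
  by (auto simp: corner_def)

lemma measure_eqI_corners:
  assumes "sets \<mu> = sets square_borel" "sets \<nu> = sets square_borel" "prob_space \<mu>" "prob_space \<nu>"
    and "\<And>p q. measure \<mu> (corner p q) = measure \<nu> (corner p q)"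
  shows "\<mu> = \<nu>"
proof (rule measure_eqI_generator_eq[OF Int_stable_corners])
  interpret \<mu>: prob_space \<mu> by fact
  interpret \<nu>: prob_space \<nu> by fact
  show "range (\<lambda>_ :: nat. unit_square) \<subseteq> range (\<lambda>(p, q). corner p q)"
    by (auto simp: corner_2_2[symmetric])
  show "X \<in> range (\<lambda>(p, q). corner p q) \<Longrightarrow> emeasure \<mu> X = emeasure \<nu> X" for X
    using assms(5) by (auto simp: \<mu>.emeasure_eq_measure \<nu>.emeasure_eq_measure)
  show "emeasure \<mu> unit_square \<noteq> \<infinity>" by simp
qed (use assms in \<open>auto simp: sets_square_corners corner_def\<close>)

lemma measure_eqI_rat_lessThan:
  fixes \<mu> \<nu> :: "real measure"
  assumes "sets \<mu> = sets borel" "sets \<nu> = sets borel" "prob_space \<mu>" "prob_space \<nu>"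
    and "\<And>q. measure \<mu> {..<of_rat q} = measure \<nu> {..<of_rat q}"
  shows "\<mu> = \<nu>"
proof -
  interpret \<mu>: prob_space \<mu> by fact
  interpret \<nu>: prob_space \<nu> by fact
  let ?G = "range (\<lambda>q. {..<real_of_rat q})"
  have gen: "sets borel = sigma_sets UNIV ?G"
  proof (rule sets_eq_sigma_setsI)
    show "(\<lambda>x. x) \<in> borel_measurable (sigma UNIV ?G)"
      by (rule borel_measurableI_rat_less) (auto simp: space_measure_of sets_measure_of lessThan_def[symmetric])
  qed auto
  show ?thesis
  proof (rule measure_eqI_generator_eq[where E = ?G and A = "\<lambda>n. {..<real n}"])
    show "Int_stable ?G"
    proof (rule Int_stableI, safe)
      fix q q'
      have "{..<real_of_rat q} \<inter> {..<real_of_rat q'} = {..<real_of_rat (min q q')}"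
        by (auto simp: min_def of_rat_less_eq)
          (metis less_le_trans of_rat_less_eq not_le less_imp_le)+
      then show "{..<real_of_rat q} \<inter> {..<real_of_rat q'} \<in> ?G" by simp
    qed
    show "range (\<lambda>n. {..<real n}) \<subseteq> ?G"
    proof safe
      fix n
      have "{..<real n} = {..<real_of_rat (of_nat n)}" by simp
      then show "{..<real n} \<in> ?G" by (rule range_eqI)
    qed
    show "(\<Union>n. {..<real n}) = UNIV"
      using reals_Archimedean2 by auto
  qed (use assms gen in \<open>auto simp: \<mu>.emeasure_eq_measure \<nu>.emeasure_eq_measure\<close>)
qed

lemma prob_space_copula_measure: "prob_space (copula_measure C)"
  unfolding copula_measure_def
  by (intro prob_space.prob_space_distr prob_space_pair prob_space_uniform01 measurable_copula_point)

lemma sets_copula_measure [simp]: "sets (copula_measure C) = sets square_borel"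
  by (simp add: copula_measure_def)

lemma copula_measure_coupling:
  assumes C: "copula C"
  shows "copula_measure C \<in> uniform_couplings"
proof -
  let ?\<nu> = "copula_measure C"
  interpret prob_space ?\<nu> by (rule prob_space_copula_measure)
  have [simp]: "space ?\<nu> = unit_square"
    by (simp add: copula_measure_def)
  have [measurable]: "fst \<in> borel_measurable ?\<nu>" "snd \<in> borel_measurable ?\<nu>"
    by (simp_all cong: measurable_cong_sets)
  have "distr ?\<nu> borel fst = uniform01"
  proof (rule measure_eqI_rat_lessThan)
    fix q
    have "fst -` {..<real_of_rat q} \<inter> space ?\<nu> = corner q 2"
      by (auto simp: corner_def)
    then show "measure (distr ?\<nu> borel fst) {..<of_rat q} = measure uniform01 {..<of_rat q}"
      by (simp add: measure_distr measure_copula_measure[OF C] copula_boundary(3)[OF C] measure_uniform01_lessThan)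
  qed (auto intro: prob_space_distr prob_space_uniform01)
  moreover have "distr ?\<nu> borel snd = uniform01"
  proof (rule measure_eqI_rat_lessThan)
    fix q
    have "snd -` {..<real_of_rat q} \<inter> space ?\<nu> = corner 2 q"
      by (auto simp: corner_def)
    then show "measure (distr ?\<nu> borel snd) {..<of_rat q} = measure uniform01 {..<of_rat q}"
      by (simp add: measure_distr measure_copula_measure[OF C] copula_boundary(4)[OF C] measure_uniform01_lessThan)
  qed (auto intro: prob_space_distr prob_space_uniform01)
  ultimately show ?thesis
    by (simp add: uniform_couplings_def prob_measures_on_def prob_space_axioms)
qed

section \<open>The copula of a coupling\<close>

definition copula_of :: "(real \<times> real) measure \<Rightarrow> rat \<Rightarrow> rat \<Rightarrow> real" where
  "copula_of \<nu> p q = measure \<nu> (corner p q)"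

lemma uniform_couplingsD:
  assumes "\<nu> \<in> uniform_couplings"
  shows "prob_space \<nu>" "sets \<nu> = sets square_borel" "space \<nu> = unit_square"
    "distr \<nu> borel fst = uniform01" "distr \<nu> borel snd = uniform01"
  using assms sets_eq_imp_space_eq[of \<nu> square_borel] by (auto simp: uniform_couplings_def prob_measures_on_def)

lemma copula_copula_of:
  assumes \<nu>: "\<nu> \<in> uniform_couplings"
  shows "copula (copula_of \<nu>)"
proof -
  note D = uniform_couplingsD[OF \<nu>]
  interpret prob_space \<nu> by (rule D)
  note [simp] = D(3) and [measurable_cong] = D(2)
  have [measurable]: "fst \<in> borel_measurable \<nu>" "snd \<in> borel_measurable \<nu>"
    by measurable
  have [measurable]: "corner p q \<in> sets \<nu>" for p q
    by (simp add: D)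
  \<comment> \<open>Because corners have strict bounds, a corner with bound 1 differs from the full
    strip by an edge of the square; uniform marginals make the edges null.\<close>
  have ae: "AE z in \<nu>. fst z < 1" "AE z in \<nu>. snd z < 1"
  proof -
    have u: "AE x in uniform01. x < 1"
      using AE_uniform01 by eventually_elim simp
    show "AE z in \<nu>. fst z < 1"
      using u unfolding D(4)[symmetric] by (rule AE_distrD[rotated]) measurable
    show "AE z in \<nu>. snd z < 1"
      using u unfolding D(5)[symmetric] by (rule AE_distrD[rotated]) measurable
  qed
  have m1: "measure \<nu> {z \<in> unit_square. fst z < x} = clip x" for x
  proof -
    have "measure (distr \<nu> borel fst) {..<x} = measure \<nu> {z \<in> unit_square. fst z < x}"
      by (subst measure_distr) (auto intro!: arg_cong[where f = prob])
    then show ?thesis by (simp add: D measure_uniform01_lessThan)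
  qed
  have m2: "measure \<nu> {z \<in> unit_square. snd z < x} = clip x" for x
  proof -
    have "measure (distr \<nu> borel snd) {..<x} = measure \<nu> {z \<in> unit_square. snd z < x}"
      by (subst measure_distr) (auto intro!: arg_cong[where f = prob])
    then show ?thesis by (simp add: D measure_uniform01_lessThan)
  qed
  show ?thesis
    unfolding copula_def
  proof (intro conjI allI impI)
    fix p p' q q' :: rat assume le: "p \<le> p'" "q \<le> q'"
    have le': "of_rat p \<le> (of_rat p' :: real)" "of_rat q \<le> (of_rat q' :: real)"
      using le by (simp_all add: of_rat_less_eq)
    then have sub: "corner p x \<subseteq> corner p' x" for x
      by (auto simp: corner_def)
    have "measure \<nu> (corner p' q - corner p q) \<le> measure \<nu> (corner p' q' - corner p q')"
    proof (rule finite_measure_mono)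
      show "corner p' q - corner p q \<subseteq> corner p' q' - corner p q'"
        using le' by (auto simp: corner_def)
    qed measurable
    then show "0 \<le> copula_of \<nu> p' q' - copula_of \<nu> p q' - copula_of \<nu> p' q + copula_of \<nu> p q"
      using sub by (simp add: finite_measure_Diff copula_of_def)
  next
    fix p q :: rat assume "p \<le> 0 \<or> q \<le> 0"
    then have "of_rat p \<le> (0::real) \<or> of_rat q \<le> (0::real)"
      by simp
    then have "corner p q = {}"
      by (auto simp: corner_def simp del: of_rat_le_0_iff)
    then show "copula_of \<nu> p q = 0"
      by (simp add: copula_of_def)
  next
    fix p q :: rat assume "1 \<le> q"
    then have q: "(1::real) \<le> of_rat q" by simp
    have "copula_of \<nu> p q = measure \<nu> {z \<in> unit_square. fst z < of_rat p}"
      unfolding copula_of_def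
    proof (rule finite_measure_eq_AE)
      show "AE z in \<nu>. z \<in> corner p q \<longleftrightarrow> z \<in> {z \<in> unit_square. fst z < of_rat p}"
        using ae(2) by eventually_elim (use q in \<open>auto simp: corner_def simp del: one_le_of_rat_iff\<close>)
      have "{z \<in> space \<nu>. fst z < of_rat p} \<in> sets \<nu>" by measurable
      then show "{z \<in> unit_square. fst z < of_rat p} \<in> sets \<nu>" by simp
    qed measurable
    then show "copula_of \<nu> p q = clip (of_rat p)" by (simp add: m1)
  next
    fix p q :: rat assume "1 \<le> p"
    then have p: "(1::real) \<le> of_rat p" by simp
    have "copula_of \<nu> p q = measure \<nu> {z \<in> unit_square. snd z < of_rat q}"
      unfolding copula_of_def
    proof (rule finite_measure_eq_AE)
      show "AE z in \<nu>. z \<in> corner p q \<longleftrightarrow> z \<in> {z \<in> unit_square. snd z < of_rat q}"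
        using ae(1) by eventually_elim (use p in \<open>auto simp: corner_def simp del: one_le_of_rat_iff\<close>)
      have "{z \<in> space \<nu>. snd z < of_rat q} \<in> sets \<nu>" by measurable
      then show "{z \<in> unit_square. snd z < of_rat q} \<in> sets \<nu>" by simp
    qed measurable
    then show "copula_of \<nu> p q = clip (of_rat q)" by (simp add: m2)
  qed
qed

text \<open>Corner masses determine a probability measure on the square, so every coupling is
  reproduced by the explicit sampler. This is what lets one sampling formula serve all
  couplings.\<close>

lemma copula_measure_copula_of:
  assumes \<nu>: "\<nu> \<in> uniform_couplings"
  shows "copula_measure (copula_of \<nu>) = \<nu>"
  using measure_copula_measure[OF copula_copula_of[OF \<nu>]] uniform_couplingsD[OF \<nu>]
  by (intro measure_eqI_corners prob_space_copula_measure) (auto simp: copula_of_def)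

section \<open>The weak topology on the square\<close>

lemma space_prob_algebra_square: "space (prob_algebra square_borel) = prob_measures_on unit_square"
  by (auto simp: space_prob_algebra prob_measures_on_def)

lemma weak_topology_subset: "openin (weak_topology unit_square) W \<Longrightarrow> W \<subseteq> prob_measures_on unit_square"
proof -
  assume "openin (weak_topology unit_square) W"
  then have "W \<subseteq> topspace (weak_topology unit_square)"
    by (rule openin_subset)
  also have "\<dots> \<subseteq> prob_measures_on unit_square"
    unfolding weak_topology_def topology_generated_by_topspace by auto
  finally show ?thesis .
qed

lemma space_weak_borel: "space (weak_borel unit_square) = prob_measures_on unit_square"
  unfolding weak_borel_def using weak_topology_subset by (intro space_measure_of) auto

lemma sets_weak_borel:
  "sets (weak_borel unit_square) = sigma_sets (prob_measures_on unit_square) {W. openin (weak_topology unit_square) W}"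
  unfolding weak_borel_def using weak_topology_subset by (intro sets_measure_of) auto

lemma integral_measurable_weak_borel:
  fixes f :: "real \<times> real \<Rightarrow> real"
  assumes "continuous_on unit_square f"
  shows "(\<lambda>\<nu>. \<integral>x. f x \<partial>\<nu>) \<in> borel_measurable (weak_borel unit_square)"
proof (rule borel_measurableI)
  fix G :: "real set" assume "open G"
  have "bounded (f ` unit_square)"
    by (intro compact_imp_bounded compact_continuous_image assms compact_Times) auto
  with assms \<open>open G\<close> have "openin (weak_topology unit_square) {\<nu> \<in> prob_measures_on unit_square. (\<integral>x. f x \<partial>\<nu>) \<in> G}"
    unfolding weak_topology_def by (intro topology_generated_by_Basis) blast
  moreover have "(\<lambda>\<nu>. \<integral>x. f x \<partial>\<nu>) -` G \<inter> space (weak_borel unit_square)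
      = {\<nu> \<in> prob_measures_on unit_square. (\<integral>x. f x \<partial>\<nu>) \<in> G}"
    by (auto simp: space_weak_borel)
  ultimately show "(\<lambda>\<nu>. \<integral>x. f x \<partial>\<nu>) -` G \<inter> space (weak_borel unit_square) \<in> sets (weak_borel unit_square)"
    by (auto simp: sets_weak_borel)
qed

text \<open>The ramps vanish at \<open>a\<close> and beyond, so their limit is the indicator of the
  open half-line, in agreement with the strict bounds of corners.\<close>

lemma ramp_tendsto_indicator:
  "(\<lambda>n. min 1 (max 0 (real n * (a - x)))) \<longlonglongrightarrow> (indicator {..<a} x :: real)"
proof (cases "x < a")
  case True
  have "eventually (\<lambda>n. min 1 (max 0 (real n * (a - x))) = 1) sequentially"
  proof (rule eventually_sequentiallyI[of "nat \<lceil>1 / (a - x)\<rceil>"])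
    fix n assume "nat \<lceil>1 / (a - x)\<rceil> \<le> n"
    then have "1 / (a - x) \<le> real n"
      by linarith
    then have "1 \<le> real n * (a - x)"
      using True by (simp add: field_simps)
    then show "min 1 (max 0 (real n * (a - x))) = 1"
      by simp
  qed
  then show ?thesis
    using True by (auto intro: tendsto_eventually)
next
  case False
  then have "real n * (a - x) \<le> 0" for n
    by (intro mult_nonneg_nonpos) auto
  then have "max 0 (real n * (a - x)) = 0" for n
    by (rule max_absorb1)
  with False show ?thesis by simp
qed

lemma measure_corner_measurable_weak_borel:
  "(\<lambda>\<nu>. measure \<nu> (corner p q)) \<in> borel_measurable (weak_borel unit_square)"
proof (rule borel_measurable_LIMSEQ_real)
  define f where "f n z = min 1 (max 0 (real n * (of_rat p - fst z))) * min 1 (max 0 (real n * (of_rat q - snd z)))"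
    for n and z :: "real \<times> real"
  show "(\<lambda>\<nu>. \<integral>z. f n z \<partial>\<nu>) \<in> borel_measurable (weak_borel unit_square)" for n
    unfolding f_def by (intro integral_measurable_weak_borel continuous_intros)
  fix \<nu> assume "\<nu> \<in> space (weak_borel unit_square)"
  then have [measurable_cong]: "sets \<nu> = sets square_borel" and "prob_space \<nu>"
    by (auto simp: space_weak_borel prob_measures_on_def)
  interpret prob_space \<nu> by fact
  have sp: "space \<nu> = unit_square"
    using sets_eq_imp_space_eq[OF \<open>sets \<nu> = _\<close>] by simp
  have [measurable]: "f n \<in> borel_measurable \<nu>" for n
    unfolding f_def by measurable
  have [measurable]: "corner p q \<in> sets \<nu>"
    using \<open>sets \<nu> = _\<close> sets_corner by simp
  have "(\<lambda>n. \<integral>z. f n z \<partial>\<nu>) \<longlonglongrightarrow> (\<integral>z. indicator (corner p q) z \<partial>\<nu>)"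
  proof (rule integral_dominated_convergence[where w = "\<lambda>_. 1"])
    show "AE z in \<nu>. (\<lambda>n. f n z) \<longlonglongrightarrow> indicator (corner p q) z"
    proof (rule AE_I2)
      fix z assume "z \<in> space \<nu>"
      then have "indicator (corner p q) z = (indicator {..<of_rat p} (fst z) * indicator {..<of_rat q} (snd z) :: real)"
        by (auto simp: sp corner_def indicator_def)
      then show "(\<lambda>n. f n z) \<longlonglongrightarrow> indicator (corner p q) z"
        unfolding f_def by (simp only:) (intro tendsto_mult ramp_tendsto_indicator)
    qed
    show "AE z in \<nu>. norm (f n z) \<le> 1" for n
      unfolding f_def by (auto simp: abs_mult intro!: mult_le_one)
  qed auto
  then show "(\<lambda>n. \<integral>z. f n z \<partial>\<nu>) \<longlonglongrightarrow> measure \<nu> (corner p q)"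
    by (simp add: sp Int_absorb2 corner_def subset_iff)
qed

text \<open>The cells are half-open, so for n > 0 a coordinate equal to 1 receives the extra index
  n; sums over cells therefore run up to and including n.\<close>

definition grid_cell :: "nat \<Rightarrow> nat \<Rightarrow> nat \<Rightarrow> (real \<times> real) set" where
  "grid_cell n i j = {z \<in> unit_square. nat \<lfloor>real n * fst z\<rfloor> = i \<and> nat \<lfloor>real n * snd z\<rfloor> = j}"

lemma sets_grid_cell: "grid_cell n i j \<in> sets square_borel"
proof -
  have "{z \<in> space square_borel. nat \<lfloor>real n * fst z\<rfloor> = i \<and> nat \<lfloor>real n * snd z\<rfloor> = j} \<in> sets square_borel"
    by measurable
  then show ?thesis by (simp add: grid_cell_def)
qed

text \<open>Uniform continuity on the compact square gives one mesh for which sampling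
  \<open>f\<close> at the lower left corner of each cell errs by less than \<open>e\<close>
  everywhere. The mesh depends on \<open>f\<close> and \<open>e\<close> only, so it serves all
  measures at once.\<close>

lemma integral_grid_approx:
  fixes f :: "real \<times> real \<Rightarrow> real"
  assumes f: "continuous_on unit_square f" and "0 < e"
  obtains n where "\<And>\<nu>. \<nu> \<in> prob_measures_on unit_square \<Longrightarrow>
    \<bar>(\<integral>z. f z \<partial>\<nu>) - (\<Sum>i\<le>n. \<Sum>j\<le>n. f (real i / n, real j / n) * measure \<nu> (grid_cell n i j))\<bar> \<le> e"
proof -
  have "uniformly_continuous_on unit_square f"
    by (intro compact_uniformly_continuous f compact_Times) auto
  then obtain d where d: "0 < d" "\<And>z z'. z \<in> unit_square \<Longrightarrow> z' \<in> unit_square \<Longrightarrow> dist z' z < d \<Longrightarrow> dist (f z') (f z) < e"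
    using \<open>0 < e\<close> unfolding uniformly_continuous_on_def by metis
  \<comment> \<open>A point and the corner of its cell differ by less than 1/n in each coordinate,
    hence by less than 2/n in distance.\<close>
  obtain n :: nat where n: "2 / d < real n"
    using reals_Archimedean2 by blast
  have "0 < n"
    using n d(1) by (cases n) (auto simp: divide_less_0_iff)
  define \<phi> where "\<phi> z = (real (nat \<lfloor>real n * fst z\<rfloor>) / n, real (nat \<lfloor>real n * snd z\<rfloor>) / n)" for z :: "real \<times> real"
  have coord: "0 \<le> real (nat \<lfloor>real n * x\<rfloor>) / n \<and> real (nat \<lfloor>real n * x\<rfloor>) / n \<le> x \<and> x < real (nat \<lfloor>real n * x\<rfloor>) / n + 1 / n"
    if "0 \<le> x" for x :: real
  proof -
    have "0 \<le> real n * x" using that by simp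
    then have "real (nat \<lfloor>real n * x\<rfloor>) \<le> real n * x" "real n * x < real (nat \<lfloor>real n * x\<rfloor>) + 1"
      by linarith+
    then show ?thesis
      using \<open>0 < n\<close> by (simp add: field_simps)
  qed
  have \<phi>_in: "\<phi> z \<in> unit_square" and \<phi>_dist: "dist (\<phi> z) z < d" if z: "z \<in> unit_square" for z
  proof -
    obtain x y where xy: "z = (x, y)" "0 \<le> x" "x \<le> 1" "0 \<le> y" "y \<le> 1"
      using z by auto
    show "\<phi> z \<in> unit_square"
      using coord[OF xy(2)] coord[OF xy(4)] xy by (auto simp: \<phi>_def)
    have "dist (\<phi> z) z \<le> \<bar>fst (\<phi> z) - x\<bar> + \<bar>snd (\<phi> z) - y\<bar>"
      unfolding xy(1) dist_prod_def dist_real_def by (simp add: sqrt_sum_squares_le_sum_abs)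
    also have "\<dots> < 2 / n"
      using coord[OF xy(2)] coord[OF xy(4)] by (simp add: \<phi>_def xy(1))
    also have "\<dots> < d"
      using n d(1) \<open>0 < n\<close> by (simp add: field_simps)
    finally show "dist (\<phi> z) z < d" .
  qed
  show ?thesis
  proof
    fix \<nu> :: "(real \<times> real) measure" assume "\<nu> \<in> prob_measures_on unit_square"
    then have [measurable_cong]: "sets \<nu> = sets square_borel" and "prob_space \<nu>"
      by (auto simp: prob_measures_on_def)
    interpret prob_space \<nu> by fact
    have sp: "space \<nu> = unit_square"
      using sets_eq_imp_space_eq[OF \<open>sets \<nu> = _\<close>] by simp
    have fm[measurable]: "f \<in> borel_measurable \<nu>"
      using borel_measurable_continuous_on_restrict[OF f] \<open>sets \<nu> = _\<close> by (simp cong: measurable_cong_sets)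
    obtain B where B: "\<And>z. z \<in> unit_square \<Longrightarrow> \<bar>f z\<bar> \<le> B"
      using compact_imp_bounded[OF compact_continuous_image[OF f]] compact_Times[of "{0..1::real}" "{0..1::real}"]
      by (auto simp: bounded_iff)
    have int_f: "integrable \<nu> f"
      using B by (intro integrable_const_bound[where B = B]) (auto simp: sp)
    define s where "s z = (\<Sum>i\<le>n. \<Sum>j\<le>n. f (real i / n, real j / n) * indicator (grid_cell n i j) z)" for z
    have cells: "grid_cell n i j \<in> sets \<nu>" for i j
      using sets_grid_cell \<open>sets \<nu> = _\<close> by simp
    have int_s: "integrable \<nu> s"
      unfolding s_def using cells
      by (intro Bochner_Integration.integrable_sum integrable_mult_right integrable_real_indicator)
        (auto simp: emeasure_eq_measure)
    have s_eq: "s z = f (\<phi> z)" if "z \<in> unit_square" for z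
    proof -
      let ?a = "nat \<lfloor>real n * fst z\<rfloor>" and ?b = "nat \<lfloor>real n * snd z\<rfloor>"
      have "real n * fst z \<le> real n" "real n * snd z \<le> real n"
        using that by (auto intro!: mult_left_le)
      then have ab: "?a \<le> n" "?b \<le> n" by linarith+
      have "s z = (\<Sum>i\<le>n. \<Sum>j\<le>n. if i = ?a then (if j = ?b then f (real i / n, real j / n) else 0) else 0)"
        unfolding s_def using that by (intro sum.cong refl) (auto simp: grid_cell_def)
      also have "\<dots> = (\<Sum>i\<le>n. if i = ?a then (\<Sum>j\<le>n. if j = ?b then f (real i / n, real j / n) else 0) else 0)"
        by (intro sum.cong refl) auto
      also have "\<dots> = f (\<phi> z)"
        using ab by (simp add: \<phi>_def)
      finally show ?thesis .
    qed
    have "(\<integral>z. s z \<partial>\<nu>) = (\<Sum>i\<le>n. \<Sum>j\<le>n. f (real i / n, real j / n) * measure \<nu> (grid_cell n i j))"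
      unfolding s_def using cells
      by (subst Bochner_Integration.integral_sum,
          (intro Bochner_Integration.integrable_sum integrable_mult_right integrable_real_indicator;
            simp add: emeasure_eq_measure))
        (intro sum.cong refl, subst Bochner_Integration.integral_sum,
          auto intro!: integrable_mult_right integrable_real_indicator simp: emeasure_eq_measure)
    moreover have "\<bar>(\<integral>z. f z \<partial>\<nu>) - (\<integral>z. s z \<partial>\<nu>)\<bar> \<le> e"
    proof -
      have "\<bar>(\<integral>z. f z \<partial>\<nu>) - (\<integral>z. s z \<partial>\<nu>)\<bar> = \<bar>\<integral>z. f z - s z \<partial>\<nu>\<bar>"
        by (simp add: int_f int_s)
      also have "\<dots> \<le> (\<integral>z. \<bar>f z - s z\<bar> \<partial>\<nu>)"
        by (rule integral_abs_bound)
      also have "\<dots> \<le> (\<integral>z. e \<partial>\<nu>)"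
      proof (rule integral_mono)
        fix z assume z: "z \<in> space \<nu>"
        then have "dist (f (\<phi> z)) (f z) < e"
          using d(2)[of z "\<phi> z"] \<phi>_in \<phi>_dist by (auto simp: sp)
        then show "\<bar>f z - s z\<bar> \<le> e"
          using z by (auto simp: sp s_eq dist_real_def)
      qed (use int_f int_s in auto)
      finally show ?thesis by (simp add: prob_space)
    qed
    ultimately show "\<bar>(\<integral>z. f z \<partial>\<nu>) - (\<Sum>i\<le>n. \<Sum>j\<le>n. f (real i / n, real j / n) * measure \<nu> (grid_cell n i j))\<bar> \<le> e"
      by simp
  qed
qed

text \<open>
  The cell masses embed the probability measures into a countable product of lines, and every weakly
  open set is the preimage of an open set there. This replaces second countability of the weak topology.
\<close>

definition grid_masses :: "(real \<times> real) measure \<Rightarrow> nat \<times> nat \<times> nat \<Rightarrow> real" where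
  "grid_masses \<nu> = (\<lambda>(n, i, j). measure \<nu> (grid_cell n i j))"

text \<open>The index set is countable, so the product \<sigma>-algebra contains every open set of
  the product topology; arbitrary open sets may then be pulled back.\<close>

lemma measurable_grid_masses: "grid_masses \<in> borel_measurable (prob_algebra square_borel)"
proof -
  have "grid_masses \<in> prob_algebra square_borel \<rightarrow>\<^sub>M (\<Pi>\<^sub>M i\<in>UNIV. borel)"
    unfolding grid_masses_def
    by (intro measurable_PiM_single') (auto intro!: measurable_measure_prob_algebra sets_grid_cell)
  then show ?thesis
    by (simp add: sets_PiM_equal_borel cong: measurable_cong_sets)
qed

lemma weakly_open_eq_vimage:
  assumes "openin (weak_topology unit_square) W"
  shows "\<exists>G. open G \<and> W = grid_masses -` G \<inter> prob_measures_on unit_square"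
proof -
  have "generate_topology_on {{\<nu> \<in> prob_measures_on unit_square. (\<integral>x. f x \<partial>\<nu>) \<in> G} | (f :: real \<times> real \<Rightarrow> real) G.
     continuous_on unit_square f \<and> bounded (f ` unit_square) \<and> open G} W"
    using assms unfolding weak_topology_def openin_topology_generated_by_iff .
  then show ?thesis
  proof induction
    case Empty
    show ?case by (intro exI[of _ "{}"]) auto
  next
    case (Int a b)
    then obtain A B where "open A" "a = grid_masses -` A \<inter> prob_measures_on unit_square"
      "open B" "b = grid_masses -` B \<inter> prob_measures_on unit_square" by blast
    then show ?case by (intro exI[of _ "A \<inter> B"]) auto
  next
    case (UN K)
    then obtain G where G: "\<And>k. k \<in> K \<Longrightarrow> open (G k) \<and> k = grid_masses -` G k \<inter> prob_measures_on unit_square"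
      by metis
    then have "\<Union>K = grid_masses -` (\<Union>k\<in>K. G k) \<inter> prob_measures_on unit_square"
      by (auto; metis IntE vimageE IntI vimageI)
    then show ?case
      using G by (intro exI[of _ "\<Union>k\<in>K. G k"]) blast
  next
    case (Basis s)
    then obtain f :: "real \<times> real \<Rightarrow> real" and G where
      s: "s = {\<nu> \<in> prob_measures_on unit_square. (\<integral>x. f x \<partial>\<nu>) \<in> G}"
      and f: "continuous_on unit_square f" and "open G" by blast
    have nbhd: "\<exists>U. open U \<and> grid_masses \<nu> \<in> U \<and> grid_masses -` U \<inter> prob_measures_on unit_square \<subseteq> s" if \<nu>: "\<nu> \<in> s" for \<nu>
    proof -
      obtain e where e: "0 < e" "ball (\<integral>x. f x \<partial>\<nu>) e \<subseteq> G"
        using \<open>open G\<close> \<nu> unfolding s by (auto simp: open_contains_ball)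
      \<comment> \<open>Three errors of size e/4 occur: the grid approximation at the given measure,
        the one at its neighbour, and the distance between the two grid sums.\<close>
      obtain n where n: "\<And>\<nu>. \<nu> \<in> prob_measures_on unit_square \<Longrightarrow>
          \<bar>(\<integral>z. f z \<partial>\<nu>) - (\<Sum>i\<le>n. \<Sum>j\<le>n. f (real i / n, real j / n) * measure \<nu> (grid_cell n i j))\<bar> \<le> e / 4"
        using integral_grid_approx[OF f, of "e / 4"] e(1) by auto
      define g :: "(nat \<times> nat \<times> nat \<Rightarrow> real) \<Rightarrow> real" where
        "g x = (\<Sum>i\<le>n. \<Sum>j\<le>n. f (real i / n, real j / n) * x (n, i, j))" for x
      have "continuous_on UNIV g"
        unfolding g_def by (intro continuous_intros continuous_on_product_coordinates)
      then have "open (g -` ball (g (grid_masses \<nu>)) (e / 4))"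
        by (intro open_vimage) auto
      moreover have "\<nu>' \<in> s" if "g (grid_masses \<nu>') \<in> ball (g (grid_masses \<nu>)) (e / 4)" "\<nu>' \<in> prob_measures_on unit_square" for \<nu>'
      proof -
        have "\<bar>(\<integral>z. f z \<partial>\<nu>') - g (grid_masses \<nu>')\<bar> \<le> e / 4" "\<bar>(\<integral>z. f z \<partial>\<nu>) - g (grid_masses \<nu>)\<bar> \<le> e / 4"
          using n[OF that(2)] n[of \<nu>] \<nu> by (auto simp: g_def grid_masses_def s)
        moreover have "\<bar>g (grid_masses \<nu>) - g (grid_masses \<nu>')\<bar> < e / 4"
          using that(1) by (simp add: dist_real_def)
        ultimately have "(\<integral>z. f z \<partial>\<nu>') \<in> ball (\<integral>z. f z \<partial>\<nu>) e"
          unfolding mem_ball dist_real_def by linarith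
        with e(2) that(2) show ?thesis by (auto simp: s)
      qed
      ultimately show ?thesis
        using e(1) by (intro exI[of _ "g -` ball (g (grid_masses \<nu>)) (e / 4)"]) auto
    qed
    \<comment> \<open>The union of all admissible open sets avoids choosing a neighbourhood for each
      measure, and it is open however many sets it joins.\<close>
    let ?G = "\<Union>{U. open U \<and> grid_masses -` U \<inter> prob_measures_on unit_square \<subseteq> s}"
    have "s = grid_masses -` ?G \<inter> prob_measures_on unit_square"
    proof
      show "s \<subseteq> grid_masses -` ?G \<inter> prob_measures_on unit_square"
      proof
        fix \<nu> assume "\<nu> \<in> s"
        with nbhd[OF this] show "\<nu> \<in> grid_masses -` ?G \<inter> prob_measures_on unit_square"
          unfolding s by blast
      qed
      show "grid_masses -` ?G \<inter> prob_measures_on unit_square \<subseteq> s" by blast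
    qed
    then show ?case by (intro exI[of _ ?G]) auto
  qed
qed

text \<open>This links the topological description of the space of couplings to the \<sigma>-algebra
  used for kernels. Weakly open sets are preimages of open sets under the measurable map
  \<open>grid_masses\<close>; conversely corner masses are limits of integrals of continuous
  functions, and the corners generate.\<close>

lemma sets_weak_borel_eq: "sets (weak_borel unit_square) = sets (prob_algebra square_borel)"
proof
  have "W \<in> sets (prob_algebra square_borel)" if W: "openin (weak_topology unit_square) W" for W
  proof -
    obtain G where G: "open G" "W = grid_masses -` G \<inter> prob_measures_on unit_square"
      using weakly_open_eq_vimage[OF W] by blast
    then show ?thesis
      using measurable_sets[OF measurable_grid_masses, of G] by (simp add: space_prob_algebra_square)
  qed
  then show "sets (weak_borel unit_square) \<subseteq> sets (prob_algebra square_borel)"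
    unfolding sets_weak_borel space_prob_algebra_square[symmetric] by (intro sets.sigma_sets_subset) auto
  have "(\<lambda>\<nu>. \<nu>) \<in> weak_borel unit_square \<rightarrow>\<^sub>M prob_algebra square_borel"
  proof (rule measurable_prob_algebra_generated[OF sets_square_corners Int_stable_corners])
    show "range (\<lambda>(p, q). corner p q) \<subseteq> Pow unit_square"
      by (auto simp: corner_def)
    fix \<nu> assume "\<nu> \<in> space (weak_borel unit_square)"
    then show "prob_space \<nu>" "sets \<nu> = sets square_borel"
      by (auto simp: space_weak_borel prob_measures_on_def)
  next
    fix A assume "A \<in> range (\<lambda>(p, q). corner p q)"
    then obtain p q where A: "A = corner p q" by auto
    have "(\<lambda>\<nu>. ennreal (measure \<nu> A)) \<in> borel_measurable (weak_borel unit_square)"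
      unfolding A using measure_corner_measurable_weak_borel by measurable
    then show "(\<lambda>\<nu>. emeasure \<nu> A) \<in> borel_measurable (weak_borel unit_square)"
      by (rule measurable_cong[THEN iffD1, rotated])
        (auto simp: space_weak_borel prob_measures_on_def finite_measure.emeasure_eq_measure prob_space.finite_measure)
  qed
  then show "sets (prob_algebra square_borel) \<subseteq> sets (weak_borel unit_square)"
  proof (intro subsetI)
    fix A assume id: "(\<lambda>\<nu>. \<nu>) \<in> weak_borel unit_square \<rightarrow>\<^sub>M prob_algebra square_borel"
      and A: "A \<in> sets (prob_algebra square_borel)"
    from measurable_sets[OF this] show "A \<in> sets (weak_borel unit_square)"
      using sets.sets_into_space[OF A]
      by (simp add: space_weak_borel space_prob_algebra_square Int_absorb2)
  qed
qed

lemma uniform_couplings_subset: "uniform_couplings \<subseteq> prob_measures_on unit_square"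
  by (auto simp: uniform_couplings_def)

lemma space_coupling_space [simp]: "space coupling_space = uniform_couplings"
  using uniform_couplings_subset by (auto simp: coupling_space_def space_restrict_space space_weak_borel)

lemma sets_coupling_space: "sets coupling_space = sets (restrict_space (prob_algebra square_borel) uniform_couplings)"
  unfolding coupling_space_def by (intro restrict_space_sets_cong refl sets_weak_borel_eq)

lemma measurable_into_coupling_space:
  assumes "f \<in> M \<rightarrow>\<^sub>M prob_algebra square_borel" "f \<in> space M \<rightarrow> uniform_couplings"
  shows "f \<in> M \<rightarrow>\<^sub>M coupling_space"
  using measurable_restrict_space2[OF assms(2,1)] by (simp add: sets_coupling_space cong: measurable_cong_sets)

lemma measurable_copula_of [measurable]: "(\<lambda>\<nu>. copula_of \<nu> p q) \<in> borel_measurable coupling_space"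
proof -
  have "(\<lambda>\<nu>. copula_of \<nu> p q) \<in> borel_measurable (restrict_space (prob_algebra square_borel) uniform_couplings)"
    unfolding copula_of_def by (intro measurable_restrict_space1 measurable_measure_prob_algebra sets_corner)
  then show ?thesis
    by (simp add: sets_coupling_space cong: measurable_cong_sets)
qed

section \<open>Joint laws of orderings and their disintegrations\<close>

lemma measurable_PiM_UNIV:
  assumes "\<And>k. (\<lambda>x. X x k) \<in> M \<rightarrow>\<^sub>M N"
  shows "X \<in> M \<rightarrow>\<^sub>M (\<Pi>\<^sub>M k\<in>UNIV. N)"
  using assms by (intro measurable_PiM_single') (auto dest: measurable_space)

lemma distr_PiM_map:
  assumes M: "prob_space M" and f: "f \<in> M \<rightarrow>\<^sub>M N"
  shows "distr (\<Pi>\<^sub>M k\<in>UNIV. M) (\<Pi>\<^sub>M k\<in>UNIV. N) (\<lambda>x k. f (x k)) = (\<Pi>\<^sub>M k\<in>(UNIV :: 'i set). distr M N f)"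
proof -
  interpret M: prob_space M by fact
  have prob: "prob_space (distr M N f)"
    by (rule M.prob_space_distr[OF f])
  interpret N: product_prob_space "\<lambda>_ :: 'i. distr M N f" UNIV
    using prob by (simp add: product_prob_space_def product_prob_space_axioms_def product_sigma_finite_def
        prob_space_imp_sigma_finite)
  have meas: "(\<lambda>x k. f (x k)) \<in> (\<Pi>\<^sub>M k\<in>(UNIV :: 'i set). M) \<rightarrow>\<^sub>M (\<Pi>\<^sub>M k\<in>UNIV. N)"
    by (intro measurable_PiM_UNIV measurable_compose[OF _ f]) measurable
  show ?thesis
  proof (rule N.PiM_eq)
    fix J :: "'i set" and F :: "'i \<Rightarrow> 'b set"
    assume J: "finite J" and F: "\<And>j. j \<in> J \<Longrightarrow> F j \<in> sets (distr M N f)"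
    have emb: "prod_emb UNIV (\<lambda>_. distr M N f) J (Pi\<^sub>E J F) \<in> sets (\<Pi>\<^sub>M k\<in>(UNIV :: 'i set). N)"
    proof -
      have "prod_emb UNIV (\<lambda>_. distr M N f) J (Pi\<^sub>E J F) = prod_emb UNIV (\<lambda>_. N) J (Pi\<^sub>E J F)"
        by (simp add: prod_emb_def)
      then show ?thesis
        using J F by (auto intro!: sets_PiM_I)
    qed
    have "emeasure (distr (\<Pi>\<^sub>M k\<in>(UNIV :: 'i set). M) (\<Pi>\<^sub>M k\<in>UNIV. N) (\<lambda>x k. f (x k)))
        (prod_emb UNIV (\<lambda>_. distr M N f) J (Pi\<^sub>E J F))
      = emeasure (\<Pi>\<^sub>M k\<in>(UNIV :: 'i set). M) (prod_emb UNIV (\<lambda>_. M) J (\<Pi>\<^sub>E j\<in>J. f -` F j \<inter> space M))"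
    proof (subst emeasure_distr[OF meas emb], rule arg_cong[where f = "emeasure _"])
      show "(\<lambda>x k. f (x k)) -` prod_emb UNIV (\<lambda>_. distr M N f) J (Pi\<^sub>E J F) \<inter> space (\<Pi>\<^sub>M k\<in>(UNIV :: 'i set). M)
          = prod_emb UNIV (\<lambda>_. M) J (\<Pi>\<^sub>E j\<in>J. f -` F j \<inter> space M)"
        using measurable_space[OF f] by (auto simp: prod_emb_def space_PiM PiE_iff)
    qed
    also have "\<dots> = (\<Prod>j\<in>J. emeasure M (f -` F j \<inter> space M))"
      using J F f by (intro emeasure_PiM_emb M) (auto intro: measurable_sets)
    also have "\<dots> = (\<Prod>j\<in>J. emeasure (distr M N f) (F j))"
      using F f by (intro prod.cong refl) (simp add: emeasure_distr)
    finally show "emeasure (distr (\<Pi>\<^sub>M k\<in>(UNIV :: 'i set). M) (\<Pi>\<^sub>M k\<in>UNIV. N) (\<lambda>x k. f (x k)))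
        (prod_emb UNIV (\<lambda>_. distr M N f) J (Pi\<^sub>E J F)) = (\<Prod>j\<in>J. emeasure (distr M N f) (F j))" .
  qed (auto intro!: sets_PiM_cong)
qed

lemma indep_vars_uniform_sequence: "uniform_seq.P.indep_vars (\<lambda>_. uniform01) (\<lambda>k u. u k) UNIV"
proof (subst uniform_seq.P.indep_vars_iff_distr_eq_PiM)
  have "distr uniform_sequence uniform01 (\<lambda>u. u k) = uniform01" for k
    using distr_PiM_component[of UNIV "\<lambda>_. uniform01" k] prob_space_uniform01 by simp
  then show "distr uniform_sequence (\<Pi>\<^sub>M i\<in>UNIV. uniform01) (\<lambda>x. restrict x UNIV)
      = (\<Pi>\<^sub>M i\<in>UNIV. distr uniform_sequence uniform01 (\<lambda>u. u i))"
    by (simp add: restrict_def distr_id)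
qed auto

text \<open>On cylinders, Fubini first fixes \<open>u\<close>: the sections factor over the
  coordinates of \<open>w\<close>, and then independence of the coordinates of \<open>u\<close>
  factors the outer integral. This later splits a sequence of pairs into first coordinates and
  independent noise.\<close>

lemma distr_pair_uniform_sequence:
  "distr (uniform_sequence \<Otimes>\<^sub>M uniform_sequence) (\<Pi>\<^sub>M k\<in>UNIV. uniform01 \<Otimes>\<^sub>M uniform01) (\<lambda>(u, w) k. (u k, w k))
     = (\<Pi>\<^sub>M k\<in>UNIV. uniform01 \<Otimes>\<^sub>M uniform01)"
proof -
  let ?UU = "uniform01 \<Otimes>\<^sub>M uniform01"
  interpret UU: prob_space ?UU
    by (intro prob_space_pair prob_space_uniform01)
  interpret PUU: product_prob_space "\<lambda>_ :: nat. ?UU" UNIV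
    by standard
  have meas: "(\<lambda>(u, w) k. (u k, w k)) \<in> uniform_sequence \<Otimes>\<^sub>M uniform_sequence \<rightarrow>\<^sub>M (\<Pi>\<^sub>M k\<in>UNIV. ?UU)"
    unfolding case_prod_unfold by (intro measurable_PiM_single') (auto simp: space_pair_measure)
  show ?thesis
  proof (rule PUU.PiM_eq)
    fix J :: "nat set" and F :: "nat \<Rightarrow> (real \<times> real) set"
    assume J: "finite J" and F: "\<And>j. j \<in> J \<Longrightarrow> F j \<in> sets ?UU"
    let ?E = "prod_emb UNIV (\<lambda>_. ?UU) J (Pi\<^sub>E J F)"
    let ?A = "{(u, w). \<forall>j\<in>J. (u j, w j) \<in> F j}"
    have E: "?E \<in> sets (\<Pi>\<^sub>M k\<in>UNIV. ?UU)"
      using J F by (intro sets_PiM_I) auto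
    have pre: "(\<lambda>(u, w) k. (u k, w k)) -` ?E \<inter> space (uniform_sequence \<Otimes>\<^sub>M uniform_sequence) = ?A"
      by (auto simp: prod_emb_def space_pair_measure PiE_iff)
    have A: "?A \<in> sets (uniform_sequence \<Otimes>\<^sub>M uniform_sequence)"
      using measurable_sets[OF meas E] unfolding pre .
    have sec: "Pair x -` F j \<in> sets uniform01" if "j \<in> J" for x j
      using F[OF that] by (rule sets_Pair1)
    have "emeasure (distr (uniform_sequence \<Otimes>\<^sub>M uniform_sequence) (\<Pi>\<^sub>M k\<in>UNIV. ?UU) (\<lambda>(u, w) k. (u k, w k))) ?E
        = emeasure (uniform_sequence \<Otimes>\<^sub>M uniform_sequence) ?A"
      by (simp add: emeasure_distr[OF meas E] pre)
    also have "\<dots> = (\<integral>\<^sup>+u. emeasure uniform_sequence (Pair u -` ?A) \<partial>uniform_sequence)"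
      by (rule uniform_seq.P.emeasure_pair_measure_alt[OF A])
    also have "\<dots> = (\<integral>\<^sup>+u. (\<Prod>j\<in>J. emeasure uniform01 (Pair (u j) -` F j)) \<partial>uniform_sequence)"
    proof (intro nn_integral_cong)
      fix u :: "nat \<Rightarrow> real"
      have "Pair u -` ?A = {w \<in> space uniform_sequence. \<forall>j\<in>J. w j \<in> Pair (u j) -` F j}"
        by auto
      then show "emeasure uniform_sequence (Pair u -` ?A) = (\<Prod>j\<in>J. emeasure uniform01 (Pair (u j) -` F j))"
        using J sec by (simp only:) (intro uniform_seq.emeasure_PiM_Collect, auto)
    qed
    also have "\<dots> = (\<Prod>j\<in>J. \<integral>\<^sup>+u. emeasure uniform01 (Pair (u j) -` F j) \<partial>uniform_sequence)"
    proof (intro uniform_seq.P.indep_vars_nn_integral J)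
      show "uniform_seq.P.indep_vars (\<lambda>_. borel) (\<lambda>j u. emeasure uniform01 (Pair (u j) -` F j)) J"
        using uniform_seq.P.indep_vars_compose2[OF uniform_seq.P.indep_vars_subset[OF indep_vars_uniform_sequence, of J],
            of "\<lambda>j x. emeasure uniform01 (Pair x -` F j)" "\<lambda>_. borel"] F
        by (auto intro: uniform01.measurable_emeasure_Pair)
    qed auto
    also have "\<dots> = (\<Prod>j\<in>J. emeasure ?UU (F j))"
    proof (intro prod.cong refl)
      fix j assume j: "j \<in> J"
      have comp: "distr uniform_sequence uniform01 (\<lambda>u. u j) = uniform01"
        using distr_PiM_component[of UNIV "\<lambda>_. uniform01" j] prob_space_uniform01 by simp
      have "emeasure ?UU (F j) = (\<integral>\<^sup>+x. emeasure uniform01 (Pair x -` F j) \<partial>distr uniform_sequence uniform01 (\<lambda>u. u j))"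
        unfolding comp by (rule uniform01.emeasure_pair_measure_alt[OF F[OF j]])
      also have "\<dots> = (\<integral>\<^sup>+u. emeasure uniform01 (Pair (u j) -` F j) \<partial>uniform_sequence)"
        using F[OF j] by (intro nn_integral_distr uniform01.measurable_emeasure_Pair) auto
      finally show "(\<integral>\<^sup>+u. emeasure uniform01 (Pair (u j) -` F j) \<partial>uniform_sequence) = emeasure ?UU (F j)" ..
    qed
    finally show "emeasure (distr (uniform_sequence \<Otimes>\<^sub>M uniform_sequence) (\<Pi>\<^sub>M k\<in>UNIV. ?UU) (\<lambda>(u, w) k. (u k, w k))) ?E
        = (\<Prod>j\<in>J. emeasure ?UU (F j))" .
  qed simp
qed

section \<open>The joint law of the two orderings\<close>

abbreviation ordering_pairs :: "(nat rel \<times> nat rel) measure" where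
  "ordering_pairs \<equiv> ordering_space \<Otimes>\<^sub>M ordering_space"

abbreviation relabel_pair :: "(nat \<Rightarrow> nat) \<Rightarrow> nat rel \<times> nat rel \<Rightarrow> nat rel \<times> nat rel" where
  "relabel_pair r \<equiv> map_prod (relabel r) (relabel r)"

definition orderings_of_pairs :: "(nat \<Rightarrow> real \<times> real) \<Rightarrow> nat rel \<times> nat rel" where
  "orderings_of_pairs z = (ordering_of (\<lambda>k. fst (z k)), ordering_of (\<lambda>k. snd (z k)))"

definition pair_law :: "(real \<times> real) measure \<Rightarrow> (nat rel \<times> nat rel) measure" where
  "pair_law \<nu> = distr (\<Pi>\<^sub>M k\<in>UNIV. \<nu>) ordering_pairs orderings_of_pairs"

lemma measurable_orderings_of_pairs [measurable]:
  "orderings_of_pairs \<in> (\<Pi>\<^sub>M k\<in>UNIV. square_borel) \<rightarrow>\<^sub>M ordering_pairs"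
proof -
  have "(\<lambda>z. fst (z k)) \<in> borel_measurable (\<Pi>\<^sub>M k\<in>UNIV. square_borel)"
    "(\<lambda>z. snd (z k)) \<in> borel_measurable (\<Pi>\<^sub>M k\<in>UNIV. square_borel)" for k :: nat
    by (auto intro: measurable_compose[OF measurable_component_singleton])
  then show ?thesis
    unfolding orderings_of_pairs_def[abs_def] by (intro measurable_Pair measurable_ordering_of_component)
qed

lemma sets_PiM_square:
  "sets \<nu> = sets square_borel \<Longrightarrow> sets (\<Pi>\<^sub>M k\<in>UNIV. \<nu>) = sets (\<Pi>\<^sub>M k\<in>UNIV. square_borel)"
  by (intro sets_PiM_cong) auto

context
  fixes \<nu> :: "(real \<times> real) measure"
  assumes \<nu>: "\<nu> \<in> uniform_couplings"
begin

interpretation prob_space \<nu>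
  using \<nu> by (rule uniform_couplingsD)

interpretation Pi: prob_space "\<Pi>\<^sub>M k\<in>(UNIV :: nat set). \<nu>"
  by (intro prob_space_PiM prob_space_axioms)

lemma measurable_orderings_of_pairs_coupling [measurable]:
  "orderings_of_pairs \<in> (\<Pi>\<^sub>M k\<in>UNIV. \<nu>) \<rightarrow>\<^sub>M ordering_pairs"
  using measurable_orderings_of_pairs
  unfolding measurable_cong_sets[OF sets_PiM_square[OF uniform_couplingsD(2)[OF \<nu>]] refl] .

lemma prob_space_pair_law: "prob_space (pair_law \<nu>)"
  unfolding pair_law_def by (intro Pi.prob_space_distr measurable_orderings_of_pairs_coupling)

lemma measurable_fst_coupling: "fst \<in> borel_measurable \<nu>"
  and measurable_snd_coupling: "snd \<in> borel_measurable \<nu>"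
  using uniform_couplingsD(2)[OF \<nu>] measurable_fst_square measurable_snd_square
  by (simp_all cong: measurable_cong_sets)

lemma distr_fst_sequence: "distr (\<Pi>\<^sub>M k\<in>UNIV. \<nu>) (\<Pi>\<^sub>M k\<in>UNIV. borel) (\<lambda>z k. fst (z k)) = uniform_sequence"
  and distr_snd_sequence: "distr (\<Pi>\<^sub>M k\<in>UNIV. \<nu>) (\<Pi>\<^sub>M k\<in>UNIV. borel) (\<lambda>z k. snd (z k)) = uniform_sequence"
  using distr_PiM_map[OF prob_space_axioms measurable_fst_coupling, where 'i = nat]
    distr_PiM_map[OF prob_space_axioms measurable_snd_coupling, where 'i = nat] uniform_couplingsD(4,5)[OF \<nu>]
  by simp_all

lemma AE_typical_pairs:
  "AE z in \<Pi>\<^sub>M k\<in>UNIV. \<nu>. typical (\<lambda>k. fst (z k)) \<and> typical (\<lambda>k. snd (z k))"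
proof -
  have meas: "(\<lambda>z k. fst (z k)) \<in> (\<Pi>\<^sub>M k\<in>(UNIV :: nat set). \<nu>) \<rightarrow>\<^sub>M (\<Pi>\<^sub>M k\<in>UNIV. borel)"
    "(\<lambda>z k. snd (z k)) \<in> (\<Pi>\<^sub>M k\<in>(UNIV :: nat set). \<nu>) \<rightarrow>\<^sub>M (\<Pi>\<^sub>M k\<in>UNIV. borel)"
    by (auto intro!: measurable_PiM_single' measurable_compose[OF measurable_component_singleton]
        measurable_fst_coupling measurable_snd_coupling)
  have "AE z in \<Pi>\<^sub>M k\<in>UNIV. \<nu>. typical (\<lambda>k. fst (z k))"
    by (rule AE_distrD[OF meas(1)]) (unfold distr_fst_sequence, rule AE_typical)
  moreover have "AE z in \<Pi>\<^sub>M k\<in>UNIV. \<nu>. typical (\<lambda>k. snd (z k))"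
    by (rule AE_distrD[OF meas(2)]) (unfold distr_snd_sequence, rule AE_typical)
  ultimately show ?thesis by eventually_elim simp
qed

lemma distr_fst_pair_law: "distr (pair_law \<nu>) ordering_space fst = uniform_ordering"
proof -
  have meas: "(\<lambda>z k. fst (z k)) \<in> (\<Pi>\<^sub>M k\<in>(UNIV :: nat set). \<nu>) \<rightarrow>\<^sub>M (\<Pi>\<^sub>M k\<in>UNIV. borel)"
    by (auto intro!: measurable_PiM_single' measurable_compose[OF measurable_component_singleton]
        measurable_fst_coupling)
  have "distr (pair_law \<nu>) ordering_space fst
      = distr (\<Pi>\<^sub>M k\<in>UNIV. \<nu>) ordering_space (\<lambda>z. ordering_of (\<lambda>k. fst (z k)))"
    unfolding pair_law_def by (subst distr_distr) (auto simp: comp_def orderings_of_pairs_def)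
  also have "\<dots> = distr (distr (\<Pi>\<^sub>M k\<in>UNIV. \<nu>) (\<Pi>\<^sub>M k\<in>UNIV. borel) (\<lambda>z k. fst (z k))) ordering_space ordering_of"
    using meas by (subst distr_distr) (auto simp: comp_def)
  finally show ?thesis
    by (simp add: distr_fst_sequence uniform_ordering_def)
qed

lemma distr_pair_law_relabel:
  assumes r: "bij r"
  shows "distr (pair_law \<nu>) ordering_pairs (relabel_pair r) = pair_law \<nu>"
proof -
  note [measurable] = measurable_relabel[OF bij_is_inj[OF r]]
  have [measurable]: "relabel_pair r \<in> ordering_pairs \<rightarrow>\<^sub>M ordering_pairs"
    unfolding map_prod_def by measurable
  have perm: "(\<lambda>z k. z (r k)) \<in> (\<Pi>\<^sub>M k\<in>UNIV. \<nu>) \<rightarrow>\<^sub>M (\<Pi>\<^sub>M k\<in>UNIV. \<nu>)"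
    by (intro measurable_PiM_single') (auto simp: space_PiM)
  have "distr (pair_law \<nu>) ordering_pairs (relabel_pair r)
      = distr (\<Pi>\<^sub>M k\<in>UNIV. \<nu>) ordering_pairs (\<lambda>z. relabel_pair r (orderings_of_pairs z))"
    unfolding pair_law_def by (subst distr_distr) (auto simp: comp_def)
  also have "\<dots> = distr (\<Pi>\<^sub>M k\<in>UNIV. \<nu>) ordering_pairs (\<lambda>z. orderings_of_pairs (\<lambda>k. z (r k)))"
  proof (intro distr_cong_AE refl)
    \<comment> \<open>Injectivity is essential here: for a tied sequence \<open>ordering_of\<close>
      returns the usual ordering, which does not follow the relabelling.\<close>
    show "AE z in \<Pi>\<^sub>M k\<in>UNIV. \<nu>. relabel_pair r (orderings_of_pairs z) = orderings_of_pairs (\<lambda>k. z (r k))"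
      using AE_typical_pairs
      by eventually_elim (auto simp: typical_def orderings_of_pairs_def relabel_ordering_of bij_is_inj[OF r])
    show "(\<lambda>z. orderings_of_pairs (\<lambda>k. z (r k))) \<in> (\<Pi>\<^sub>M k\<in>UNIV. \<nu>) \<rightarrow>\<^sub>M ordering_pairs"
      by (rule measurable_compose[OF perm measurable_orderings_of_pairs_coupling])
  qed measurable
  also have "\<dots> = distr (distr (\<Pi>\<^sub>M k\<in>UNIV. \<nu>) (\<Pi>\<^sub>M k\<in>UNIV. \<nu>) (\<lambda>z k. z (r k))) ordering_pairs orderings_of_pairs"
    using perm by (subst distr_distr) (auto simp: comp_def)
  also have "distr (\<Pi>\<^sub>M k\<in>UNIV. \<nu>) (\<Pi>\<^sub>M k\<in>UNIV. \<nu>) (\<lambda>z k. z (r k)) = (\<Pi>\<^sub>M k\<in>UNIV. \<nu>)"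
    using distr_PiM_reindex[of UNIV "\<lambda>_. \<nu>" r UNIV] prob_space_axioms bij_is_inj[OF r]
    by (simp add: restrict_def)
  finally show ?thesis
    by (simp add: pair_law_def)
qed

end

text \<open>The two orderings are functions of the sequence of pairs, and independence identifies
  the law of that sequence as the infinite product of \<nu>, whatever the space
  \<open>M\<close>.\<close>

lemma distr_iid_pairs:
  assumes iid: "iid_pairs M U V \<nu>"
  shows "distr M ordering_pairs (\<lambda>\<omega>. (ordering_of (\<lambda>k. U k \<omega>), ordering_of (\<lambda>k. V k \<omega>))) = pair_law \<nu>"
    and "(\<lambda>\<omega>. ordering_of (\<lambda>k. U k \<omega>)) \<in> M \<rightarrow>\<^sub>M ordering_space"
    and "(\<lambda>\<omega>. ordering_of (\<lambda>k. V k \<omega>)) \<in> M \<rightarrow>\<^sub>M ordering_space"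
proof -
  interpret prob_space M
    using iid by (simp add: iid_pairs_def)
  have indep: "indep_vars (\<lambda>_. square_borel) (\<lambda>k \<omega>. (U k \<omega>, V k \<omega>)) UNIV"
    and law: "\<And>k. distr M square_borel (\<lambda>\<omega>. (U k \<omega>, V k \<omega>)) = \<nu>"
    using iid by (auto simp: iid_pairs_def)
  then have rv: "(\<lambda>\<omega>. (U k \<omega>, V k \<omega>)) \<in> M \<rightarrow>\<^sub>M square_borel" for k
    by (auto simp: indep_vars_def)
  then have seq: "(\<lambda>\<omega> k. (U k \<omega>, V k \<omega>)) \<in> M \<rightarrow>\<^sub>M (\<Pi>\<^sub>M k\<in>UNIV. square_borel)"
    by (rule measurable_PiM_UNIV)
  have "distr M (\<Pi>\<^sub>M k\<in>UNIV. square_borel) (\<lambda>\<omega> k. (U k \<omega>, V k \<omega>)) = (\<Pi>\<^sub>M k\<in>UNIV. \<nu>)"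
    using indep indep_vars_iff_distr_eq_PiM[where I = UNIV and M' = "\<lambda>_. square_borel" and X = "\<lambda>k \<omega>. (U k \<omega>, V k \<omega>)", OF _ rv]
    by (simp add: law restrict_def)
  then have "pair_law \<nu> = distr (distr M (\<Pi>\<^sub>M k\<in>UNIV. square_borel) (\<lambda>\<omega> k. (U k \<omega>, V k \<omega>)))
      ordering_pairs orderings_of_pairs"
    by (simp add: pair_law_def)
  also have "\<dots> = distr M ordering_pairs (\<lambda>\<omega>. (ordering_of (\<lambda>k. U k \<omega>), ordering_of (\<lambda>k. V k \<omega>)))"
    by (subst distr_distr[OF measurable_orderings_of_pairs seq]) (simp add: comp_def orderings_of_pairs_def)
  finally show "distr M ordering_pairs (\<lambda>\<omega>. (ordering_of (\<lambda>k. U k \<omega>), ordering_of (\<lambda>k. V k \<omega>))) = pair_law \<nu>" ..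
  show "(\<lambda>\<omega>. ordering_of (\<lambda>k. U k \<omega>)) \<in> M \<rightarrow>\<^sub>M ordering_space"
    using measurable_compose[OF rv measurable_fst_square] by (intro measurable_ordering_of_component) simp
  show "(\<lambda>\<omega>. ordering_of (\<lambda>k. V k \<omega>)) \<in> M \<rightarrow>\<^sub>M ordering_space"
    using measurable_compose[OF rv measurable_snd_square] by (intro measurable_ordering_of_component) simp
qed

text \<open>The integrated form of \<open>regular_cond_prob\<close>: it involves the joint law alone
  and no longer the probability space carrying the variables, with the first marginal taken to be
  \<lambda>.\<close>

definition disintegrates :: "(nat rel \<times> nat rel) measure \<Rightarrow> (nat rel \<Rightarrow> nat rel measure) \<Rightarrow> bool" where
  "disintegrates Q \<kappa> \<longleftrightarrow> ordering_kernel \<kappa> \<and>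
     (\<forall>A\<in>sets ordering_space. \<forall>B\<in>sets ordering_space.
        measure Q (A \<times> B) = (\<integral>R. indicator A R * measure (\<kappa> R) B \<partial>uniform_ordering))"

lemma ordering_kernelD:
  assumes "ordering_kernel \<kappa>"
  shows "R \<in> orderings \<Longrightarrow> prob_space (\<kappa> R)" "R \<in> orderings \<Longrightarrow> sets (\<kappa> R) = sets ordering_space"
  using measurable_space[OF assms] by (auto simp: space_prob_algebra)

lemma measurable_kernel_measure:
  assumes "ordering_kernel \<kappa>" "B \<in> sets ordering_space"
  shows "(\<lambda>R. measure (\<kappa> R) B) \<in> borel_measurable ordering_space"
  by (rule measurable_compose[OF assms(1) measurable_measure_prob_algebra[OF assms(2)]])

lemma integrable_kernel_measure:
  assumes "ordering_kernel \<kappa>" "B \<in> sets ordering_space" "A \<in> sets ordering_space"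
  shows "integrable uniform_ordering (\<lambda>R. indicator A R * measure (\<kappa> R) B)"
proof (rule uniform_ordering.integrable_const_bound[where B = 1])
  note [measurable] = measurable_kernel_measure[OF assms(1,2)] assms(3)
  show "(\<lambda>R. indicator A R * measure (\<kappa> R) B) \<in> borel_measurable uniform_ordering"
    by measurable
  show "AE R in uniform_ordering. norm (indicator A R * measure (\<kappa> R) B) \<le> 1"
    using ordering_kernelD(1)[OF assms(1)] by (auto simp: indicator_def prob_space.prob_le_1)
qed

text \<open>The events of the \<sigma>-algebra generated by \<open>X\<close> are exactly the
  preimages of events under \<open>X\<close>, so the characterization of conditional expectation by
  integrals over them is the disintegration identity.\<close>

lemma regular_cond_prob_iff_disintegrates:
  assumes M: "prob_space M" and X[measurable]: "X \<in> M \<rightarrow>\<^sub>M ordering_space" and Y[measurable]: "Y \<in> M \<rightarrow>\<^sub>M ordering_space"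
    and law: "distr M ordering_space X = uniform_ordering"
  shows "regular_cond_prob M ordering_space X ordering_space Y \<kappa>
     \<longleftrightarrow> disintegrates (distr M ordering_pairs (\<lambda>\<omega>. (X \<omega>, Y \<omega>))) \<kappa>"
proof -
  interpret prob_space M by fact
  let ?F = "vimage_algebra (space M) X ordering_space"
  have XS: "X \<in> space M \<rightarrow> space ordering_space"
    using measurable_space[OF X] by auto
  have "subalgebra M ?F"
    using sets_image_in_sets[OF refl X] by (simp add: subalgebra_def)
  then interpret finite_measure_subalgebra M ?F
    by unfold_locales
  have ind: "integrable M (indicator (Y -` B \<inter> space M) :: _ \<Rightarrow> real)" if "B \<in> sets ordering_space" for B
    using measurable_sets[OF Y that] by (intro integrable_real_indicator) (auto simp: emeasure_eq_measure)
  have left: "measure (distr M ordering_pairs (\<lambda>\<omega>. (X \<omega>, Y \<omega>))) (A \<times> B)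
      = (\<integral>\<omega>\<in>X -` A \<inter> space M. indicator (Y -` B \<inter> space M) \<omega> \<partial>M)"
    if [measurable]: "A \<in> sets ordering_space" "B \<in> sets ordering_space" for A B
  proof -
    have "measure (distr M ordering_pairs (\<lambda>\<omega>. (X \<omega>, Y \<omega>))) (A \<times> B)
        = measure M ((X -` A \<inter> space M) \<inter> (Y -` B \<inter> space M))"
      by (subst measure_distr) (auto intro!: arg_cong[where f = prob])
    also have "\<dots> = (\<integral>\<omega>. indicator ((X -` A \<inter> space M) \<inter> (Y -` B \<inter> space M)) \<omega> \<partial>M)"
      by (simp add: Int_absorb2 le_infI1)
    finally show ?thesis
      by (simp add: set_lebesgue_integral_def indicator_inter_arith)
  qed
  have right: "(\<integral>\<omega>\<in>X -` A \<inter> space M. measure (\<kappa> (X \<omega>)) B \<partial>M) = (\<integral>R. indicator A R * measure (\<kappa> R) B \<partial>uniform_ordering)"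
    if [measurable]: "A \<in> sets ordering_space" "B \<in> sets ordering_space" and \<kappa>: "ordering_kernel \<kappa>" for A B
  proof -
    note [measurable] = measurable_kernel_measure[OF \<kappa>]
    have "(\<integral>R. indicator A R * measure (\<kappa> R) B \<partial>uniform_ordering) = (\<integral>\<omega>. indicator A (X \<omega>) * measure (\<kappa> (X \<omega>)) B \<partial>M)"
      unfolding law[symmetric] by (rule integral_distr) measurable
    also have "\<dots> = (\<integral>\<omega>\<in>X -` A \<inter> space M. measure (\<kappa> (X \<omega>)) B \<partial>M)"
      unfolding set_lebesgue_integral_def
      by (intro Bochner_Integration.integral_cong) (auto simp: indicator_def)
    finally show ?thesis ..
  qed
  show ?thesis
  proof
    assume rcp: "regular_cond_prob M ordering_space X ordering_space Y \<kappa>"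
    then have \<kappa>: "ordering_kernel \<kappa>"
      by (simp add: regular_cond_prob_def)
    show "disintegrates (distr M ordering_pairs (\<lambda>\<omega>. (X \<omega>, Y \<omega>))) \<kappa>"
      unfolding disintegrates_def
    proof (intro conjI ballI \<kappa>)
      fix A B assume A[measurable]: "A \<in> sets ordering_space" and B[measurable]: "B \<in> sets ordering_space"
      let ?f = "indicator (Y -` B \<inter> space M) :: _ \<Rightarrow> real"
      note [measurable] = measurable_kernel_measure[OF \<kappa> B]
      have AE: "AE \<omega> in M. measure (\<kappa> (X \<omega>)) B = real_cond_exp M ?F ?f \<omega>"
        using rcp B by (simp add: regular_cond_prob_def)
      have "(\<integral>\<omega>\<in>X -` A \<inter> space M. ?f \<omega> \<partial>M) = (\<integral>\<omega>\<in>X -` A \<inter> space M. real_cond_exp M ?F ?f \<omega> \<partial>M)"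
        by (intro real_cond_exp_intA ind B in_vimage_algebra A)
      also have "\<dots> = (\<integral>\<omega>\<in>X -` A \<inter> space M. measure (\<kappa> (X \<omega>)) B \<partial>M)"
        unfolding set_lebesgue_integral_def
      proof (intro integral_cong_AE)
        show "AE \<omega> in M. indicator (X -` A \<inter> space M) \<omega> *\<^sub>R real_cond_exp M ?F ?f \<omega>
            = indicator (X -` A \<inter> space M) \<omega> *\<^sub>R measure (\<kappa> (X \<omega>)) B"
          using AE by eventually_elim simp
      qed measurable
      finally show "measure (distr M ordering_pairs (\<lambda>\<omega>. (X \<omega>, Y \<omega>))) (A \<times> B)
          = (\<integral>R. indicator A R * measure (\<kappa> R) B \<partial>uniform_ordering)"
        by (simp add: left right \<kappa>)
    qed
  next
    assume dis: "disintegrates (distr M ordering_pairs (\<lambda>\<omega>. (X \<omega>, Y \<omega>))) \<kappa>"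
    then have \<kappa>: "ordering_kernel \<kappa>"
      by (simp add: disintegrates_def)
    show "regular_cond_prob M ordering_space X ordering_space Y \<kappa>"
      unfolding regular_cond_prob_def
    proof (intro conjI ballI \<kappa>)
      fix B assume B[measurable]: "B \<in> sets ordering_space"
      note [measurable] = measurable_kernel_measure[OF \<kappa> B]
      have "AE \<omega> in M. real_cond_exp M ?F (indicator (Y -` B \<inter> space M)) \<omega> = measure (\<kappa> (X \<omega>)) B"
      proof (rule real_cond_exp_charact)
        fix E assume "E \<in> sets ?F"
        then obtain A where A: "A \<in> sets ordering_space" "E = X -` A \<inter> space M"
          by (auto simp: sets_vimage_algebra2[OF XS])
        then show "(\<integral>\<omega>\<in>E. indicator (Y -` B \<inter> space M) \<omega> \<partial>M) = (\<integral>\<omega>\<in>E. measure (\<kappa> (X \<omega>)) B \<partial>M)"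
          using dis B by (simp add: disintegrates_def left[symmetric] right \<kappa>)
      next
        show "integrable M (\<lambda>\<omega>. measure (\<kappa> (X \<omega>)) B)"
          using ordering_kernelD(1)[OF \<kappa>] XS
          by (intro integrable_const_bound[where B = 1]) (auto simp: prob_space.prob_le_1 Pi_iff)
        show "(\<lambda>\<omega>. measure (\<kappa> (X \<omega>)) B) \<in> borel_measurable ?F"
          by (rule measurable_compose[OF measurable_vimage_algebra1[OF XS] measurable_kernel_measure[OF \<kappa> B]])
      qed (rule ind[OF B])
      then show "AE \<omega> in M. measure (\<kappa> (X \<omega>)) B = real_cond_exp M ?F (indicator (Y -` B \<inter> space M)) \<omega>"
        by eventually_elim simp
    qed
  qed
qed

text \<open>For fixed \<open>r\<close> and \<open>A\<close> both sides of the relation are densities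
  with respect to \<lambda>. Integrated over a set \<open>C\<close>, using invariance of \<lambda>,
  they become the \<open>Q\<close>-masses of the relabelled and of the original rectangle
  \<open>C \<times> A\<close>; invariance of \<open>Q\<close> equates them.\<close>

lemma commutes_if_disintegrates:
  assumes dis: "disintegrates Q \<kappa>" and Q: "sets Q = sets ordering_pairs"
    and inv: "\<And>r. bij r \<Longrightarrow> distr Q ordering_pairs (relabel_pair r) = Q"
  shows "commutes_with_relabelling \<kappa>"
  unfolding commutes_with_relabelling_def
proof (intro allI impI ballI)
  fix r :: "nat \<Rightarrow> nat" and A assume r: "bij r" and A: "A \<in> sets ordering_space"
  have \<kappa>: "ordering_kernel \<kappa>"
    using dis by (simp add: disintegrates_def)
  note rel[measurable] = measurable_relabel[OF bij_is_inj[OF r]]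
  have img: "relabel r ` B \<in> sets ordering_space" if "B \<in> sets ordering_space" for B
    by (rule sets_relabel_image[OF r that])
  have mem: "relabel r R \<in> relabel r ` B \<longleftrightarrow> R \<in> B" for R B
    using relabel_inv(1)[OF r] by (metis imageE image_eqI)
  have inj_rel: "relabel r R = relabel r R' \<Longrightarrow> R = R'" for R R'
    by (metis relabel_inv(1)[OF r])
  note [measurable] = measurable_kernel_measure[OF \<kappa> A] measurable_kernel_measure[OF \<kappa> img[OF A]]
  have "AE R in uniform_ordering. measure (\<kappa> (relabel r R)) (relabel r ` A) = measure (\<kappa> R) A"
  proof (rule density_unique_real)
    show "integrable uniform_ordering (\<lambda>R. measure (\<kappa> R) A)"
      using ordering_kernelD(1)[OF \<kappa>]
      by (intro uniform_ordering.integrable_const_bound[where B = 1]) (auto simp: prob_space.prob_le_1)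
    show "integrable uniform_ordering (\<lambda>R. measure (\<kappa> (relabel r R)) (relabel r ` A))"
      using ordering_kernelD(1)[OF \<kappa>] relabel_in_orderings[OF _ bij_is_inj[OF r]]
      by (intro uniform_ordering.integrable_const_bound[where B = 1]) (auto simp: prob_space.prob_le_1)
    fix C assume "C \<in> sets uniform_ordering"
    then have C: "C \<in> sets ordering_space" by simp
    have [measurable]: "relabel r ` C \<in> sets ordering_space" by (rule img[OF C])
    have sub: "C \<subseteq> orderings" "A \<subseteq> orderings"
      using sets.sets_into_space[OF C] sets.sets_into_space[OF A] by auto
    have "(\<integral>R\<in>C. measure (\<kappa> (relabel r R)) (relabel r ` A) \<partial>uniform_ordering)
        = (\<integral>R. indicator (relabel r ` C) (relabel r R) * measure (\<kappa> (relabel r R)) (relabel r ` A) \<partial>uniform_ordering)"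
      by (simp add: set_lebesgue_integral_def indicator_def mem)
    also have "\<dots> = (\<integral>R. indicator (relabel r ` C) R * measure (\<kappa> R) (relabel r ` A)
        \<partial>distr uniform_ordering ordering_space (relabel r))"
      by (rule integral_distr[symmetric]) measurable
    also have "\<dots> = measure Q ((relabel r ` C) \<times> (relabel r ` A))"
      using dis img[OF A] img[OF C] by (simp add: distr_uniform_ordering_relabel[OF r] disintegrates_def)
    also have "\<dots> = measure (distr Q ordering_pairs (relabel_pair r))
        ((relabel r ` C) \<times> (relabel r ` A))"
      by (simp add: inv[OF r])
    also have "\<dots> = measure Q (C \<times> A)"
    proof (subst measure_distr)
      show "relabel_pair r \<in> Q \<rightarrow>\<^sub>M ordering_pairs"
        unfolding map_prod_def using Q by (simp cong: measurable_cong_sets)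
      have "space Q = orderings \<times> orderings"
        using sets_eq_imp_space_eq[OF Q] by (simp add: space_pair_measure)
      with sub have "relabel_pair r -` (relabel r ` C \<times> relabel r ` A) \<inter> space Q = C \<times> A"
        by (auto dest!: inj_rel)
      then show "measure Q (relabel_pair r -` (relabel r ` C \<times> relabel r ` A) \<inter> space Q) = measure Q (C \<times> A)"
        by simp
    qed (use img[OF C] img[OF A] in auto)
    also have "\<dots> = (\<integral>R\<in>C. measure (\<kappa> R) A \<partial>uniform_ordering)"
      using dis C A by (simp add: disintegrates_def set_lebesgue_integral_def)
    finally show "(\<integral>R\<in>C. measure (\<kappa> (relabel r R)) (relabel r ` A) \<partial>uniform_ordering)
        = (\<integral>R\<in>C. measure (\<kappa> R) A \<partial>uniform_ordering)" .
  qed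
  moreover have "AE R in uniform_ordering. R \<in> orderings"
    using AE_space[of uniform_ordering] by simp
  ultimately show "AE R in uniform_ordering. emeasure (\<kappa> (relabel r R)) (relabel r ` A) = emeasure (\<kappa> R) A"
  proof eventually_elim
    case (elim R)
    then have "prob_space (\<kappa> R)" "prob_space (\<kappa> (relabel r R))"
      using ordering_kernelD(1)[OF \<kappa>] relabel_in_orderings[OF _ bij_is_inj[OF r]] by auto
    with elim show ?case
      by (simp add: finite_measure.emeasure_eq_measure prob_space.finite_measure)
  qed
qed

lemma coupling_kernel_commutes:
  assumes \<nu>: "\<nu> \<in> uniform_couplings" and iid: "iid_pairs M U V \<nu>" and ck: "coupling_kernel M U V \<kappa>"
  shows "commutes_with_relabelling \<kappa>"
proof -
  note iid' = distr_iid_pairs[OF iid]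
  have M: "prob_space M"
    using iid by (simp add: iid_pairs_def)
  have "distr M ordering_space (\<lambda>\<omega>. ordering_of (\<lambda>k. U k \<omega>))
      = distr (distr M ordering_pairs (\<lambda>\<omega>. (ordering_of (\<lambda>k. U k \<omega>), ordering_of (\<lambda>k. V k \<omega>))))
          ordering_space fst"
    using iid'(2,3) by (subst distr_distr) (auto simp: comp_def)
  then have "distr M ordering_space (\<lambda>\<omega>. ordering_of (\<lambda>k. U k \<omega>)) = uniform_ordering"
    by (simp add: iid'(1) distr_fst_pair_law[OF \<nu>])
  from regular_cond_prob_iff_disintegrates[OF M iid'(2,3) this] ck have "disintegrates (pair_law \<nu>) \<kappa>"
    by (simp add: coupling_kernel_def iid'(1))
  then show ?thesis
    by (rule commutes_if_disintegrates) (auto simp: pair_law_def distr_pair_law_relabel[OF \<nu>, unfolded pair_law_def])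
qed

text \<open>The ranks of \<open>R\<close> stand in for the values of the U-variables, which they
  recover almost surely, so conditioning on the ordering amounts to conditioning on all those
  values. The coupling enters only through its copula.\<close>

definition coupling_hat :: "(real \<times> real) measure \<Rightarrow> nat rel \<Rightarrow> nat rel measure" where
  "coupling_hat \<nu> R = distr uniform_sequence ordering_space
     (\<lambda>w. ordering_of (\<lambda>k. quantile (copula_of \<nu>) (limit_rank R k) (w k)))"

lemma measurable_coupling_hat:
  "(\<lambda>x. coupling_hat (fst x) (snd x)) \<in> coupling_space \<Otimes>\<^sub>M ordering_space \<rightarrow>\<^sub>M prob_algebra ordering_space"
  unfolding coupling_hat_def
proof (rule measurable_distr_prob_space2[OF measurable_const])
  show "uniform_sequence \<in> space (prob_algebra uniform_sequence)"
    using uniform_seq.P.prob_space_axioms by (simp add: space_prob_algebra)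
  have "(\<lambda>y. quantile (copula_of (fst (fst y))) (limit_rank (snd (fst y)) k) (snd y k))
      \<in> borel_measurable ((coupling_space \<Otimes>\<^sub>M ordering_space) \<Otimes>\<^sub>M uniform_sequence)" for k
    by (rule measurable_quantile_param) measurable
  then show "(\<lambda>(x, w). ordering_of (\<lambda>k. quantile (copula_of (fst x)) (limit_rank (snd x) k) (w k)))
      \<in> (coupling_space \<Otimes>\<^sub>M ordering_space) \<Otimes>\<^sub>M uniform_sequence \<rightarrow>\<^sub>M ordering_space"
    unfolding case_prod_unfold by (rule measurable_ordering_of_component)
qed

lemma ordering_kernel_coupling_hat: "\<nu> \<in> uniform_couplings \<Longrightarrow> ordering_kernel (coupling_hat \<nu>)"
  using measurable_compose[OF measurable_Pair1'[of \<nu> coupling_space ordering_space] measurable_coupling_hat] by simp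

text \<open>Independent pairs are realized by a sequence \<open>u\<close> and an independent noise
  sequence \<open>w\<close>; conditioning on the first ordering then leaves the noise
  untouched.\<close>

lemma PiM_coupling_eq:
  assumes \<nu>: "\<nu> \<in> uniform_couplings"
  shows "(\<Pi>\<^sub>M k\<in>UNIV. \<nu>) = distr (uniform_sequence \<Otimes>\<^sub>M uniform_sequence) (\<Pi>\<^sub>M k\<in>UNIV. square_borel)
     (\<lambda>(u, w) k. copula_point (copula_of \<nu>) (u k, w k))"
proof -
  have UU: "prob_space (uniform01 \<Otimes>\<^sub>M uniform01)"
    by (intro prob_space_pair prob_space_uniform01)
  have m1: "(\<lambda>(u, w) k. (u k, w k)) \<in> uniform_sequence \<Otimes>\<^sub>M uniform_sequence \<rightarrow>\<^sub>M (\<Pi>\<^sub>M k\<in>UNIV. uniform01 \<Otimes>\<^sub>M uniform01)"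
    unfolding case_prod_unfold by (intro measurable_PiM_single') (auto simp: space_pair_measure)
  have m2: "(\<lambda>x k. copula_point (copula_of \<nu>) (x k)) \<in> (\<Pi>\<^sub>M k\<in>(UNIV :: nat set). uniform01 \<Otimes>\<^sub>M uniform01) \<rightarrow>\<^sub>M (\<Pi>\<^sub>M k\<in>UNIV. square_borel)"
    by (intro measurable_PiM_UNIV) measurable
  have "(\<Pi>\<^sub>M k\<in>(UNIV :: nat set). \<nu>) = (\<Pi>\<^sub>M k\<in>UNIV. copula_measure (copula_of \<nu>))"
    by (simp add: copula_measure_copula_of[OF \<nu>])
  also have "\<dots> = distr (\<Pi>\<^sub>M k\<in>UNIV. uniform01 \<Otimes>\<^sub>M uniform01) (\<Pi>\<^sub>M k\<in>UNIV. square_borel) (\<lambda>x k. copula_point (copula_of \<nu>) (x k))"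
    unfolding copula_measure_def by (rule distr_PiM_map[symmetric, OF UU measurable_copula_point])
  also have "\<dots> = distr (distr (uniform_sequence \<Otimes>\<^sub>M uniform_sequence) (\<Pi>\<^sub>M k\<in>UNIV. uniform01 \<Otimes>\<^sub>M uniform01)
      (\<lambda>(u, w) k. (u k, w k))) (\<Pi>\<^sub>M k\<in>UNIV. square_borel) (\<lambda>x k. copula_point (copula_of \<nu>) (x k))"
    by (simp only: distr_pair_uniform_sequence)
  also have "\<dots> = distr (uniform_sequence \<Otimes>\<^sub>M uniform_sequence) (\<Pi>\<^sub>M k\<in>UNIV. square_borel)
     (\<lambda>(u, w) k. copula_point (copula_of \<nu>) (u k, w k))"
    by (subst distr_distr[OF m2 m1]) (simp add: comp_def case_prod_unfold)
  finally show ?thesis .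
qed

text \<open>For typical \<open>u\<close> the ordering gives \<open>u\<close> back, so the section at
  \<open>u\<close> of the event is the event that defines \<open>coupling_hat\<close> at
  \<open>ordering_of u\<close>. Fubini over the noise yields the identity.\<close>

lemma disintegrates_coupling_hat:
  assumes \<nu>: "\<nu> \<in> uniform_couplings"
  shows "disintegrates (pair_law \<nu>) (coupling_hat \<nu>)"
  unfolding disintegrates_def
proof (intro conjI ballI ordering_kernel_coupling_hat[OF \<nu>])
  fix A B assume A[measurable]: "A \<in> sets ordering_space" and B[measurable]: "B \<in> sets ordering_space"
  let ?C = "copula_of \<nu>" and ?P = "uniform_sequence \<Otimes>\<^sub>M uniform_sequence"
  interpret PP: prob_space ?P
    by (intro prob_space_pair uniform_seq.P.prob_space_axioms)
  define Y where "Y = (\<lambda>(u, w). ordering_of (\<lambda>k. quantile ?C (u k :: real) (w k :: real)))"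
  have Y[measurable]: "Y \<in> ?P \<rightarrow>\<^sub>M ordering_space"
  proof -
    have "(\<lambda>y. quantile ?C (fst y k) (snd y k)) \<in> borel_measurable ?P" for k
      by (rule measurable_quantile_param) measurable
    then show ?thesis
      unfolding Y_def case_prod_unfold by (rule measurable_ordering_of_component)
  qed
  have seq: "(\<lambda>(u, w) k. copula_point ?C (u k, w k)) \<in> ?P \<rightarrow>\<^sub>M (\<Pi>\<^sub>M k\<in>UNIV. square_borel)"
    unfolding case_prod_unfold by (intro measurable_PiM_UNIV) measurable
  have "pair_law \<nu> = distr ?P ordering_pairs
      (\<lambda>x. (ordering_of (\<lambda>k. clip (fst x k)), Y x))"
    unfolding pair_law_def PiM_coupling_eq[OF \<nu>]
    by (subst distr_distr[OF measurable_orderings_of_pairs seq])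
      (simp add: comp_def orderings_of_pairs_def copula_point_def Y_def case_prod_unfold)
  also have "\<dots> = distr ?P ordering_pairs (\<lambda>x. (ordering_of (fst x), Y x))"
  proof (intro distr_cong_AE refl)
    \<comment> \<open>The clipping in \<open>copula_point\<close> is invisible on typical
      sequences.\<close>
    have "AE u in uniform_sequence. clip \<circ> u = u"
      using AE_typical by eventually_elim (auto simp: typical_def clip_id less_imp_le)
    then have "AE u in distr ?P uniform_sequence fst. clip \<circ> u = u"
      by (simp only: uniform_seq.P.distr_pair_fst)
    then have "AE x in ?P. clip \<circ> fst x = fst x"
      by (rule AE_distrD[OF measurable_fst])
    then show "AE x in ?P. (ordering_of (\<lambda>k. clip (fst x k)), Y x) = (ordering_of (fst x), Y x)"
      by eventually_elim (simp add: comp_def)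
  qed measurable
  finally have law: "pair_law \<nu> = distr ?P ordering_pairs (\<lambda>x. (ordering_of (fst x), Y x))" .
  let ?E = "{x. ordering_of (fst x) \<in> A \<and> Y x \<in> B}"
  have E: "?E \<in> sets ?P"
  proof -
    have "{x \<in> space ?P. ordering_of (fst x) \<in> A \<and> Y x \<in> B} \<in> sets ?P" by measurable
    then show ?thesis by (simp add: space_pair_measure)
  qed
  have hat: "measure (coupling_hat \<nu> R) B = measure uniform_sequence {w. Y (limit_rank R, w) \<in> B}" for R
  proof -
    have "(\<lambda>w. Y (limit_rank R, w)) \<in> uniform_sequence \<rightarrow>\<^sub>M ordering_space"
      by measurable
    then show ?thesis
      unfolding coupling_hat_def Y_def by (subst measure_distr) (auto simp: vimage_def)
  qed
  have int: "integrable uniform_ordering (\<lambda>R. indicator A R * measure (coupling_hat \<nu> R) B)"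
    by (rule integrable_kernel_measure[OF ordering_kernel_coupling_hat[OF \<nu>] B A])
  have [measurable]: "(\<lambda>R. measure (coupling_hat \<nu> R) B) \<in> borel_measurable ordering_space"
    by (rule measurable_kernel_measure[OF ordering_kernel_coupling_hat[OF \<nu>] B])
  have "emeasure (pair_law \<nu>) (A \<times> B) = emeasure ?P ?E"
    unfolding law by (subst emeasure_distr) (auto simp: space_pair_measure intro!: arg_cong2[where f = emeasure])
  also have "\<dots> = (\<integral>\<^sup>+u. emeasure uniform_sequence (Pair u -` ?E) \<partial>uniform_sequence)"
    by (rule uniform_seq.P.emeasure_pair_measure_alt[OF E])
  also have "\<dots> = (\<integral>\<^sup>+u. ennreal (indicator A (ordering_of u) * measure (coupling_hat \<nu> (ordering_of u)) B) \<partial>uniform_sequence)"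
  proof (intro nn_integral_cong_AE)
    show "AE u in uniform_sequence. emeasure uniform_sequence (Pair u -` ?E)
        = ennreal (indicator A (ordering_of u) * measure (coupling_hat \<nu> (ordering_of u)) B)"
      using AE_typical
    proof eventually_elim
      case (elim u)
      have "Pair u -` ?E = (if ordering_of u \<in> A then {w. Y (limit_rank (ordering_of u), w) \<in> B} else {})"
        by (auto simp: rank_ordering_of[OF elim])
      then show ?case
        by (simp add: hat uniform_seq.P.emeasure_eq_measure)
    qed
  qed
  also have "\<dots> = (\<integral>\<^sup>+R. ennreal (indicator A R * measure (coupling_hat \<nu> R) B) \<partial>uniform_ordering)"
    unfolding uniform_ordering_def by (subst nn_integral_distr) auto
  also have "\<dots> = ennreal (\<integral>R. indicator A R * measure (coupling_hat \<nu> R) B \<partial>uniform_ordering)"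
    by (intro nn_integral_eq_integral int) auto
  finally show "measure (pair_law \<nu>) (A \<times> B) = (\<integral>R. indicator A R * measure (coupling_hat \<nu> R) B \<partial>uniform_ordering)"
    by (simp add: measure_def integral_nonneg_AE)
qed

section \<open>De Finetti's theorem for pairs with uniform marginals\<close>

text \<open>The copula of independent coordinates, needed as the default value of
  \<open>limit_copula\<close>.\<close>

lemma copula_independent: "copula (\<lambda>p q. clip (of_rat p) * clip (of_rat q))"
  unfolding copula_def
proof (intro conjI allI impI)
  fix p p' q q' :: rat assume "p \<le> p'" "q \<le> q'"
  then have "clip (of_rat p) \<le> clip (of_rat p')" "clip (of_rat q) \<le> clip (of_rat q')"
    by (auto simp: clip_def of_rat_less_eq max_def min_def)
  then have "0 \<le> (clip (of_rat p') - clip (of_rat p)) * (clip (of_rat q') - clip (of_rat q))"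
    by simp
  then show "0 \<le> clip (of_rat p') * clip (of_rat q') - clip (of_rat p) * clip (of_rat q')
      - clip (of_rat p') * clip (of_rat q) + clip (of_rat p) * clip (of_rat q)"
    by (simp add: algebra_simps)
qed (auto simp: clip_def)

abbreviation square_sequence :: "(nat \<Rightarrow> real \<times> real) measure" where
  "square_sequence \<equiv> \<Pi>\<^sub>M k\<in>UNIV. square_borel"

definition cylinder :: "(nat \<Rightarrow> rat) \<Rightarrow> (nat \<Rightarrow> rat) \<Rightarrow> (nat \<Rightarrow> real \<times> real) set" where
  "cylinder p q = {z. \<forall>k. z k \<in> corner (p k) (q k)}"

text \<open>A bound of 2 imposes no restriction, so these are the cylinders over finitely many coordinates.\<close>

definition cylinders :: "(nat \<Rightarrow> real \<times> real) set set" where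
  "cylinders = {cylinder p q | p q. \<exists>m. \<forall>k\<ge>m. p k = 2 \<and> q k = 2}"

lemma cylindersI: "\<forall>k\<ge>m. p k = 2 \<and> q k = 2 \<Longrightarrow> cylinder p q \<in> cylinders"
  by (auto simp: cylinders_def)

lemma space_square_sequence: "space square_sequence = {z. \<forall>k. z k \<in> unit_square}"
  by (auto simp: space_PiM)

lemma cylinder_finite:
  assumes "\<forall>k\<ge>m. p k = 2 \<and> q k = 2"
  shows "cylinder p q = {z \<in> space square_sequence. \<forall>k\<in>{..<m}. z k \<in> corner (p k) (q k)}"
proof -
  have "z k \<in> corner (p k) (q k)" if "z k \<in> unit_square" "k < m \<longrightarrow> z k \<in> corner (p k) (q k)" for z k
    using that assms corner_2_2 by (cases "k < m") auto
  moreover have "corner (p k) (q k) \<subseteq> unit_square" for k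
    by (auto simp: corner_def)
  ultimately show ?thesis
    unfolding cylinder_def space_square_sequence by blast
qed

lemma sets_square_sequence: "sets square_sequence = sigma_sets (space square_sequence) cylinders"
proof (rule sets_eq_sigma_setsI)
  show "cylinders \<subseteq> sets square_sequence"
  proof
    fix A assume "A \<in> cylinders"
    then obtain p q m where A: "A = cylinder p q" "\<forall>k\<ge>m. p k = 2 \<and> q k = 2"
      by (auto simp: cylinders_def)
    show "A \<in> sets square_sequence"
      unfolding A(1) cylinder_finite[OF A(2)] by measurable
  qed
  let ?N = "sigma (space square_sequence) cylinders"
  have sub: "cylinders \<subseteq> Pow (space square_sequence)"
    by (auto simp: cylinders_def cylinder_def space_square_sequence corner_def)
  then have sp: "space ?N = space square_sequence" and st: "cylinders \<subseteq> sets ?N"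
    by (auto simp: space_measure_of sets_measure_of)
  have two: "fst z < 2" "snd z < 2" if "z \<in> unit_square" for z :: "real \<times> real"
    using that by auto
  have "(\<lambda>z. z k) \<in> ?N \<rightarrow>\<^sub>M square_borel" for k
  proof -
    have "(\<lambda>z. fst (z k)) \<in> borel_measurable ?N"
    proof (rule borel_measurableI_rat_less)
      fix x
      have "{z \<in> space ?N. fst (z k) < of_rat x} = cylinder ((\<lambda>_. 2)(k := x)) (\<lambda>_. 2)"
        unfolding sp by (auto simp: space_square_sequence cylinder_def corner_def intro: two)
      also have "\<dots> \<in> cylinders"
        by (rule cylindersI[of "Suc k"]) auto
      finally show "{z \<in> space ?N. fst (z k) < of_rat x} \<in> sets ?N"
        using st by auto
    qed
    moreover have "(\<lambda>z. snd (z k)) \<in> borel_measurable ?N"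
    proof (rule borel_measurableI_rat_less)
      fix x
      have "{z \<in> space ?N. snd (z k) < of_rat x} = cylinder (\<lambda>_. 2) ((\<lambda>_. 2)(k := x))"
        unfolding sp by (auto simp: space_square_sequence cylinder_def corner_def intro: two)
      also have "\<dots> \<in> cylinders"
        by (rule cylindersI[of "Suc k"]) auto
      finally show "{z \<in> space ?N. snd (z k) < of_rat x} \<in> sets ?N"
        using st by auto
    qed
    ultimately have "(\<lambda>z. (fst (z k), snd (z k))) \<in> ?N \<rightarrow>\<^sub>M square_borel"
      by (rule measurable_into_square) (unfold sp, auto simp: space_square_sequence mem_Times_iff)
    then show ?thesis by simp
  qed
  then show "(\<lambda>z. z) \<in> ?N \<rightarrow>\<^sub>M square_sequence"
    by (rule measurable_PiM_UNIV)
qed simp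

lemma measure_eqI_cylinders:
  assumes sets: "sets \<mu> = sets square_sequence" "sets \<mu>' = sets square_sequence"
    and prob: "prob_space \<mu>" "prob_space \<mu>'"
    and eq: "\<And>p q m. \<forall>k\<ge>m. p k = 2 \<and> q k = 2 \<Longrightarrow> emeasure \<mu> (cylinder p q) = emeasure \<mu>' (cylinder p q)"
  shows "\<mu> = \<mu>'"
proof (rule measure_eqI_generator_eq)
  interpret \<mu>: prob_space \<mu> by fact
  show "Int_stable cylinders"
  proof (rule Int_stableI)
    fix A B assume "A \<in> cylinders" "B \<in> cylinders"
    then obtain p q m p' q' m' where *: "A = cylinder p q" "\<forall>k\<ge>m. p k = 2 \<and> q k = 2"
      "B = cylinder p' q'" "\<forall>k\<ge>m'. p' k = 2 \<and> q' k = 2"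
      by (auto simp: cylinders_def)
    have "A \<inter> B = cylinder (\<lambda>k. min (p k) (p' k)) (\<lambda>k. min (q k) (q' k))"
      unfolding *(1,3) cylinder_def corner_Int[symmetric] by auto
    also have "\<dots> \<in> cylinders"
      using *(2,4) by (intro cylindersI[of "max m m'"]) simp
    finally show "A \<inter> B \<in> cylinders" .
  qed
  show "cylinders \<subseteq> Pow (space square_sequence)"
    by (auto simp: cylinders_def cylinder_def space_square_sequence corner_def)
  show "X \<in> cylinders \<Longrightarrow> emeasure \<mu> X = emeasure \<mu>' X" for X
    using eq by (auto simp: cylinders_def)
  show "sets \<mu> = sigma_sets (space square_sequence) cylinders" "sets \<mu>' = sigma_sets (space square_sequence) cylinders"
    using sets sets_square_sequence by auto
  have "space square_sequence = cylinder (\<lambda>_. 2) (\<lambda>_. 2)"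
    by (auto simp: cylinder_def corner_2_2 space_square_sequence)
  then show "range (\<lambda>_ :: nat. space square_sequence) \<subseteq> cylinders"
    by (auto simp: cylinders_def)
  show "emeasure \<mu> (space square_sequence) \<noteq> \<infinity>"
    by (simp add: \<mu>.emeasure_eq_measure)
qed auto

lemma dyadic_mean_transpose:
  assumes "i < 2^j" "l < 2^j"
  shows "dyadic_mean (\<lambda>k. a (Transposition.transpose i l k)) j = dyadic_mean a j"
proof -
  have "Transposition.transpose i l permutes {..<2^j}"
    using assms by (intro permutes_swap_id) auto
  from sum.permute[OF this, of a] show ?thesis
    by (simp add: dyadic_mean_def comp_def)
qed

definition frequency :: "(nat \<Rightarrow> real \<times> real) \<Rightarrow> rat \<Rightarrow> rat \<Rightarrow> nat \<Rightarrow> real" where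
  "frequency z p q = dyadic_mean (\<lambda>k. indicator (corner p q) (z k))"

definition has_copula :: "(nat \<Rightarrow> real \<times> real) \<Rightarrow> bool" where
  "has_copula z \<longleftrightarrow> (\<forall>p q. convergent (frequency z p q)) \<and> copula (\<lambda>p q. lim (frequency z p q))"

text \<open>The default makes this a copula for every \<open>z\<close> and not just for almost every
  \<open>z\<close>, so that the associated measures are couplings without exception.\<close>

definition limit_copula :: "(nat \<Rightarrow> real \<times> real) \<Rightarrow> rat \<Rightarrow> rat \<Rightarrow> real" where
  "limit_copula z = (if has_copula z then (\<lambda>p q. lim (frequency z p q)) else (\<lambda>p q. clip (of_rat p) * clip (of_rat q)))"

lemma copula_limit_copula: "copula (limit_copula z)"
  using copula_independent by (auto simp: limit_copula_def has_copula_def)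

lemma frequency_bounds: "0 \<le> frequency z p q j" "frequency z p q j \<le> 1"
  unfolding frequency_def by (rule dyadic_mean_bounds[of 0 _ 1]; simp)+

lemma measurable_indicator_corner [measurable]:
  "(\<lambda>z. indicator (corner p q) (z k) :: real) \<in> borel_measurable square_sequence"
  by (rule measurable_compose[OF _ borel_measurable_indicator[OF sets_corner]]) simp

lemma measurable_frequency [measurable]: "(\<lambda>z. frequency z p q j) \<in> borel_measurable square_sequence"
  unfolding frequency_def by measurable

lemma measurable_limit_copula [measurable]: "(\<lambda>z. limit_copula z p q) \<in> borel_measurable square_sequence"
proof -
  have [measurable]: "(\<lambda>z. lim (frequency z p q)) \<in> borel_measurable square_sequence" for p q
    by measurable
  have "Measurable.pred square_sequence (\<lambda>z. convergent (frequency z p q))" for p q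
    unfolding Cauchy_convergent_iff[symmetric] pred_def by (rule sets_Collect_Cauchy) (rule measurable_frequency)
  note [measurable] = this
  have [measurable]: "Measurable.pred square_sequence has_copula"
    unfolding has_copula_def[abs_def] copula_def by measurable
  have "limit_copula z p q = (if has_copula z then lim (frequency z p q) else clip (of_rat p) * clip (of_rat q))" for z
    by (simp add: limit_copula_def)
  then show ?thesis by simp
qed

text \<open>Once 2^j exceeds both indices, a transposition only permutes the summands of the
  frequency, so the limits agree.\<close>

lemma limit_copula_transpose: "limit_copula (\<lambda>k. z (Transposition.transpose i l k)) = limit_copula z"
proof -
  let ?z = "\<lambda>k. z (Transposition.transpose i l k)"
  have ev: "eventually (\<lambda>j. frequency ?z p q j = frequency z p q j) sequentially" for p q
  proof (rule eventually_sequentiallyI)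
    fix j assume "max i l \<le> j"
    moreover have "j < 2^j" by (rule less_exp)
    ultimately have "i < 2^j" "l < 2^j" by linarith+
    then show "frequency ?z p q j = frequency z p q j"
      unfolding frequency_def by (rule dyadic_mean_transpose)
  qed
  have iff: "frequency ?z p q \<longlonglongrightarrow> c \<longleftrightarrow> frequency z p q \<longlonglongrightarrow> c" for p q c
    by (rule tendsto_cong[OF ev])
  then have "convergent (frequency ?z p q) \<longleftrightarrow> convergent (frequency z p q)"
    "lim (frequency ?z p q) = lim (frequency z p q)" for p q
    by (simp_all add: convergent_def lim_def)
  then show ?thesis
    by (simp add: limit_copula_def has_copula_def)
qed

text \<open>Each product measure is the image of one fixed noise measure under a map that is jointly
  measurable in \<open>z\<close> and the noise, which reduces the dependence on \<open>z\<close> to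
  that of the sampler.\<close>

lemma copula_measure_sequence_measurable:
  "(\<lambda>z. \<Pi>\<^sub>M k\<in>(UNIV :: nat set). copula_measure (limit_copula z)) \<in> square_sequence \<rightarrow>\<^sub>M prob_algebra square_sequence"
proof -
  let ?UU = "uniform01 \<Otimes>\<^sub>M uniform01"
  have UU: "prob_space ?UU"
    by (intro prob_space_pair prob_space_uniform01)
  have eq: "(\<Pi>\<^sub>M k\<in>(UNIV :: nat set). copula_measure C)
      = distr (\<Pi>\<^sub>M k\<in>UNIV. ?UU) square_sequence (\<lambda>x k. copula_point C (x k))" for C
    unfolding copula_measure_def by (rule distr_PiM_map[symmetric, OF UU measurable_copula_point])
  show ?thesis
    unfolding eq
  proof (rule measurable_distr_prob_space2[OF measurable_const])
    show "(\<Pi>\<^sub>M k\<in>(UNIV :: nat set). ?UU) \<in> space (prob_algebra (\<Pi>\<^sub>M k\<in>UNIV. ?UU))"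
      using UU by (auto simp: space_prob_algebra intro!: prob_space_PiM)
    have "(\<lambda>y. copula_point (limit_copula (fst y)) (snd y k))
        \<in> square_sequence \<Otimes>\<^sub>M (\<Pi>\<^sub>M k\<in>UNIV. ?UU) \<rightarrow>\<^sub>M square_borel" for k :: nat
    proof -
      have "(\<lambda>y. (fst y, snd y k)) \<in> square_sequence \<Otimes>\<^sub>M (\<Pi>\<^sub>M k\<in>UNIV. ?UU) \<rightarrow>\<^sub>M square_sequence \<Otimes>\<^sub>M ?UU"
        by measurable
      from measurable_compose[OF this measurable_copula_point_param[OF measurable_limit_copula]]
      show ?thesis by simp
    qed
    then show "(\<lambda>(z, x) k. copula_point (limit_copula z) (x k))
        \<in> square_sequence \<Otimes>\<^sub>M (\<Pi>\<^sub>M k\<in>UNIV. ?UU) \<rightarrow>\<^sub>M square_sequence"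
      unfolding case_prod_unfold by (rule measurable_PiM_UNIV)
  qed
qed

text \<open>Transpositions suffice because coordinates are replaced one at a time. The condition on
  \<open>typical\<close> supplies uniform marginals in the form of limiting frequencies.\<close>

locale exchangeable_pairs = prob_space \<zeta> for \<zeta> :: "(nat \<Rightarrow> real \<times> real) measure" +
  assumes sets_\<zeta> [measurable_cong]: "sets \<zeta> = sets square_sequence"
    and exchangeable: "\<And>i l. distr \<zeta> square_sequence (\<lambda>z k. z (Transposition.transpose i l k)) = \<zeta>"
    and typical_coordinates: "AE z in \<zeta>. typical (\<lambda>k. fst (z k)) \<and> typical (\<lambda>k. snd (z k))"
begin

lemma space_\<zeta>: "space \<zeta> = {z. \<forall>k. z k \<in> unit_square}"
  using sets_eq_imp_space_eq[OF sets_\<zeta>] by (simp add: space_square_sequence)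

lemma integral_transpose:
  fixes f :: "(nat \<Rightarrow> real \<times> real) \<Rightarrow> real"
  assumes [measurable]: "f \<in> borel_measurable square_sequence"
  shows "(\<integral>z. f (\<lambda>k. z (Transposition.transpose i l k)) \<partial>\<zeta>) = (\<integral>z. f z \<partial>\<zeta>)"
proof -
  have "(\<integral>z. f z \<partial>distr \<zeta> square_sequence (\<lambda>z k. z (Transposition.transpose i l k)))
      = (\<integral>z. f (\<lambda>k. z (Transposition.transpose i l k)) \<partial>\<zeta>)"
    by (rule integral_distr) (auto intro!: measurable_PiM_UNIV)
  then show ?thesis by (simp add: exchangeable)
qed

lemma AE_has_copula: "AE z in \<zeta>. has_copula z"
proof -
  have conv: "AE z in \<zeta>. \<forall>p q. convergent (frequency z p q)"
    unfolding AE_all_countable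
  proof (intro allI)
    fix p q
    let ?f = "\<lambda>k z. indicator (corner p q) (z k) :: real"
    show "AE z in \<zeta>. convergent (frequency z p q)"
      unfolding frequency_def
    proof (rule AE_convergent_dyadic_mean)
      show "?f k \<in> borel_measurable \<zeta>" for k by measurable
      show "expectation (\<lambda>z. ?f i z * ?f k z) = expectation (\<lambda>z. ?f 0 z * ?f 1 z)" if "i \<noteq> k" for i k
      proof -
        \<comment> \<open>The first transposition moves \<open>i\<close> to 0 and \<open>k\<close>
          to \<open>k'\<close>, which differs from 0; the second moves \<open>k'\<close> to 1 and
          fixes 0.\<close>
        define k' where "k' = Transposition.transpose i 0 k"
        have "k' \<noteq> 0"
          using that by (auto simp: k'_def Transposition.transpose_def)
        have "expectation (\<lambda>z. ?f i z * ?f k z) = expectation (\<lambda>z. ?f 0 z * ?f k' z)"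
          using integral_transpose[of "\<lambda>z. ?f i z * ?f k z" i 0] by (simp add: k'_def)
        also have "\<dots> = expectation (\<lambda>z. ?f 0 z * ?f 1 z)"
          using integral_transpose[of "\<lambda>z. ?f 0 z * ?f k' z" k' 1] \<open>k' \<noteq> 0\<close>
          by (simp add: Transposition.transpose_def)
        finally show ?thesis .
      qed
      show "expectation (\<lambda>z. (?f i z)\<^sup>2) = expectation (\<lambda>z. (?f 0 z)\<^sup>2)" for i
        using integral_transpose[of "\<lambda>z. (?f i z)\<^sup>2" i 0] by simp
    qed (auto simp: indicator_def)
  qed
  have "AE z in \<zeta>. z \<in> space \<zeta>" by simp
  with conv typical_coordinates show ?thesis
  proof eventually_elim
    case (elim z)
    let ?L = "\<lambda>p q. lim (frequency z p q)"
    have lim: "frequency z p q \<longlonglongrightarrow> ?L p q" for p q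
      using elim by (simp add: convergent_LIMSEQ_iff)
    have z: "0 \<le> fst (z k)" "fst (z k) < 1" "0 \<le> snd (z k)" "snd (z k) < 1" "z k \<in> unit_square" for k
      using elim by (auto simp: typical_def space_\<zeta>)
    have mean: "dyadic_mean (\<lambda>k. of_bool (fst (z k) < of_rat p)) \<longlonglongrightarrow> clip (of_rat p)"
      "dyadic_mean (\<lambda>k. of_bool (snd (z k) < of_rat p)) \<longlonglongrightarrow> clip (of_rat p)" for p
      using elim by (auto simp: typical_def)
    have "copula ?L"
      unfolding copula_def
    proof (intro conjI allI impI)
      fix p p' q q' :: rat assume le: "p \<le> p'" "q \<le> q'"
      have le': "of_rat p \<le> (of_rat p' :: real)" "of_rat q \<le> (of_rat q' :: real)"
        using le by (simp_all add: of_rat_less_eq)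
      have "(\<lambda>j. frequency z p' q' j - frequency z p q' j - frequency z p' q j + frequency z p q j)
          \<longlonglongrightarrow> ?L p' q' - ?L p q' - ?L p' q + ?L p q"
        by (intro tendsto_intros lim)
      moreover have "0 \<le> frequency z p' q' j - frequency z p q' j - frequency z p' q j + frequency z p q j" for j
      proof -
        have "frequency z p' q' j - frequency z p q' j - frequency z p' q j + frequency z p q j
            = dyadic_mean (\<lambda>k. indicator (corner p' q') (z k) - indicator (corner p q') (z k)
                - indicator (corner p' q) (z k) + indicator (corner p q) (z k)) j"
          by (simp add: frequency_def dyadic_mean_add dyadic_mean_diff)
        \<comment> \<open>The alternating sum is the indicator of a half-open rectangle, so
          nonnegativity holds before any limit is taken.\<close>
        moreover have "0 \<le> indicator (corner p' q') x - indicator (corner p q') x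
                - indicator (corner p' q) x + (indicator (corner p q) x :: real)" for x
          using le' by (auto simp: indicator_def corner_def)
        ultimately show ?thesis
          by (simp add: dyadic_mean_def sum_nonneg)
      qed
      ultimately show "0 \<le> ?L p' q' - ?L p q' - ?L p' q + ?L p q"
        by (intro LIMSEQ_le_const) auto
    next
      fix p q :: rat assume "p \<le> 0 \<or> q \<le> 0"
      then have "of_rat p \<le> (0 :: real) \<or> of_rat q \<le> (0 :: real)" by simp
      then have "z k \<notin> corner p q" for k
        using z(1)[of k] z(3)[of k] unfolding corner_def by (smt (verit) mem_Collect_eq)
      then have "frequency z p q = (\<lambda>_. 0)"
        by (simp add: frequency_def fun_eq_iff)
      then show "?L p q = 0" by simp
    next
      fix p q :: rat assume "1 \<le> q"
      then have "1 \<le> (of_rat q :: real)" by simp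
      then have "snd (z k) < of_rat q" for k
        using z(4)[of k] by linarith
      then have "frequency z p q = dyadic_mean (\<lambda>k. of_bool (fst (z k) < of_rat p))"
        using z(5) unfolding frequency_def by (intro arg_cong[where f = dyadic_mean]) (auto simp: corner_def indicator_def fun_eq_iff)
      then show "?L p q = clip (of_rat p)"
        using mean(1)[of p] by (simp add: limI)
    next
      fix p q :: rat assume "1 \<le> p"
      then have "1 \<le> (of_rat p :: real)" by simp
      then have "fst (z k) < of_rat p" for k
        using z(2)[of k] by linarith
      then have "frequency z p q = dyadic_mean (\<lambda>k. of_bool (snd (z k) < of_rat q))"
        using z(5) unfolding frequency_def by (intro arg_cong[where f = dyadic_mean]) (auto simp: corner_def indicator_def fun_eq_iff)
      then show "?L p q = clip (of_rat q)"
        using mean(2)[of q] by (simp add: limI)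
    qed
    with elim show ?case by (simp add: has_copula_def)
  qed
qed

lemma AE_frequency_tendsto: "AE z in \<zeta>. frequency z p q \<longlonglongrightarrow> limit_copula z p q"
  using AE_has_copula by eventually_elim (auto simp: has_copula_def limit_copula_def convergent_LIMSEQ_iff)

text \<open>
  By exchangeability the coordinate \<open>z i\<close> may be replaced by \<open>z l\<close> for any \<open>l \<ge> i\<close>, hence by the average
  over many such \<open>l\<close>.
\<close>

lemma integral_replace_coordinate:
  assumes [measurable]: "H \<in> borel_measurable square_sequence" and H: "\<And>z. 0 \<le> H z" "\<And>z. H z \<le> 1"
    and inv: "\<And>z l. i \<le> l \<Longrightarrow> H (\<lambda>k. z (Transposition.transpose i l k)) = H z"
  shows "(\<integral>z. H z * indicator (corner p q) (z i) \<partial>\<zeta>) = (\<integral>z. H z * limit_copula z p q \<partial>\<zeta>)"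
proof (rule LIMSEQ_unique)
  let ?f = "\<lambda>k z. indicator (corner p q) (z k) :: real"
  define e where "e l = (\<integral>z. H z * ?f l z \<partial>\<zeta>)" for l
  have bdd: "0 \<le> H z * ?f l z" "H z * ?f l z \<le> 1" for l z
    using H by (auto intro: mult_le_one simp: indicator_def)
  have int: "integrable \<zeta> (\<lambda>z. H z * ?f l z)" for l
    using bdd by (intro integrable_const_bound[where B = 1]) auto
  have e_bdd: "0 \<le> e l" "e l \<le> 1" for l
  proof -
    show "0 \<le> e l" unfolding e_def using bdd by (intro Bochner_Integration.integral_nonneg) auto
    have "e l \<le> (\<integral>z. 1 \<partial>\<zeta>)"
      unfolding e_def using bdd int by (intro integral_mono) auto
    then show "e l \<le> 1" by (simp add: prob_space)
  qed
  have e_eq: "e l = e i" if "i \<le> l" for l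
    using integral_transpose[of "\<lambda>z. H z * ?f i z" i l] by (simp add: e_def inv[OF that])
  have mean: "(\<integral>z. H z * frequency z p q j \<partial>\<zeta>) = dyadic_mean e j" for j
  proof -
    have "(\<integral>z. H z * frequency z p q j \<partial>\<zeta>) = (\<integral>z. (\<Sum>l<2^j. H z * ?f l z) / 2^j \<partial>\<zeta>)"
      by (simp only: frequency_def dyadic_mean_def sum_distrib_left times_divide_eq_right)
    also have "\<dots> = (\<Sum>l<2^j. e l) / 2^j"
      unfolding e_def by (subst Bochner_Integration.integral_sum[OF int, symmetric]) (rule integral_divide_zero)
    finally show ?thesis by (simp add: dyadic_mean_def)
  qed
  show "(\<lambda>j. \<integral>z. H z * frequency z p q j \<partial>\<zeta>) \<longlonglongrightarrow> (\<integral>z. H z * limit_copula z p q \<partial>\<zeta>)"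
  proof (rule integral_dominated_convergence[where w = "\<lambda>_. 1"])
    show "AE z in \<zeta>. (\<lambda>j. H z * frequency z p q j) \<longlonglongrightarrow> H z * limit_copula z p q"
      using AE_frequency_tendsto by eventually_elim (intro tendsto_intros)
    show "AE z in \<zeta>. norm (H z * frequency z p q j) \<le> 1" for j
      using H frequency_bounds by (auto simp: abs_mult intro!: mult_le_one)
  qed auto
  \<comment> \<open>All terms with index at least \<open>i\<close> equal \<open>e i\<close>; the
    fewer than or exactly \<open>i\<close> remaining ones are off by at most 1 each and are divided
    by 2^j.\<close>
  have "(\<lambda>j. dyadic_mean e j - e i) \<longlonglongrightarrow> 0"
  proof (rule Lim_null_comparison)
    show "(\<lambda>j. real i * (1/2)^j) \<longlonglongrightarrow> 0"
      by (intro tendsto_mult_right_zero LIMSEQ_realpow_zero) auto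
    show "eventually (\<lambda>j. norm (dyadic_mean e j - e i) \<le> real i * (1/2)^j) sequentially"
    proof (intro always_eventually allI)
      fix j
      have "dyadic_mean e j - e i = (\<Sum>l<2^j. e l - e i) / 2^j"
        by (simp add: dyadic_mean_def sum_subtractf diff_divide_distrib)
      also have "(\<Sum>l<2^j. e l - e i) = (\<Sum>l\<in>{..<2^j} \<inter> {..<i}. e l - e i)"
      proof (rule sum.mono_neutral_right)
        show "\<forall>l\<in>{..<2^j} - {..<2^j} \<inter> {..<i}. e l - e i = 0"
        proof
          fix l assume "l \<in> {..<2^j} - {..<2^j} \<inter> {..<i}"
          then have "i \<le> l" by auto
          from e_eq[OF this] show "e l - e i = 0" by simp
        qed
      qed auto
      finally have "\<bar>dyadic_mean e j - e i\<bar> = \<bar>\<Sum>l\<in>{..<2^j} \<inter> {..<i}. e l - e i\<bar> / 2^j"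
        by simp
      also have "\<bar>\<Sum>l\<in>{..<2^j} \<inter> {..<i}. e l - e i\<bar> \<le> (\<Sum>l\<in>{..<2^j} \<inter> {..<i}. \<bar>e l - e i\<bar>)"
        by (rule sum_abs)
      also have "\<dots> \<le> (\<Sum>l\<in>{..<2^j} \<inter> {..<i}. 1)"
      proof (rule sum_mono)
        fix l
        show "\<bar>e l - e i\<bar> \<le> 1"
          using e_bdd[of l] e_bdd[of i] by linarith
      qed
      also have "\<dots> \<le> real i"
        using card_mono[of "{..<i}" "{..<2^j} \<inter> {..<i}"] by simp
      finally show "norm (dyadic_mean e j - e i) \<le> real i * (1/2)^j"
        by (simp add: divide_right_mono power_one_over field_simps)
    qed
  qed
  then show "(\<lambda>j. \<integral>z. H z * frequency z p q j \<partial>\<zeta>) \<longlonglongrightarrow> (\<integral>z. H z * indicator (corner p q) (z i) \<partial>\<zeta>)"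
    unfolding mean e_def[symmetric] by (simp add: LIM_zero_iff)
qed

lemma integral_corners_eq:
  "(\<integral>z. (\<Prod>k<m. indicator (corner (p k) (q k)) (z k)) \<partial>\<zeta>) = (\<integral>z. (\<Prod>k<m. limit_copula z (p k) (q k)) \<partial>\<zeta>)"
proof -
  let ?f = "\<lambda>k z. indicator (corner (p k) (q k)) (z k) :: real"
  let ?g = "\<lambda>k z. limit_copula z (p k) (q k)"
  have g: "0 \<le> ?g k z" "?g k z \<le> 1" for k z
    using copula_bounds[OF copula_limit_copula] by auto
  have "(\<integral>z. (\<Prod>k<i. ?f k z) * (\<Prod>k\<in>{i..<m}. ?g k z) \<partial>\<zeta>) = (\<integral>z. (\<Prod>k<m. ?g k z) \<partial>\<zeta>)" if "i \<le> m" for i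
    using that
  proof (induction i)
    case 0
    then show ?case by (simp add: atLeast0LessThan)
  next
    case (Suc i)
    \<comment> \<open>\<open>H\<close> collects the indicators still present, at indices below
      \<open>i\<close>, and the factors already replaced, which depend on \<open>z\<close> through
      the limit copula. Swapping \<open>i\<close> with a later index changes neither.\<close>
    define H where "H z = (\<Prod>k<i. ?f k z) * (\<Prod>k\<in>{Suc i..<m}. ?g k z)" for z
    have H: "H \<in> borel_measurable square_sequence"
      unfolding H_def by measurable
    have H_bdd: "0 \<le> H z" "H z \<le> 1" for z
      unfolding H_def using g by (auto intro!: mult_nonneg_nonneg mult_le_one prod_nonneg prod_le_1 simp: indicator_def)
    have H_inv: "H (\<lambda>k. z (Transposition.transpose i l k)) = H z" if "i \<le> l" for z l
      unfolding H_def limit_copula_transpose using that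
      by (intro arg_cong2[where f = "(*)"] prod.cong refl) (auto simp: Transposition.transpose_def)
    have "(\<integral>z. (\<Prod>k<Suc i. ?f k z) * (\<Prod>k\<in>{Suc i..<m}. ?g k z) \<partial>\<zeta>) = (\<integral>z. H z * ?f i z \<partial>\<zeta>)"
      by (simp add: H_def mult_ac)
    also have "\<dots> = (\<integral>z. H z * ?g i z \<partial>\<zeta>)"
      by (rule integral_replace_coordinate[OF H H_bdd H_inv])
    also have "\<dots> = (\<integral>z. (\<Prod>k<i. ?f k z) * (\<Prod>k\<in>{i..<m}. ?g k z) \<partial>\<zeta>)"
      using Suc.prems by (simp add: H_def prod.atLeast_Suc_lessThan mult_ac)
    finally show ?case
      using Suc by simp
  qed
  from this[of m] show ?thesis by simp
qed

text \<open>It is enough to compare both sides on cylinders. There the product law gives the product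
  of copula values, whose mean was identified with the mean of the product of indicators.\<close>

lemma de_Finetti:
  assumes E: "E \<in> sets square_sequence"
  shows "emeasure \<zeta> E = (\<integral>\<^sup>+z. emeasure (\<Pi>\<^sub>M k\<in>UNIV. copula_measure (limit_copula z)) E \<partial>\<zeta>)"
proof -
  let ?K = "\<lambda>z. \<Pi>\<^sub>M k\<in>(UNIV :: nat set). copula_measure (limit_copula z)"
  have \<zeta>: "\<zeta> \<in> space (prob_algebra square_sequence)"
    using sets_\<zeta> prob_space_axioms by (simp add: space_prob_algebra)
  note K = copula_measure_sequence_measurable
  note bind = emeasure_bind_prob_algebra[OF \<zeta> K]
  have "\<zeta> = bind \<zeta> ?K"
  proof (rule measure_eqI_cylinders[OF sets_\<zeta> sets_bind'[OF \<zeta> K] prob_space_axioms prob_space_bind'[OF \<zeta> K]])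
    fix p q :: "nat \<Rightarrow> rat" and m assume m: "\<forall>k\<ge>m. p k = 2 \<and> q k = 2"
    have cyl: "cylinder p q \<in> sets square_sequence"
      unfolding cylinder_finite[OF m] by measurable
    have K_eq: "emeasure (?K z) (cylinder p q) = ennreal (\<Prod>k<m. limit_copula z (p k) (q k))" for z
    proof -
      interpret N: prob_space "copula_measure (limit_copula z)"
        by (rule prob_space_copula_measure)
      interpret P: product_prob_space "\<lambda>_. copula_measure (limit_copula z)" "UNIV :: nat set"
        by standard
      have sp: "space (?K z) = space square_sequence"
        by (simp add: space_PiM copula_measure_def)
      have "emeasure (?K z) (cylinder p q) = (\<Prod>k<m. emeasure (copula_measure (limit_copula z)) (corner (p k) (q k)))"
        unfolding cylinder_finite[OF m] sp[symmetric] by (intro P.emeasure_PiM_Collect) auto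
      also have "\<dots> = (\<Prod>k<m. ennreal (limit_copula z (p k) (q k)))"
        by (intro prod.cong refl) (simp add: N.emeasure_eq_measure measure_copula_measure[OF copula_limit_copula])
      finally show ?thesis
        using copula_bounds[OF copula_limit_copula] by (simp add: prod_ennreal)
    qed
    have ind: "indicator (cylinder p q) z = (\<Prod>k<m. indicator (corner (p k) (q k)) (z k) :: real)" if "z \<in> space \<zeta>" for z
    proof -
      have "z \<in> cylinder p q \<longleftrightarrow> (\<forall>k<m. z k \<in> corner (p k) (q k))"
        using that unfolding cylinder_finite[OF m] sets_eq_imp_space_eq[OF sets_\<zeta>, symmetric] by auto
      then show ?thesis
        by (auto simp: indicator_def prod.If_cases intro!: prod_zero)
    qed
    have "measure \<zeta> (cylinder p q) = (\<integral>z. indicator (cylinder p q) z \<partial>\<zeta>)"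
      using cyl sets.sets_into_space[OF cyl] sets_eq_imp_space_eq[OF sets_\<zeta>] by (simp add: Int_absorb2)
    also have "\<dots> = (\<integral>z. (\<Prod>k<m. indicator (corner (p k) (q k)) (z k)) \<partial>\<zeta>)"
      by (intro Bochner_Integration.integral_cong refl ind)
    also have "\<dots> = (\<integral>z. (\<Prod>k<m. limit_copula z (p k) (q k)) \<partial>\<zeta>)"
      by (rule integral_corners_eq)
    finally have "emeasure \<zeta> (cylinder p q) = ennreal (\<integral>z. (\<Prod>k<m. limit_copula z (p k) (q k)) \<partial>\<zeta>)"
      by (simp add: emeasure_eq_measure)
    also have "\<dots> = (\<integral>\<^sup>+z. ennreal (\<Prod>k<m. limit_copula z (p k) (q k)) \<partial>\<zeta>)"
    proof (rule nn_integral_eq_integral[symmetric])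
      show "integrable \<zeta> (\<lambda>z. \<Prod>k<m. limit_copula z (p k) (q k))"
        using copula_bounds[OF copula_limit_copula]
        by (intro integrable_const_bound[where B = 1]) (auto simp: abs_prod intro!: prod_le_1 prod_nonneg)
    qed (use copula_bounds[OF copula_limit_copula] in \<open>auto intro!: prod_nonneg\<close>)
    also have "\<dots> = emeasure (bind \<zeta> ?K) (cylinder p q)"
      by (simp add: bind[OF cyl] K_eq)
    finally show "emeasure \<zeta> (cylinder p q) = emeasure (bind \<zeta> ?K) (cylinder p q)" .
  qed
  then have "emeasure \<zeta> E = emeasure (bind \<zeta> ?K) E" by simp
  then show ?thesis
    by (simp add: bind[OF E])
qed

end

section \<open>Mixtures of coupling kernels\<close>

lemma measure_eqI_rectangles:
  assumes sets: "sets \<mu> = sets (M \<Otimes>\<^sub>M N)" "sets \<nu> = sets (M \<Otimes>\<^sub>M N)"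
    and prob: "prob_space \<mu>" "prob_space \<nu>"
    and eq: "\<And>A B. A \<in> sets M \<Longrightarrow> B \<in> sets N \<Longrightarrow> measure \<mu> (A \<times> B) = measure \<nu> (A \<times> B)"
  shows "\<mu> = \<nu>"
proof (rule measure_eqI_generator_eq[OF Int_stable_pair_measure_generator[of M N]])
  interpret \<mu>: prob_space \<mu> by fact
  interpret \<nu>: prob_space \<nu> by fact
  let ?E = "{a \<times> b |a b. a \<in> sets M \<and> b \<in> sets N}"
  show "?E \<subseteq> Pow (space M \<times> space N)"
    using sets.space_closed[of M] sets.space_closed[of N] by auto
  show "sets \<mu> = sigma_sets (space M \<times> space N) ?E" "sets \<nu> = sigma_sets (space M \<times> space N) ?E"
    by (simp_all add: sets sets_pair_measure)
  show "X \<in> ?E \<Longrightarrow> emeasure \<mu> X = emeasure \<nu> X" for X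
    using eq by (auto simp: \<mu>.emeasure_eq_measure \<nu>.emeasure_eq_measure)
  show "range (\<lambda>_ :: nat. space M \<times> space N) \<subseteq> ?E" by auto
  show "emeasure \<mu> (space M \<times> space N) \<noteq> \<infinity>"
    by (simp add: \<mu>.emeasure_eq_measure)
qed auto

text \<open>A general bijection rearranges the terms of the dyadic means and may change their
  limits, so equivariance is only almost sure: the permuted ranks are again independent and uniform,
  hence typical, and are recovered from their own ordering.\<close>

lemma AE_rank_relabel:
  assumes r: "bij r"
  shows "AE R in uniform_ordering. limit_rank (relabel r R) = (\<lambda>k. limit_rank R (r k))"
proof -
  have perm: "(\<lambda>u k. u (r k)) \<in> uniform_sequence \<rightarrow>\<^sub>M uniform_sequence"
    by (rule measurable_PiM_UNIV) measurable
  have "distr uniform_sequence uniform_sequence (\<lambda>u k. u (r k)) = uniform_sequence"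
    using distr_PiM_reindex[of UNIV "\<lambda>_. uniform01" r UNIV] prob_space_uniform01 bij_is_inj[OF r]
    by (simp add: restrict_def)
  then have "AE u in distr uniform_sequence uniform_sequence (\<lambda>u k. u (r k)). typical u"
    by (simp only: AE_typical)
  then have "AE u in uniform_sequence. typical (\<lambda>k. u (r k))"
    by (rule AE_distrD[OF perm])
  then have "AE u in distr uniform_ordering (\<Pi>\<^sub>M k\<in>UNIV. borel) limit_rank. typical (\<lambda>k. u (r k))"
    by (simp only: distr_rank_uniform_ordering)
  moreover have "limit_rank \<in> uniform_ordering \<rightarrow>\<^sub>M (\<Pi>\<^sub>M k\<in>UNIV. borel)"
    by measurable
  ultimately have "AE R in uniform_ordering. typical (\<lambda>k. limit_rank R (r k))"
    using AE_distrD by blast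
  with AE_uniform_ordering show ?thesis
  proof eventually_elim
    case (elim R)
    then have "relabel r R = relabel r (ordering_of (limit_rank R))" by simp
    also have "\<dots> = ordering_of (\<lambda>k. limit_rank R (r k))"
      using elim by (intro relabel_ordering_of bij_is_inj[OF r]) (auto simp: typical_def)
    finally show ?case
      using rank_ordering_of elim by simp
  qed
qed

section \<open>The joint law generated by a commuting kernel\<close>

definition kernel_law :: "(nat rel \<Rightarrow> nat rel measure) \<Rightarrow> (nat rel \<times> nat rel) measure" where
  "kernel_law \<kappa> = bind uniform_ordering (\<lambda>R. distr (\<kappa> R) ordering_pairs (Pair R))"

definition rank_pairs :: "nat rel \<times> nat rel \<Rightarrow> nat \<Rightarrow> real \<times> real" where
  "rank_pairs x k = (limit_rank (fst x) k, limit_rank (snd x) k)"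

lemma measurable_rank_pairs [measurable]: "rank_pairs \<in> ordering_pairs \<rightarrow>\<^sub>M square_sequence"
  unfolding rank_pairs_def[abs_def] by (intro measurable_PiM_UNIV measurable_into_square; (measurable | simp))

context
  fixes \<kappa> :: "nat rel \<Rightarrow> nat rel measure"
  assumes \<kappa>: "ordering_kernel \<kappa>" and comm: "commutes_with_relabelling \<kappa>"
begin

abbreviation (input) "Q \<equiv> kernel_law \<kappa>"

lemma kernel_law_kernel:
  "(\<lambda>R. distr (\<kappa> R) ordering_pairs (Pair R)) \<in> ordering_space \<rightarrow>\<^sub>M prob_algebra ordering_pairs"
  by (rule measurable_distr_prob_space2[OF \<kappa>]) measurable

lemma uniform_ordering_in_prob_algebra: "uniform_ordering \<in> space (prob_algebra ordering_space)"
  using uniform_ordering.prob_space_axioms by (simp add: space_prob_algebra)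

lemma sets_kernel_law [measurable_cong]: "sets Q = sets ordering_pairs"
  unfolding kernel_law_def by (rule sets_bind'[OF uniform_ordering_in_prob_algebra kernel_law_kernel])

lemma space_kernel_law: "space Q = orderings \<times> orderings"
  using sets_eq_imp_space_eq[OF sets_kernel_law] by (simp add: space_pair_measure)

lemma prob_space_kernel_law: "prob_space Q"
  unfolding kernel_law_def by (rule prob_space_bind'[OF uniform_ordering_in_prob_algebra kernel_law_kernel])

lemma emeasure_kernel_law:
  assumes A: "A \<in> sets ordering_space" and B: "B \<in> sets ordering_space"
  shows "emeasure Q (A \<times> B) = (\<integral>\<^sup>+R. indicator A R * emeasure (\<kappa> R) B \<partial>uniform_ordering)"
proof -
  have "emeasure Q (A \<times> B) = (\<integral>\<^sup>+R. emeasure (distr (\<kappa> R) ordering_pairs (Pair R)) (A \<times> B) \<partial>uniform_ordering)"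
    unfolding kernel_law_def using A B
    by (intro emeasure_bind_prob_algebra[OF uniform_ordering_in_prob_algebra kernel_law_kernel]) auto
  also have "\<dots> = (\<integral>\<^sup>+R. indicator A R * emeasure (\<kappa> R) B \<partial>uniform_ordering)"
  proof (intro nn_integral_cong)
    fix R assume "R \<in> space uniform_ordering"
    then have R: "R \<in> orderings" by simp
    note S = ordering_kernelD(2)[OF \<kappa> R]
    have "Pair R \<in> \<kappa> R \<rightarrow>\<^sub>M ordering_pairs"
      using R unfolding measurable_cong_sets[OF S refl] by (intro measurable_Pair1') simp
    moreover have "Pair R -` (A \<times> B) \<inter> space (\<kappa> R) = (if R \<in> A then B else {})"
      using sets_eq_imp_space_eq[OF S] sets.sets_into_space[OF B] by auto
    ultimately show "emeasure (distr (\<kappa> R) ordering_pairs (Pair R)) (A \<times> B) = indicator A R * emeasure (\<kappa> R) B"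
      using A B by (subst emeasure_distr) auto
  qed
  finally show ?thesis .
qed

lemma measure_kernel_law:
  assumes A: "A \<in> sets ordering_space" and B: "B \<in> sets ordering_space"
  shows "measure Q (A \<times> B) = (\<integral>R. indicator A R * measure (\<kappa> R) B \<partial>uniform_ordering)"
proof -
  have "emeasure Q (A \<times> B) = (\<integral>\<^sup>+R. ennreal (indicator A R * measure (\<kappa> R) B) \<partial>uniform_ordering)"
    unfolding emeasure_kernel_law[OF A B]
  proof (intro nn_integral_cong)
    fix R assume "R \<in> space uniform_ordering"
    then have "finite_measure (\<kappa> R)"
      using ordering_kernelD(1)[OF \<kappa>] by (simp add: prob_space.finite_measure)
    then show "indicator A R * emeasure (\<kappa> R) B = ennreal (indicator A R * measure (\<kappa> R) B)"
      by (simp add: finite_measure.emeasure_eq_measure indicator_def)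
  qed
  also have "\<dots> = ennreal (\<integral>R. indicator A R * measure (\<kappa> R) B \<partial>uniform_ordering)"
    by (intro nn_integral_eq_integral integrable_kernel_measure \<kappa> A B) auto
  finally show ?thesis
    by (simp add: measure_def integral_nonneg_AE)
qed

lemma measurable_map_relabel:
  "bij r \<Longrightarrow> relabel_pair r \<in> ordering_pairs \<rightarrow>\<^sub>M ordering_pairs"
  using measurable_relabel[OF bij_is_inj] unfolding map_prod_def by measurable

text \<open>On a rectangle the claim is the commutation relation integrated against \<lambda>, so
  the dependence of its null set on \<open>r\<close> and on the event is harmless.\<close>

lemma distr_kernel_law_relabel:
  assumes r: "bij r"
  shows "distr Q ordering_pairs (relabel_pair r) = Q"
proof (rule measure_eqI_rectangles[OF _ sets_kernel_law _ prob_space_kernel_law])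
  interpret Q: prob_space Q by (rule prob_space_kernel_law)
  have map: "relabel_pair r \<in> Q \<rightarrow>\<^sub>M ordering_pairs"
    using measurable_map_relabel[OF r] unfolding measurable_cong_sets[OF sets_kernel_law refl] .
  show "prob_space (distr Q ordering_pairs (relabel_pair r))"
    by (rule Q.prob_space_distr[OF map])
  fix A B assume A[measurable]: "A \<in> sets ordering_space" and B[measurable]: "B \<in> sets ordering_space"
  note rel[measurable] = measurable_relabel[OF bij_is_inj[OF r]]
  define A' B' where "A' = relabel r -` A \<inter> orderings" and "B' = relabel r -` B \<inter> orderings"
  have A': "A' \<in> sets ordering_space" and B': "B' \<in> sets ordering_space"
    using measurable_sets[OF rel A] measurable_sets[OF rel B] by (simp_all add: A'_def B'_def)
  \<comment> \<open>The commutation relation speaks of images, so it is applied to the preimage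
    \<open>B'\<close>, whose image is \<open>B\<close> again.\<close>
  have img: "relabel r ` B' = B"
  proof
    show "relabel r ` B' \<subseteq> B" by (auto simp: B'_def)
    show "B \<subseteq> relabel r ` B'"
    proof
      fix R assume R: "R \<in> B"
      then have "R \<in> orderings" using sets.sets_into_space[OF B] by auto
      then have "relabel (inv r) R \<in> B'"
        using R r by (auto simp: B'_def relabel_inv intro!: relabel_in_orderings bij_is_inj bij_imp_bij_inv)
      then show "R \<in> relabel r ` B'"
        using relabel_inv(2)[OF r, of R] by (metis imageI)
    qed
  qed
  note [measurable] = measurable_kernel_measure[OF \<kappa> B] measurable_kernel_measure[OF \<kappa> B'] A'
  have "measure (distr Q ordering_pairs (relabel_pair r)) (A \<times> B)
      = measure Q (A' \<times> B')"
    by (subst measure_distr[OF map]) (auto simp: space_kernel_law A'_def B'_def intro!: arg_cong[where f = "measure Q"])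
  also have "\<dots> = (\<integral>R. indicator A' R * measure (\<kappa> R) B' \<partial>uniform_ordering)"
    by (rule measure_kernel_law[OF A' B'])
  also have "\<dots> = (\<integral>R. indicator A (relabel r R) * measure (\<kappa> (relabel r R)) B \<partial>uniform_ordering)"
  proof (intro integral_cong_AE)
    have "AE R in uniform_ordering. emeasure (\<kappa> (relabel r R)) (relabel r ` B') = emeasure (\<kappa> R) B'"
      using comm r B' by (simp add: commutes_with_relabelling_def)
    moreover have "AE R in uniform_ordering. R \<in> orderings"
      using AE_space[of uniform_ordering] by simp
    ultimately show "AE R in uniform_ordering. indicator A' R * measure (\<kappa> R) B' = indicator A (relabel r R) * measure (\<kappa> (relabel r R)) B"
    proof eventually_elim
      case (elim R)
      then have "R \<in> A' \<longleftrightarrow> relabel r R \<in> A" by (simp add: A'_def)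
      with elim show ?case
        by (simp add: img measure_def indicator_def)
    qed
  qed measurable
  also have "\<dots> = (\<integral>R. indicator A R * measure (\<kappa> R) B \<partial>distr uniform_ordering ordering_space (relabel r))"
    by (rule integral_distr[symmetric]) measurable
  also have "\<dots> = measure Q (A \<times> B)"
    by (simp add: distr_uniform_ordering_relabel[OF r] measure_kernel_law[OF A B])
  finally show "measure (distr Q ordering_pairs (relabel_pair r)) (A \<times> B)
      = measure Q (A \<times> B)" .
qed simp

text \<open>Both projections intertwine the relabelling of pairs with that of orderings, so each
  marginal is invariant; uniqueness of the invariant law then gives the second marginal without any
  information on the values of \<kappa>.\<close>

lemma kernel_law_marginal:
  assumes f: "f = fst \<or> f = snd"
  shows "distr Q ordering_space f = uniform_ordering"
proof (rule relabel_invariant_eq_uniform_ordering)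
  interpret Q: prob_space Q by (rule prob_space_kernel_law)
  have f_meas: "f \<in> ordering_pairs \<rightarrow>\<^sub>M ordering_space"
    using f by auto
  then have f_meas': "f \<in> Q \<rightarrow>\<^sub>M ordering_space"
    unfolding measurable_cong_sets[OF sets_kernel_law refl] .
  show "prob_space (distr Q ordering_space f)"
    by (rule Q.prob_space_distr[OF f_meas'])
  fix r :: "nat \<Rightarrow> nat" assume r: "bij r"
  have map: "relabel_pair r \<in> Q \<rightarrow>\<^sub>M ordering_pairs"
    using measurable_map_relabel[OF r] unfolding measurable_cong_sets[OF sets_kernel_law refl] .
  have "distr (distr Q ordering_space f) ordering_space (relabel r) = distr Q ordering_space (\<lambda>x. relabel r (f x))"
    by (subst distr_distr[OF measurable_relabel[OF bij_is_inj[OF r]] f_meas']) (simp add: comp_def)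
  also have "(\<lambda>x. relabel r (f x)) = f \<circ> relabel_pair r"
    using f by auto
  also have "distr Q ordering_space \<dots> = distr (distr Q ordering_pairs (relabel_pair r)) ordering_space f"
    by (rule distr_distr[OF f_meas map, symmetric])
  finally show "distr (distr Q ordering_space f) ordering_space (relabel r) = distr Q ordering_space f"
    by (simp only: distr_kernel_law_relabel[OF r])
qed simp

lemma AE_kernel_law_marginal:
  assumes "AE R in uniform_ordering. P R"
  shows "AE x in Q. P (fst x) \<and> P (snd x)"
proof -
  have "fst \<in> Q \<rightarrow>\<^sub>M ordering_space" "snd \<in> Q \<rightarrow>\<^sub>M ordering_space"
    by measurable
  moreover have "AE R in distr Q ordering_space fst. P R" "AE R in distr Q ordering_space snd. P R"
    using assms by (simp_all only: kernel_law_marginal simp_thms)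
  ultimately have "AE x in Q. P (fst x)" "AE x in Q. P (snd x)"
    using AE_distrD[of fst Q ordering_space P] AE_distrD[of snd Q ordering_space P] by blast+
  then show ?thesis by eventually_elim simp
qed

definition rank_law :: "(nat \<Rightarrow> real \<times> real) measure" where
  "rank_law = distr Q square_sequence rank_pairs"

lemma measurable_rank_pairs_kernel_law [measurable]: "rank_pairs \<in> Q \<rightarrow>\<^sub>M square_sequence"
  using measurable_rank_pairs unfolding measurable_cong_sets[OF sets_kernel_law refl] .

text \<open>Relabelling by a transposition permutes the ranks almost surely, so invariance of
  \<open>Q\<close> turns into exchangeability; both marginals being \<lambda> makes the coordinates
  typical.\<close>

lemma exchangeable_rank_law: "exchangeable_pairs rank_law"
proof -
  interpret Q: prob_space Q by (rule prob_space_kernel_law)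
  interpret prob_space rank_law
    unfolding rank_law_def by (rule Q.prob_space_distr[OF measurable_rank_pairs_kernel_law])
  show ?thesis
  proof
    show "sets rank_law = sets square_sequence"
      by (simp add: rank_law_def)
    fix i l
    let ?r = "Transposition.transpose i l :: nat \<Rightarrow> nat"
    have r: "bij ?r" by simp
    have map: "relabel_pair ?r \<in> Q \<rightarrow>\<^sub>M ordering_pairs"
      using measurable_map_relabel[OF r] unfolding measurable_cong_sets[OF sets_kernel_law refl] .
    have perm: "(\<lambda>z k. z (?r k)) \<in> square_sequence \<rightarrow>\<^sub>M square_sequence"
      by (rule measurable_PiM_UNIV) measurable
    have "distr rank_law square_sequence (\<lambda>z k. z (?r k)) = distr Q square_sequence (\<lambda>x k. rank_pairs x (?r k))"
      unfolding rank_law_def by (subst distr_distr[OF perm measurable_rank_pairs_kernel_law]) (simp add: comp_def)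
    also have "\<dots> = distr Q square_sequence (\<lambda>x. rank_pairs (relabel_pair ?r x))"
    proof (intro distr_cong_AE refl)
      show "AE x in Q. (\<lambda>k. rank_pairs x (?r k)) = rank_pairs (relabel_pair ?r x)"
        using AE_kernel_law_marginal[OF AE_rank_relabel[OF r]]
        by eventually_elim (simp add: rank_pairs_def fun_eq_iff)
      show "(\<lambda>x k. rank_pairs x (?r k)) \<in> Q \<rightarrow>\<^sub>M square_sequence"
        by (rule measurable_compose[OF measurable_rank_pairs_kernel_law perm])
      show "(\<lambda>x. rank_pairs (relabel_pair ?r x)) \<in> Q \<rightarrow>\<^sub>M square_sequence"
        by (rule measurable_compose[OF map measurable_rank_pairs])
    qed
    also have "\<dots> = distr (distr Q ordering_pairs (relabel_pair ?r)) square_sequence rank_pairs"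
      by (subst distr_distr[OF measurable_rank_pairs map]) (simp add: comp_def)
    finally show "distr rank_law square_sequence (\<lambda>z k. z (?r k)) = rank_law"
      by (simp only: distr_kernel_law_relabel[OF r] rank_law_def)
  next
    have [measurable]: "Measurable.pred square_sequence (\<lambda>z. typical (\<lambda>k. fst (z k)))"
      "Measurable.pred square_sequence (\<lambda>z. typical (\<lambda>k. snd (z k)))"
    proof -
      have "(\<lambda>z k. fst (z k)) \<in> square_sequence \<rightarrow>\<^sub>M (\<Pi>\<^sub>M k\<in>UNIV. borel)" "(\<lambda>z k. snd (z k)) \<in> square_sequence \<rightarrow>\<^sub>M (\<Pi>\<^sub>M k\<in>UNIV. borel)"
        by (rule measurable_PiM_UNIV, measurable)+
      then show "Measurable.pred square_sequence (\<lambda>z. typical (\<lambda>k. fst (z k)))"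
        "Measurable.pred square_sequence (\<lambda>z. typical (\<lambda>k. snd (z k)))"
        by (auto intro: measurable_compose[OF _ measurable_typical])
    qed
    show "AE z in rank_law. typical (\<lambda>k. fst (z k)) \<and> typical (\<lambda>k. snd (z k))"
      unfolding rank_law_def
    proof (subst AE_distr_iff)
      have "AE R in uniform_ordering. typical (limit_rank R)"
        using AE_uniform_ordering by eventually_elim simp
      from AE_kernel_law_marginal[OF this]
      show "AE x in Q. typical (\<lambda>k. fst (rank_pairs x k)) \<and> typical (\<lambda>k. snd (rank_pairs x k))"
        by eventually_elim (simp add: rank_pairs_def)
    qed measurable
  qed
qed

interpretation exchangeable_pairs rank_law
  by (rule exchangeable_rank_law)

text \<open>Passing to ranks loses no information: under either marginal the ordering of the ranks
  is almost surely the original ordering.\<close>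

lemma distr_rank_law: "distr rank_law ordering_pairs orderings_of_pairs = Q"
proof -
  have "distr rank_law ordering_pairs orderings_of_pairs
      = distr Q ordering_pairs (\<lambda>x. orderings_of_pairs (rank_pairs x))"
    unfolding rank_law_def
    by (subst distr_distr[OF measurable_orderings_of_pairs measurable_rank_pairs_kernel_law]) (simp add: comp_def)
  also have "\<dots> = distr Q Q (\<lambda>x. x)"
  proof (intro distr_cong_AE refl sets_kernel_law[symmetric])
    have "AE R in uniform_ordering. ordering_of (limit_rank R) = R"
      using AE_uniform_ordering by eventually_elim simp
    from AE_kernel_law_marginal[OF this] show "AE x in Q. orderings_of_pairs (rank_pairs x) = x"
      by eventually_elim (auto simp: orderings_of_pairs_def rank_pairs_def prod_eq_iff)
    show "(\<lambda>x. orderings_of_pairs (rank_pairs x)) \<in> Q \<rightarrow>\<^sub>M ordering_pairs"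
      by (rule measurable_compose[OF measurable_rank_pairs_kernel_law measurable_orderings_of_pairs])
  qed measurable
  finally show ?thesis by (simp add: distr_id)
qed

section \<open>The mixing measure and the mixture identity\<close>

definition mixing_measure :: "(real \<times> real) measure measure" where
  "mixing_measure = distr rank_law coupling_space (\<lambda>z. copula_measure (limit_copula z))"

lemma measurable_limit_coupling: "(\<lambda>z. copula_measure (limit_copula z)) \<in> rank_law \<rightarrow>\<^sub>M coupling_space"
  unfolding measurable_cong_sets[OF sets_\<zeta> refl]
  by (intro measurable_into_coupling_space measurable_copula_measure measurable_limit_copula)
    (auto intro: copula_measure_coupling copula_limit_copula)

lemma prob_space_mixing_measure: "prob_space mixing_measure"
  unfolding mixing_measure_def by (rule prob_space_distr[OF measurable_limit_coupling])

lemma sets_mixing_measure [measurable_cong]: "sets mixing_measure = sets coupling_space"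
  by (simp add: mixing_measure_def)

lemma measurable_emeasure_coupling_hat:
  assumes "B \<in> sets ordering_space"
  shows "(\<lambda>x. emeasure (coupling_hat (fst x) (snd x)) B) \<in> borel_measurable (coupling_space \<Otimes>\<^sub>M ordering_space)"
  by (rule measurable_compose[OF measurable_prob_algebraD[OF measurable_coupling_hat]
      measurable_emeasure_subprob_algebra[OF assms]])

lemma measurable_mixture:
  assumes B: "B \<in> sets ordering_space"
  shows "(\<lambda>R. \<integral>\<^sup>+\<nu>. emeasure (coupling_hat \<nu> R) B \<partial>mixing_measure) \<in> borel_measurable ordering_space"
proof -
  interpret \<alpha>: prob_space mixing_measure by (rule prob_space_mixing_measure)
  have "(\<lambda>(R, \<nu>). emeasure (coupling_hat \<nu> R) B) \<in> borel_measurable (ordering_space \<Otimes>\<^sub>M mixing_measure)"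
    using measurable_compose[OF measurable_pair_swap' measurable_emeasure_coupling_hat[OF B]]
    by (simp add: case_prod_unfold cong: measurable_cong_sets)
  then show ?thesis
    by (rule \<alpha>.borel_measurable_nn_integral[of "\<lambda>R \<nu>. emeasure (coupling_hat \<nu> R) B"])
qed

text \<open>For fixed \<open>B\<close> both sides are densities with respect to \<lambda>, so their
  integrals over \<open>A\<close> are compared. De Finetti's theorem expands \<open>Q\<close> on
  \<open>A \<times> B\<close> over product measures, \<open>coupling_hat\<close> disintegrates each
  of them, and Fubini moves the mixture inside.\<close>

lemma AE_mixture:
  assumes B: "B \<in> sets ordering_space"
  shows "AE R in uniform_ordering. emeasure (\<kappa> R) B = (\<integral>\<^sup>+\<nu>. emeasure (coupling_hat \<nu> R) B \<partial>mixing_measure)"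
proof (rule uniform_ordering.density_unique2)
  interpret \<alpha>: prob_space mixing_measure by (rule prob_space_mixing_measure)
  interpret pair_sigma_finite mixing_measure uniform_ordering ..
  show "(\<lambda>R. emeasure (\<kappa> R) B) \<in> borel_measurable uniform_ordering"
    using measurable_compose[OF measurable_prob_algebraD[OF \<kappa>] measurable_emeasure_subprob_algebra[OF B]] by simp
  show "(\<lambda>R. \<integral>\<^sup>+\<nu>. emeasure (coupling_hat \<nu> R) B \<partial>mixing_measure) \<in> borel_measurable uniform_ordering"
    using measurable_mixture[OF B] by simp
  fix A assume "A \<in> sets uniform_ordering"
  then have A[measurable]: "A \<in> sets ordering_space" by simp
  define h where "h \<nu> R = indicator A R * emeasure (coupling_hat \<nu> R) B" for \<nu> R
  have h[measurable]: "(\<lambda>(\<nu>, R). h \<nu> R) \<in> borel_measurable (coupling_space \<Otimes>\<^sub>M ordering_space)"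
    using measurable_emeasure_coupling_hat[OF B] unfolding h_def case_prod_unfold by measurable
  have AB: "A \<times> B \<in> sets ordering_pairs"
    using A B by simp
  define E where "E = orderings_of_pairs -` (A \<times> B) \<inter> space square_sequence"
  have E: "E \<in> sets square_sequence"
    unfolding E_def by (rule measurable_sets[OF measurable_orderings_of_pairs AB])
  have pair: "emeasure (\<Pi>\<^sub>M k\<in>UNIV. \<nu>) E = (\<integral>\<^sup>+R. h \<nu> R \<partial>uniform_ordering)" if \<nu>: "\<nu> \<in> uniform_couplings" for \<nu>
  proof -
    interpret P: prob_space "pair_law \<nu>" by (rule prob_space_pair_law[OF \<nu>])
    have hat: "ordering_kernel (coupling_hat \<nu>)" by (rule ordering_kernel_coupling_hat[OF \<nu>])
    have "emeasure (\<Pi>\<^sub>M k\<in>UNIV. \<nu>) E = emeasure (pair_law \<nu>) (A \<times> B)"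
      unfolding pair_law_def E_def
      by (subst emeasure_distr[OF measurable_orderings_of_pairs_coupling[OF \<nu>] AB])
        (simp add: sets_eq_imp_space_eq[OF sets_PiM_square[OF uniform_couplingsD(2)[OF \<nu>]]])
    also have "\<dots> = ennreal (\<integral>R. indicator A R * measure (coupling_hat \<nu> R) B \<partial>uniform_ordering)"
      using disintegrates_coupling_hat[OF \<nu>] A B by (simp add: P.emeasure_eq_measure disintegrates_def)
    also have "\<dots> = (\<integral>\<^sup>+R. ennreal (indicator A R * measure (coupling_hat \<nu> R) B) \<partial>uniform_ordering)"
      by (intro nn_integral_eq_integral[symmetric] integrable_kernel_measure hat A B) auto
    also have "\<dots> = (\<integral>\<^sup>+R. h \<nu> R \<partial>uniform_ordering)"
    proof (intro nn_integral_cong)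
      fix R assume "R \<in> space uniform_ordering"
      then have "finite_measure (coupling_hat \<nu> R)"
        using ordering_kernelD(1)[OF hat] by (simp add: prob_space.finite_measure)
      then show "ennreal (indicator A R * measure (coupling_hat \<nu> R) B) = h \<nu> R"
        by (simp add: h_def finite_measure.emeasure_eq_measure indicator_def)
    qed
    finally show ?thesis .
  qed
  have "(\<integral>\<^sup>+R\<in>A. emeasure (\<kappa> R) B \<partial>uniform_ordering) = emeasure Q (A \<times> B)"
    by (simp add: emeasure_kernel_law[OF A B] mult.commute)
  also have "\<dots> = emeasure rank_law E"
    unfolding distr_rank_law[symmetric] E_def
    by (subst emeasure_distr) (use AB measurable_orderings_of_pairs in \<open>auto simp: sets_eq_imp_space_eq[OF sets_\<zeta>] cong: measurable_cong_sets\<close>)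
  also have "\<dots> = (\<integral>\<^sup>+z. emeasure (\<Pi>\<^sub>M k\<in>UNIV. copula_measure (limit_copula z)) E \<partial>rank_law)"
    by (rule de_Finetti[OF E])
  also have "\<dots> = (\<integral>\<^sup>+z. (\<integral>\<^sup>+R. h (copula_measure (limit_copula z)) R \<partial>uniform_ordering) \<partial>rank_law)"
    by (simp add: pair copula_measure_coupling copula_limit_copula)
  also have "\<dots> = (\<integral>\<^sup>+\<nu>. (\<integral>\<^sup>+R. h \<nu> R \<partial>uniform_ordering) \<partial>mixing_measure)"
    unfolding mixing_measure_def
    by (subst nn_integral_distr[OF measurable_limit_coupling])
      (auto intro!: uniform_ordering.borel_measurable_nn_integral)
  also have "\<dots> = (\<integral>\<^sup>+R. (\<integral>\<^sup>+\<nu>. h \<nu> R \<partial>mixing_measure) \<partial>uniform_ordering)"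
    by (rule Fubini'[symmetric]) measurable
  also have "\<dots> = (\<integral>\<^sup>+R\<in>A. (\<integral>\<^sup>+\<nu>. emeasure (coupling_hat \<nu> R) B \<partial>mixing_measure) \<partial>uniform_ordering)"
    unfolding h_def by (intro nn_integral_cong) (simp add: indicator_def)
  finally show "(\<integral>\<^sup>+R\<in>A. emeasure (\<kappa> R) B \<partial>uniform_ordering)
      = (\<integral>\<^sup>+R\<in>A. (\<integral>\<^sup>+\<nu>. emeasure (coupling_hat \<nu> R) B \<partial>mixing_measure) \<partial>uniform_ordering)" .
qed

text \<open>
  On a null set of orderings the identity may fail; there every version is redefined to be \<open>\<kappa>\<close> itself.
\<close>

lemma ex_mixture:
  "\<exists>(\<alpha> :: (real \<times> real) measure measure) (\<nu>hat :: (real \<times> real) measure \<Rightarrow> nat rel \<Rightarrow> nat rel measure).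
     prob_space \<alpha> \<and> sets \<alpha> = sets coupling_space \<and>
     (\<forall>\<nu>\<in>uniform_couplings. coupling_kernel_version \<nu> (\<nu>hat \<nu>)) \<and>
     (\<forall>A\<in>sets ordering_space.
        (\<lambda>(\<nu>, R). emeasure (\<nu>hat \<nu> R) A) \<in> borel_measurable (coupling_space \<Otimes>\<^sub>M ordering_space)) \<and>
     (\<forall>R\<in>orderings. \<forall>A\<in>sets ordering_space.
        emeasure (\<kappa> R) A = (\<integral>\<^sup>+\<nu>. emeasure (\<nu>hat \<nu> R) A \<partial>\<alpha>))"
proof -
  interpret \<alpha>: prob_space mixing_measure by (rule prob_space_mixing_measure)
  let ?cyl = "\<lambda>F. {R \<in> orderings. F \<subseteq> R}"
  have cyl: "?cyl F \<in> sets ordering_space" if "finite F" for F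
    unfolding sets_ordering_space_cylinders using that by (intro sigma_sets.Basic) auto
  \<comment> \<open>Each event has its own null set; only countably many cylinders are treated, so
    one null set \<open>N\<close> covers them all.\<close>
  have "AE R in uniform_ordering. \<forall>F\<in>Collect finite.
      emeasure (\<kappa> R) (?cyl F) = (\<integral>\<^sup>+\<nu>. emeasure (coupling_hat \<nu> R) (?cyl F) \<partial>mixing_measure)"
    by (subst AE_ball_countable) (auto intro: countable_Collect_finite AE_mixture cyl)
  then obtain N where N: "N \<in> sets uniform_ordering" "emeasure uniform_ordering N = 0"
    and eq: "\<And>R F. R \<in> orderings \<Longrightarrow> R \<notin> N \<Longrightarrow> finite F \<Longrightarrow>
      emeasure (\<kappa> R) (?cyl F) = (\<integral>\<^sup>+\<nu>. emeasure (coupling_hat \<nu> R) (?cyl F) \<partial>mixing_measure)"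
    by (rule AE_E) auto
  have N_sets[measurable]: "N \<in> sets ordering_space"
    using N(1) by simp
  have N_AE: "AE R in uniform_ordering. R \<notin> N"
    using N by (intro AE_not_in null_setsI)
  have mixture: "emeasure (\<kappa> R) A = (\<integral>\<^sup>+\<nu>. emeasure (coupling_hat \<nu> R) A \<partial>mixing_measure)"
    if R: "R \<in> orderings" "R \<notin> N" and A: "A \<in> sets ordering_space" for R A
  proof -
    have \<alpha>: "mixing_measure \<in> space (prob_algebra coupling_space)"
      using \<alpha>.prob_space_axioms sets_mixing_measure by (simp add: space_prob_algebra)
    have K: "(\<lambda>\<nu>. coupling_hat \<nu> R) \<in> coupling_space \<rightarrow>\<^sub>M prob_algebra ordering_space"
      using measurable_compose[OF measurable_Pair2'[of R ordering_space coupling_space] measurable_coupling_hat] R by simp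
    note bind = emeasure_bind_prob_algebra[OF \<alpha> K]
    \<comment> \<open>Off \<open>N\<close> both sides are measures in the event, so agreement on
      cylinders extends to every measurable event.\<close>
    have "\<kappa> R = bind mixing_measure (\<lambda>\<nu>. coupling_hat \<nu> R)"
    proof (rule measure_eqI_ordering_space)
      show "sets (\<kappa> R) = sets ordering_space"
        by (rule ordering_kernelD(2)[OF \<kappa> R(1)])
      show "finite_measure (\<kappa> R)"
        by (rule prob_space.finite_measure[OF ordering_kernelD(1)[OF \<kappa> R(1)]])
      show "emeasure (\<kappa> R) (?cyl F) = emeasure (bind mixing_measure (\<lambda>\<nu>. coupling_hat \<nu> R)) (?cyl F)" if "finite F" for F
        using eq[OF R that] by (simp add: bind[OF cyl[OF that]])
    qed (rule sets_bind'[OF \<alpha> K])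
    then have "emeasure (\<kappa> R) A = emeasure (bind mixing_measure (\<lambda>\<nu>. coupling_hat \<nu> R)) A" by simp
    then show ?thesis by (simp add: bind[OF A])
  qed
  define \<nu>hat where "\<nu>hat \<nu> R = (if R \<in> N then \<kappa> R else coupling_hat \<nu> R)" for \<nu> R
  have version: "coupling_kernel_version \<nu> (\<nu>hat \<nu>)" if \<nu>: "\<nu> \<in> uniform_couplings" for \<nu>
  proof -
    note hat = ordering_kernel_coupling_hat[OF \<nu>]
    have kernel: "ordering_kernel (\<nu>hat \<nu>)"
      unfolding \<nu>hat_def by (intro measurable_If_set \<kappa> hat sets.Int N_sets sets.top)
    \<comment> \<open>The change takes place on a \<lambda>-null set of orderings that does not
      depend on \<nu>, so the integrals over \<lambda> keep their values.\<close>
    have dis: "disintegrates (pair_law \<nu>) (\<nu>hat \<nu>)"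
      unfolding disintegrates_def
    proof (intro conjI ballI kernel)
      fix A B assume A[measurable]: "A \<in> sets ordering_space" and B: "B \<in> sets ordering_space"
      note [measurable] = measurable_kernel_measure[OF kernel B] measurable_kernel_measure[OF hat B]
      have "measure (pair_law \<nu>) (A \<times> B) = (\<integral>R. indicator A R * measure (coupling_hat \<nu> R) B \<partial>uniform_ordering)"
        using disintegrates_coupling_hat[OF \<nu>] A B by (simp add: disintegrates_def)
      also have "\<dots> = (\<integral>R. indicator A R * measure (\<nu>hat \<nu> R) B \<partial>uniform_ordering)"
      proof (intro integral_cong_AE)
        show "AE R in uniform_ordering. indicator A R * measure (coupling_hat \<nu> R) B = indicator A R * measure (\<nu>hat \<nu> R) B"
          using N_AE by eventually_elim (simp add: \<nu>hat_def)
      qed measurable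
      finally show "measure (pair_law \<nu>) (A \<times> B) = (\<integral>R. indicator A R * measure (\<nu>hat \<nu> R) B \<partial>uniform_ordering)" .
    qed
    let ?P = "\<Pi>\<^sub>M k\<in>(UNIV :: nat set). \<nu>"
    have P: "prob_space ?P"
      using uniform_couplingsD(1)[OF \<nu>] by (intro prob_space_PiM)
    note pairs = measurable_orderings_of_pairs_coupling[OF \<nu>]
    have X: "(\<lambda>z. ordering_of (\<lambda>k. fst (z k))) \<in> ?P \<rightarrow>\<^sub>M ordering_space"
      using measurable_compose[OF pairs measurable_fst] by (simp add: orderings_of_pairs_def)
    have Y: "(\<lambda>z. ordering_of (\<lambda>k. snd (z k))) \<in> ?P \<rightarrow>\<^sub>M ordering_space"
      using measurable_compose[OF pairs measurable_snd] by (simp add: orderings_of_pairs_def)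
    have law: "distr ?P ordering_space (\<lambda>z. ordering_of (\<lambda>k. fst (z k))) = uniform_ordering"
      unfolding distr_fst_pair_law[OF \<nu>, symmetric] pair_law_def
      by (subst distr_distr[OF measurable_fst pairs]) (simp add: comp_def orderings_of_pairs_def)
    show ?thesis
      unfolding coupling_kernel_version_def coupling_kernel_def regular_cond_prob_iff_disintegrates[OF P X Y law]
      using dis by (simp add: pair_law_def orderings_of_pairs_def[abs_def])
  qed
  show ?thesis
  proof (intro exI[of _ mixing_measure] exI[of _ \<nu>hat] conjI ballI version)
    fix A assume A: "A \<in> sets ordering_space"
    note [measurable] = measurable_emeasure_coupling_hat[OF A]
      measurable_compose[OF measurable_prob_algebraD[OF \<kappa>] measurable_emeasure_subprob_algebra[OF A]]
    have "(\<lambda>x. if snd x \<in> N then emeasure (\<kappa> (snd x)) A else emeasure (coupling_hat (fst x) (snd x)) A)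
        \<in> borel_measurable (coupling_space \<Otimes>\<^sub>M ordering_space)"
      by measurable
    then show "(\<lambda>(\<nu>, R). emeasure (\<nu>hat \<nu> R) A) \<in> borel_measurable (coupling_space \<Otimes>\<^sub>M ordering_space)"
      by (simp add: \<nu>hat_def case_prod_unfold if_distrib[where f = "\<lambda>\<mu>. emeasure \<mu> A"])
  next
    fix R A assume "R \<in> orderings" "A \<in> sets ordering_space"
    \<comment> \<open>On \<open>N\<close> the integrand does not depend on \<nu>, and the mixing
      measure has total mass 1.\<close>
    then show "emeasure (\<kappa> R) A = (\<integral>\<^sup>+\<nu>. emeasure (\<nu>hat \<nu> R) A \<partial>mixing_measure)"
      using mixture[of R A] by (cases "R \<in> N") (simp_all add: \<nu>hat_def \<alpha>.emeasure_space_1)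
  qed (rule prob_space_mixing_measure sets_mixing_measure)+
qed

end

theorem theorem4p2:
  shows "(\<forall>\<nu>\<in>uniform_couplings. \<forall>(M :: 'a measure) U V \<kappa>.
            iid_pairs M U V \<nu> \<and> coupling_kernel M U V \<kappa> \<longrightarrow> commutes_with_relabelling \<kappa>)
       \<and> (\<forall>\<kappa>. ordering_kernel \<kappa> \<and> commutes_with_relabelling \<kappa> \<longrightarrow>
            (\<exists>(\<alpha> :: (real \<times> real) measure measure)
              (\<nu>hat :: (real \<times> real) measure \<Rightarrow> nat rel \<Rightarrow> nat rel measure).
               prob_space \<alpha> \<and> sets \<alpha> = sets coupling_space \<and>
               (\<forall>\<nu>\<in>uniform_couplings. coupling_kernel_version \<nu> (\<nu>hat \<nu>)) \<and>
               (\<forall>A\<in>sets ordering_space.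
                  (\<lambda>(\<nu>, R). emeasure (\<nu>hat \<nu> R) A)
                    \<in> borel_measurable (coupling_space \<Otimes>\<^sub>M ordering_space)) \<and>
               (\<forall>R\<in>orderings. \<forall>A\<in>sets ordering_space.
                  emeasure (\<kappa> R) A = (\<integral>\<^sup>+\<nu>. emeasure (\<nu>hat \<nu> R) A \<partial>\<alpha>))))"
  using coupling_kernel_commutes ex_mixture by blast

end
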